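(* Let $d\geq 1$ and $n\geq 0$ be integers. For a sufficiently general symmetric tensor $f\in S^d\mathbb{R}^{n+1}$ and any natural number $k$, any real symmetric tensor of real symmetric rank at most $k$ closest to $f$ in the Frobenius norm (i.e. any minimizer of the Frobenius distance to $f$ among all real symmetric tensors of real symmetric rank at most $k$) lies in the complex linear span of the complex critical symmetric rank-one tensors for $f$. In particular, $f$ itself lies in the linear span of the complex critical symmetric rank-one tensors for $f$.
   Context: "Sufficiently general" means: there is a proper real algebraic (Zariski-closed) subset of $S^d\mathbb{R}^{n+1}$, depending only on $d$ and $n$, such that the assertion holds for every $f$ outside it. The real symmetric rank of $t\in S^d\mathbb{R}^{n+1}$ is the minimum $k$ such that $t=\sum_{i=1}^k\lambda_iv_i^d$ with $\lambda_i\in\mathbb{R}$ and $v_i\in\mathbb{R}^{n+1}$. The Frobenius norm is the Euclidean norm induced by the unique inner product on $S^d\mathbb{R}^{n+1}$ with $(v^d|w^d)=(v|w)^d$, where $(\cdot|\cdot)$ on $\mathbb{R}^{n+1}$ is the standard inner product. Let $T=S^d\mathbb{C}^{n+1}$ be the complexification, with the complex-bilinear (not Hermitian) extension $(\cdot|\cdot)$ of this inner product, and let $X=\{v^d:v\in\mathbb{C}^{n+1}\}\subseteq T$, a closed subvariety. A complex critical symmetric rank-one tensor for $f$ is an $x\in X\setminus\{0\}$ such that $(f-x|y)=0$ for all $y$ in the tangent space $T_xX\subseteq T$. *)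

theory Defs
  imports "HOL-Analysis.Analysis"
begin

text \<open>
  Tensors of order \<open>d = CARD('d)\<close> over \<open>K\<^sup>n\<^sup>+\<^sup>1\<close>, where \<open>n + 1 = CARD('n)\<close>, are given by their
  coordinates: the entry at \<open>i :: 'd \<Rightarrow> 'n\<close> is the coefficient of the tensor product of the
  standard basis vectors \<open>e (i k)\<close>, \<open>k :: 'd\<close>. The types \<open>'d\<close> and \<open>'n\<close> are arbitrary finite
  (nonempty) types, so all \<open>d \<ge> 1\<close> and \<open>n \<ge> 0\<close> are covered.
\<close>

definition symmetric_tensors :: "('a ^ ('d::finite \<Rightarrow> 'n::finite)) set" where
  "symmetric_tensors = {t. \<forall>p i. bij p \<longrightarrow> t $ (i \<circ> p) = t $ i}"

definition tensor_power :: "'a::comm_semiring_1 ^ 'n::finite \<Rightarrow> 'a ^ ('d::finite \<Rightarrow> 'n)" where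
  "tensor_power v = (\<chi> i. \<Prod>k\<in>UNIV. v $ i k)"

lemma tensor_power_symmetric: "tensor_power v \<in> symmetric_tensors"
proof -
  have "(\<Prod>k\<in>UNIV. v $ i (p k)) = (\<Prod>k\<in>UNIV. v $ i k)" if "bij p" for p :: "'b \<Rightarrow> 'b" and i
    using prod.reindex_bij_betw[OF that, of "\<lambda>k. v $ i k"] by simp
  then show ?thesis
    by (simp add: symmetric_tensors_def tensor_power_def)
qed

definition bilinear_form :: "'a::comm_semiring_1 ^ 'm::finite \<Rightarrow> 'a ^ 'm \<Rightarrow> 'a" where
  "bilinear_form s t = (\<Sum>i\<in>UNIV. s $ i * t $ i)"

definition complexify :: "real ^ 'm::finite \<Rightarrow> complex ^ 'm" where
  "complexify t = (\<chi> i. complex_of_real (t $ i))"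

lemma bilinear_form_tensor_power:
  fixes v w :: "'a::comm_semiring_1 ^ 'n::finite"
  shows "bilinear_form (tensor_power v :: 'a ^ ('d::finite \<Rightarrow> 'n)) (tensor_power w)
           = bilinear_form v w ^ CARD('d)"
proof -
  have "(\<Prod>k\<in>(UNIV::'d set). \<Sum>j\<in>UNIV. v $ j * w $ j)
      = (\<Sum>i\<in>Pi\<^sub>E (UNIV::'d set) (\<lambda>_. UNIV). \<Prod>k\<in>UNIV. v $ i k * w $ i k)"
    by (rule prod_sum_PiE) auto
  then show ?thesis
    by (simp add: bilinear_form_def tensor_power_def prod.distrib)
qed

text \<open>
  The next two facts show that the Euclidean inner product of \<open>real ^ ('d \<Rightarrow> 'n)\<close>, restricted to
  the symmetric tensors, is the one inducing the Frobenius norm, and that \<open>bilinear_form\<close> on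
  complex tensors is its complex-bilinear extension.
\<close>

lemma inner_tensor_power:
  fixes v w :: "real ^ 'n::finite"
  shows "(tensor_power v :: real ^ ('d::finite \<Rightarrow> 'n)) \<bullet> tensor_power w = (v \<bullet> w) ^ CARD('d)"
  using bilinear_form_tensor_power[of v w] by (simp add: inner_vec_def bilinear_form_def)

lemma bilinear_form_complexify:
  "bilinear_form (complexify s) (complexify t) = complex_of_real (s \<bullet> t)"
  by (simp add: bilinear_form_def complexify_def inner_vec_def)

text \<open>
  The minimum below is over a nonempty set for every symmetric \<open>t\<close>, since powers span the
  symmetric tensors; on other tensors the value has no meaning.
\<close>

definition real_symmetric_rank :: "real ^ ('d::finite \<Rightarrow> 'n::finite) \<Rightarrow> nat" where
  "real_symmetric_rank t =
     (LEAST k. \<exists>(c :: nat \<Rightarrow> real) (v :: nat \<Rightarrow> real ^ 'n).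
        t = (\<Sum>i<k. c i *\<^sub>R tensor_power (v i)))"

text \<open>
  Zariski-closed subsets of a linear subspace \<open>V\<close>: polynomial functions on \<open>V\<close> are the restrictions
  of polynomial functions on the surrounding space.
\<close>

definition real_algebraic_subset_of :: "'v::real_normed_vector set \<Rightarrow> 'v set \<Rightarrow> bool" where
  "real_algebraic_subset_of V Z \<longleftrightarrow>
     (\<exists>P. (\<forall>p\<in>P. real_polynomial_function p) \<and> Z = {t \<in> V. \<forall>p\<in>P. p t = 0})"

inductive complex_polynomial_function :: "(complex ^ 'm::finite \<Rightarrow> complex) \<Rightarrow> bool" where
  coordinate: "complex_polynomial_function (\<lambda>t. t $ i)"
| const: "complex_polynomial_function (\<lambda>t. c)"
| add: "\<lbrakk>complex_polynomial_function p; complex_polynomial_function q\<rbrakk>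
          \<Longrightarrow> complex_polynomial_function (\<lambda>t. p t + q t)"
| mult: "\<lbrakk>complex_polynomial_function p; complex_polynomial_function q\<rbrakk>
          \<Longrightarrow> complex_polynomial_function (\<lambda>t. p t * q t)"

definition complex_powers :: "(complex ^ ('d::finite \<Rightarrow> 'n::finite)) set" where
  "complex_powers = range tensor_power"

text \<open>
  The (Zariski) tangent space of the variety \<open>X\<close> inside the space of symmetric tensors: the common
  kernel of the differentials at \<open>x\<close> of all polynomials vanishing on \<open>X\<close>.
\<close>

definition tangent_space ::
  "(complex ^ ('d::finite \<Rightarrow> 'n::finite)) set \<Rightarrow> complex ^ ('d \<Rightarrow> 'n) \<Rightarrow> (complex ^ ('d \<Rightarrow> 'n)) set"
  where
  "tangent_space X x =
     {y \<in> symmetric_tensors. \<forall>p. complex_polynomial_function p \<and> (\<forall>z\<in>X. p z = 0)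
        \<longrightarrow> frechet_derivative p (at x) y = 0}"

definition critical_rank_one_tensors ::
  "real ^ ('d::finite \<Rightarrow> 'n::finite) \<Rightarrow> (complex ^ ('d \<Rightarrow> 'n)) set" where
  "critical_rank_one_tensors f =
     {x \<in> complex_powers - {0}.
        \<forall>y \<in> tangent_space complex_powers x. bilinear_form (complexify f - x) y = 0}"

end

theory Submission
  imports Defs "HOL-Library.Function_Algebras"
    "HOL-Computational_Algebra.Fundamental_Theorem_Algebra"
begin

text \<open>
  Write \<open>f(v\<^sup>d\<^sup>-\<^sup>1 \<sqdot>)\<close> for the vector with entries \<open>contr k f l v\<close>. A power \<open>v\<^sup>d\<close> is critical for \<open>f\<close> iff
  \<open>f(v\<^sup>d\<^sup>-\<^sup>1 \<sqdot>) = (v|v)\<^sup>d\<^sup>-\<^sup>1 v\<close>, and up to scaling these are the non-isotropic solutions of the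
  eigenvector equations \<open>F\<^sub>i = f(v\<^sup>d\<^sup>-\<^sup>1 e\<^sub>i) - v\<^sub>i = 0\<close> when \<open>d \<ge> 3\<close>. Rotating the vectors in a decomposition of
  a best approximation \<open>g\<close> shows that \<open>g\<close> is orthogonal to \<open>A f\<close> for every skew-symmetric \<open>A\<close>.
  Dually, it suffices that a form \<open>u\<close> of degree \<open>d\<close> vanishing at all eigenvectors is such an \<open>A f\<close>.

  For general \<open>f\<close> the \<open>F\<^sub>i\<close> form a complete intersection with \<open>(d-1)\<^sup>n\<^sup>+\<^sup>1\<close> simple zeros. Both properties
  are expressed by the invertibility of matrices with entries polynomial in \<open>f\<close>, and are checked at one
  diagonal form. The Koszul relations give a normal form whose remainders are spanned by the
  monomials with all exponents below \<open>d - 1\<close>, so \<open>u\<close> lies in the ideal and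
  \<open>u = \<Sum> a\<^sub>i F\<^sub>i\<close> with \<open>a\<^sub>i\<close> of degree at most \<open>1\<close>; comparing homogeneous parts makes
  \<open>a\<^sub>i\<close> the rows of a skew-symmetric matrix. For \<open>d = 2\<close> the matrices of \<open>f\<close> and \<open>g\<close> commute and have a
  joint orthonormal eigenbasis.
\<close>

section \<open>Spaces of functions and polynomials\<close>

text \<open>The tensor \<open>f\<close> is real while zeros, ideals and critical tensors are
  complex, so every condition of general position has to become the nonvanishing of a real
  polynomial in the entries of \<open>f\<close>. Spanning by finitely many polynomially varying
  vectors is such a condition; membership in an ideal, with multipliers of unbounded degree, is not.
  This gap shapes the middle part: conditions of bounded degree control the whole ideal, because the
  operators of multiplication by the variables commute as soon as this can be seen with multipliers
  of degree \<open>2 * T + e + 2\<close>. Simplicity of the zeros is not a spanning condition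
  either; a test polynomial replaces it, the Jacobian determinant times (v|v), and one more spanning
  family certifies that it has no zero among the nonzero solutions. The factor (v|v) is there
  because an isotropic eigenvector cannot be rescaled to a critical power. The equations stay
  inhomogeneous: this fixes the scale of eigenvectors up to roots of unity, makes the zero set
  finite for general \<open>f\<close>, and leaves multipliers of \<open>u\<close> that are affine
  functions.\<close>

lemma sum_fun_eq: "sum f A = (\<lambda>x. \<Sum>i\<in>A. f i x)"
  by (induction A rule: infinite_finite_induct) (auto simp: fun_eq_iff)

text \<open>The argument type is arbitrary because two kinds of functions share what follows:
  polynomials on \<open>complex ^ 'n\<close>, and tuples of polynomials as functions of an index and
  a point.\<close>

definition fscale :: "complex \<Rightarrow> ('z \<Rightarrow> complex) \<Rightarrow> 'z \<Rightarrow> complex" where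
  "fscale c p = (\<lambda>x. c * p x)"

lemma fscale_apply [simp]: "fscale c p x = c * p x"
  by (simp add: fscale_def)

interpretation fn: vector_space fscale
  by unfold_locales (auto simp: fun_eq_iff algebra_simps)

interpretation fp: vector_space_pair fscale fscale
  by unfold_locales

abbreviation flinear :: "(('y \<Rightarrow> complex) \<Rightarrow> 'z \<Rightarrow> complex) \<Rightarrow> bool" where
  "flinear \<equiv> Vector_Spaces.linear fscale fscale"

lemma flinearI:
  assumes "\<And>p q. L (p + q) = L p + L q" "\<And>c p. L (fscale c p) = fscale c (L p)"
  shows "flinear L"
  using assms by (auto simp: Vector_Spaces.linear_iff fn.vector_space_axioms)

lemma flinear_sum: "flinear L \<Longrightarrow> L (sum g A) = (\<Sum>a\<in>A. L (g a))"
  by (rule fp.linear_sum)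

lemma flinear_mult_left: "flinear ((*) p)"
  by (rule flinearI) (auto simp: fun_eq_iff algebra_simps)

lemma span_induct_linear:
  assumes "p \<in> fn.span S" "flinear L" "\<And>s. s \<in> S \<Longrightarrow> L s \<in> fn.span T"
  shows "L p \<in> fn.span T"
proof -
  have "L ` S \<subseteq> fn.span T" using assms(3) by blast
  then have "fn.span (L ` S) \<subseteq> fn.span T" by (rule fn.span_minimal) (rule fn.subspace_span)
  then show ?thesis using assms(1) fp.linear_span_image[OF assms(2), of S] by blast
qed

text \<open>Coefficients belong to the indices in \<open>J\<close>, not to the values of
  \<open>g\<close>, so \<open>g\<close> may repeat a value.\<close>

lemma span_family:
  assumes "finite J" "p \<in> fn.span (g ` J)"
  shows "\<exists>c. p = (\<Sum>j\<in>J. fscale (c j) (g j))"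
  using assms(2)
proof (induction rule: fn.span_induct_alt)
  case base
  show ?case by (rule exI[of _ "\<lambda>_. 0"]) (simp add: fun_eq_iff)
next
  case (step a s q)
  then obtain j c where j: "j \<in> J" "s = g j" and c: "q = (\<Sum>j\<in>J. fscale (c j) (g j))" by blast
  have "fscale a s + q = (\<Sum>i\<in>J. fscale (c i + (if i = j then a else 0)) (g i))"
    using j assms(1) by (simp add: c fn.scale_left_distrib sum.distrib if_distrib[of "\<lambda>a. fscale a _"] cong: if_cong)
  then show ?case by (intro exI)
qed

section \<open>Monomials and their linear independence\<close>

definition mon :: "('n::finite \<Rightarrow> nat) \<Rightarrow> complex ^ 'n \<Rightarrow> complex" where
  "mon a x = (\<Prod>i\<in>UNIV. (x $ i) ^ a i)"

definition deg :: "('n::finite \<Rightarrow> nat) \<Rightarrow> nat" where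
  "deg a = sum a UNIV"

definition unit_exp :: "'n \<Rightarrow> 'n \<Rightarrow> nat" where
  "unit_exp i j = (if j = i then 1 else 0)"

definition Mon :: "nat \<Rightarrow> ('n::finite \<Rightarrow> nat) set" where
  "Mon m = {a. deg a \<le> m}"

definition Pol :: "nat \<Rightarrow> (complex ^ 'n::finite \<Rightarrow> complex) set" where
  "Pol m = fn.span (mon ` Mon m)"

definition Polys :: "(complex ^ 'n::finite \<Rightarrow> complex) set" where
  "Polys = fn.span (range mon)"

lemma unit_exp_simps [simp]: "unit_exp i i = 1" "j \<noteq> i \<Longrightarrow> unit_exp i j = 0"
  by (auto simp: unit_exp_def)

lemma deg_0 [simp]: "deg 0 = 0" and deg_add [simp]: "deg (a + b) = deg a + deg b"
  and deg_unit_exp [simp]: "deg (unit_exp i) = 1"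
  by (auto simp: deg_def sum.distrib unit_exp_def)

lemma deg_eq_0_iff [simp]: "deg a = 0 \<longleftrightarrow> a = 0"
  by (auto simp: deg_def fun_eq_iff)

lemma deg_ge: "a i \<le> deg a"
  unfolding deg_def by (rule member_le_sum) auto

lemma finite_Mon [simp]: "finite (Mon m :: ('n::finite \<Rightarrow> nat) set)"
proof -
  have "Mon m \<subseteq> (PiE UNIV (\<lambda>_. {..m}) :: ('n \<Rightarrow> nat) set)"
    using deg_ge by (fastforce simp: Mon_def intro: order_trans)
  then show ?thesis by (rule finite_subset) (auto intro!: finite_PiE)
qed

lemma mon_0 [simp]: "mon 0 = 1" by (auto simp: mon_def fun_eq_iff)

lemma mon_add: "mon (a + b) = mon a * mon b"
  by (auto simp: mon_def fun_eq_iff power_add prod.distrib)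

lemma mon_unit_exp: "mon (unit_exp i) = (\<lambda>x :: complex ^ 'n::finite. x $ i)"
proof
  fix x :: "complex ^ 'n"
  have "mon (unit_exp i) x = (\<Prod>j\<in>UNIV. if j = i then x $ j else 1)"
    unfolding mon_def by (rule prod.cong) (auto simp: unit_exp_def)
  then show "mon (unit_exp i) x = x $ i" by simp
qed

lemma exp_split: "0 < a i \<Longrightarrow> \<exists>b. a = unit_exp i + b"
  by (rule exI[of _ "a(i := a i - 1)"]) (auto simp: fun_eq_iff unit_exp_def)

lemma exp_nonzero:
  fixes a :: "'n \<Rightarrow> nat"
  assumes "a \<noteq> 0" shows "\<exists>i. 0 < a i"
proof (rule ccontr)
  assume "\<not> ?thesis"
  then have "a i = 0 i" for i by simp
  then show False using assms by blast
qed

lemma exp_induct [case_names 0 add]: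
  fixes a :: "'n::finite \<Rightarrow> nat"
  assumes "P 0" "\<And>a i. P a \<Longrightarrow> P (unit_exp i + a)"
  shows "P a"
proof (induction "deg a" arbitrary: a)
  case 0
  then have "a = 0" by simp
  then show ?case using assms(1) by (simp only:)
next
  case (Suc k)
  then have "a \<noteq> 0" by (metis deg_eq_0_iff nat.distinct(1))
  then obtain i where "0 < a i" using exp_nonzero[OF \<open>a \<noteq> 0\<close>] by blast
  then obtain b where "a = unit_exp i + b" using exp_split[of a i] by blast
  moreover then have "P b" using Suc by simp
  ultimately show ?case using assms(2) by blast
qed

text \<open>Induction on the variables in play: grouping by the exponent of one variable
  \<open>j\<close> gives a univariate identity, whose coefficients \<open>e k\<close> vanish
  identically in the other variables. The scalars stay general because the complex case serves the
  polynomial spaces and the real case the symmetric tensors.\<close>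

lemma mon_indep_aux:
  fixes c :: "('n::finite \<Rightarrow> nat) \<Rightarrow> 'a::{idom,real_normed_div_algebra}"
  assumes "finite I" "finite S" "\<And>a i. a \<in> S \<Longrightarrow> i \<notin> I \<Longrightarrow> a i = 0"
    and "\<And>x. (\<Sum>a\<in>S. c a * (\<Prod>i\<in>I. (x $ i) ^ a i)) = 0" and "a \<in> S"
  shows "c a = 0"
  using assms
proof (induction I arbitrary: S c a rule: finite_induct)
  case empty
  have "b = a" if "b \<in> S" for b
  proof
    fix i show "b i = a i" using empty.prems(2)[of b i] empty.prems(2)[of a i] empty.prems(4) that by simp
  qed
  then have "S = {a}" using empty by blast
  then show ?case using empty by simp
next
  case (insert j I)
  define N where "N = Max ((\<lambda>a. a j) ` S)"
  have N: "b j \<le> N" if "b \<in> S" for b using that insert.prems(1) by (auto simp: N_def)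
  define e where "e k x = (\<Sum>b\<in>{b\<in>S. b j = k}. c b * (\<Prod>i\<in>I. (x $ i) ^ b i))" for k and x :: "'a ^ 'n"
  have "e k x = 0" if "k \<le> N" for k x
  proof -
    have "(\<Sum>k\<le>N. e k x * t ^ k) = 0" for t
    proof -
      define y where "y = (\<chi> i. if i = j then t else x $ i)"
      have y: "(\<Prod>i\<in>insert j I. (y $ i) ^ b i) = t ^ b j * (\<Prod>i\<in>I. (x $ i) ^ b i)" for b
      proof -
        have "(\<Prod>i\<in>I. (y $ i) ^ b i) = (\<Prod>i\<in>I. (x $ i) ^ b i)"
          using insert.hyps by (intro prod.cong) (auto simp: y_def)
        then show ?thesis using insert.hyps by (simp add: y_def)
      qed
      have "0 = (\<Sum>b\<in>S. c b * (t ^ b j * (\<Prod>i\<in>I. (x $ i) ^ b i)))"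
        using insert.prems(3)[of y] by (simp only: y)
      also have "\<dots> = (\<Sum>k\<le>N. \<Sum>b\<in>{b\<in>S. b j = k}. c b * (t ^ b j * (\<Prod>i\<in>I. (x $ i) ^ b i)))"
        using N insert.prems(1) by (intro sum.group[symmetric]) auto
      also have "\<dots> = (\<Sum>k\<le>N. e k x * t ^ k)"
        by (auto simp: e_def sum_distrib_left sum_distrib_right intro!: sum.cong)
      finally show ?thesis by simp
    qed
    then have "\<forall>k\<le>N. e k x = 0" using polyfun_eq_0[of "\<lambda>k. e k x" N] by blast
    then show ?thesis using that by blast
  qed
  note ek = this
  \<comment> \<open>Clearing the entry at \<open>j\<close> is injective on exponents with the fixed
    value \<open>a j\<close> there, so the group of \<open>a\<close> becomes a family in the
    remaining variables.\<close>
  define S' where "S' = (\<lambda>b. b(j := 0)) ` {b\<in>S. b j = a j}"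
  have inj: "inj_on (\<lambda>b. b(j := 0)) {b\<in>S. b j = a j}"
    by (rule inj_onI) (smt (verit, ccfv_threshold) fun_upd_triv fun_upd_upd mem_Collect_eq)
  have *: "c ((a(j := 0))(j := a j)) = 0"
  proof (rule insert.IH[of S' "\<lambda>b. c (b(j := a j))"])
    show "finite S'" using insert.prems(1) by (simp add: S'_def)
    show "b i = 0" if "b \<in> S'" "i \<notin> I" for b i
      using that insert.prems(2) by (auto simp: S'_def)
    show "a(j := 0) \<in> S'" using insert.prems(4) by (auto simp: S'_def)
    fix x :: "'a ^ 'n"
    have "(\<Sum>b\<in>S'. c (b(j := a j)) * (\<Prod>i\<in>I. (x $ i) ^ b i))
        = (\<Sum>b\<in>{b\<in>S. b j = a j}. c ((b(j := 0))(j := a j)) * (\<Prod>i\<in>I. (x $ i) ^ (b(j := 0)) i))"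
      unfolding S'_def by (subst sum.reindex[OF inj]) simp
    also have "\<dots> = e (a j) x"
      unfolding e_def
    proof (rule sum.cong)
      fix b assume "b \<in> {b\<in>S. b j = a j}"
      then have "(b(j := 0))(j := a j) = b" by auto
      moreover have "(\<Prod>i\<in>I. (x $ i) ^ (b(j := 0)) i) = (\<Prod>i\<in>I. (x $ i) ^ b i)"
        using insert.hyps by (intro prod.cong) auto
      ultimately show "c ((b(j := 0))(j := a j)) * (\<Prod>i\<in>I. (x $ i) ^ (b(j := 0)) i)
          = c b * (\<Prod>i\<in>I. (x $ i) ^ b i)" by simp
    qed auto
    also have "\<dots> = 0" using ek N insert.prems(4) by blast
    finally show "(\<Sum>b\<in>S'. c (b(j := a j)) * (\<Prod>i\<in>I. (x $ i) ^ b i)) = 0" .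
  qed
  then show ?case by simp
qed

lemma mon_indep:
  assumes "finite S" "\<And>x. (\<Sum>a\<in>S. c a * mon a x) = 0" "a \<in> S"
  shows "c a = 0"
  using mon_indep_aux[of UNIV S c a] assms by (simp add: mon_def)

lemma inj_mon: "inj (mon :: ('n::finite \<Rightarrow> nat) \<Rightarrow> _)"
proof (rule injI, rule ccontr)
  fix a b :: "'n \<Rightarrow> nat" assume ab: "mon a = mon b" "a \<noteq> b"
  have "(\<Sum>k\<in>{a,b}. (if k = a then 1 else -1) * mon k x) = 0" for x
    using ab by simp
  then have "(if a = a then 1 else -1 :: complex) = 0"
    by (rule mon_indep[rotated]) auto
  then show False by simp
qed

lemma independent_mon: "fn.independent (mon ` S)"
proof -
  have "fn.independent (range (mon :: ('n::finite \<Rightarrow> nat) \<Rightarrow> _))"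
    unfolding fn.independent_explicit_finite_subsets
  proof (intro allI impI ballI)
    fix A :: "(complex ^ 'n \<Rightarrow> complex) set" and u p
    assume A: "A \<subseteq> range mon" "finite A" "(\<Sum>v\<in>A. fscale (u v) v) = 0" and p: "p \<in> A"
    define S where "S = mon -` A"
    have S: "mon ` S = A" "finite S" using A inj_mon by (auto simp: S_def intro: finite_vimageI)
    obtain a where a: "a \<in> S" "p = mon a" using p S by blast
    have "(\<Sum>a\<in>S. u (mon a) * mon a x) = 0" for x
    proof -
      have "(\<Sum>v\<in>mon ` S. fscale (u v) v) = (\<Sum>a\<in>S. fscale (u (mon a)) (mon a))"
        by (rule sum.reindex[unfolded o_def]) (use inj_mon in \<open>auto intro: inj_on_subset\<close>)
      then have "(\<Sum>a\<in>S. fscale (u (mon a)) (mon a)) x = 0" using A(3) S by simp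
      then show ?thesis by (simp add: sum_fun_eq)
    qed
    then have "u (mon a) = 0" by (rule mon_indep[OF S(2) _ a(1), rotated])
    then show "u p = 0" using a by simp
  qed
  then show ?thesis by (rule fn.independent_mono) auto
qed

section \<open>Polynomials of bounded and of arbitrary degree\<close>

lemma Pol_mono: "m \<le> k \<Longrightarrow> Pol m \<subseteq> Pol k"
  unfolding Pol_def by (rule fn.span_mono) (auto simp: Mon_def)

lemma Pol_Polys: "Pol m \<subseteq> Polys"
  unfolding Pol_def Polys_def by (rule fn.span_mono) auto

lemma mon_Pol: "deg a \<le> m \<Longrightarrow> mon a \<in> Pol m"
  unfolding Pol_def by (rule fn.span_base) (auto simp: Mon_def)

lemma mon_Polys: "mon a \<in> Polys"
  unfolding Polys_def by (rule fn.span_base) auto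

lemma mult_span:
  assumes "p \<in> fn.span S" "q \<in> fn.span T" "\<And>s t. s \<in> S \<Longrightarrow> t \<in> T \<Longrightarrow> s * t \<in> fn.span U"
  shows "p * q \<in> fn.span U"
proof -
  have "s * q \<in> fn.span U" if "s \<in> S" for s
    by (rule span_induct_linear[OF assms(2) flinear_mult_left]) (use assms(3) that in auto)
  then have "q * p \<in> fn.span U"
    by (intro span_induct_linear[OF assms(1) flinear_mult_left]) (auto simp: mult.commute)
  then show ?thesis by (simp add: mult.commute)
qed

lemma Pol_mult: "p \<in> Pol m \<Longrightarrow> q \<in> Pol k \<Longrightarrow> p * q \<in> Pol (m + k)"
  unfolding Pol_def
  by (erule (1) mult_span) (auto simp flip: mon_add intro!: fn.span_base simp: Mon_def)

lemma Polys_mult: "p \<in> Polys \<Longrightarrow> q \<in> Polys \<Longrightarrow> p * q \<in> Polys"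
  unfolding Polys_def by (erule (1) mult_span) (auto simp flip: mon_add intro!: fn.span_base)

lemma Polys_add: "p \<in> Polys \<Longrightarrow> q \<in> Polys \<Longrightarrow> p + q \<in> Polys"
  and Polys_scale: "p \<in> Polys \<Longrightarrow> fscale c p \<in> Polys"
  unfolding Polys_def by (simp_all add: fn.span_add fn.span_diff fn.span_scale)

lemma Pol_add: "p \<in> Pol m \<Longrightarrow> q \<in> Pol m \<Longrightarrow> p + q \<in> Pol m"
  and Pol_scale: "p \<in> Pol m \<Longrightarrow> fscale c p \<in> Pol m"
  unfolding Pol_def by (simp_all add: fn.span_add fn.span_diff fn.span_scale fn.span_zero)

lemma Pol_const: "(\<lambda>_. c) \<in> Pol m"
proof -
  have "(\<lambda>_. c) = fscale c (mon 0)" by (auto simp: fun_eq_iff)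
  also have "\<dots> \<in> Pol m" by (intro Pol_scale mon_Pol) simp
  finally show ?thesis .
qed

lemma Pol_coord: "1 \<le> m \<Longrightarrow> (\<lambda>x. x $ i) \<in> Pol m"
  using mon_Pol[of "unit_exp i" m] by (simp add: mon_unit_exp)

lemma Polys_const: "(\<lambda>_. c) \<in> Polys" and Polys_coord: "(\<lambda>x. x $ i) \<in> Polys" and Polys_one: "1 \<in> Polys"
  using Pol_const[of c 0] Pol_coord[of 1 i] Pol_Polys[of 0] Pol_Polys[of 1] mon_Polys[of 0] by auto

lemma Polys_sum: "(\<And>a. a \<in> A \<Longrightarrow> (\<lambda>x. p a x) \<in> Polys) \<Longrightarrow> (\<lambda>x. \<Sum>a\<in>A. p a x) \<in> Polys"
  unfolding Polys_def sum_fun_eq[symmetric] by (rule fn.span_sum)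

lemma Pol_sum: "(\<And>a. a \<in> A \<Longrightarrow> (\<lambda>x. p a x) \<in> Pol m) \<Longrightarrow> (\<lambda>x. \<Sum>a\<in>A. p a x) \<in> Pol m"
  unfolding Pol_def sum_fun_eq[symmetric] by (rule fn.span_sum)

lemma Polys_times: "(\<lambda>x. p x) \<in> Polys \<Longrightarrow> (\<lambda>x. q x) \<in> Polys \<Longrightarrow> (\<lambda>x. p x * q x) \<in> Polys"
  using Polys_mult[of p q] by (simp add: times_fun_def)

lemma Polys_prod: "(\<And>a. a \<in> A \<Longrightarrow> (\<lambda>x. p a x) \<in> Polys) \<Longrightarrow> (\<lambda>x. \<Prod>a\<in>A. p a x) \<in> Polys"
proof (induction A rule: infinite_finite_induct)
  case (insert a A)
  then show ?case using Polys_times[of "p a" "\<lambda>x. \<Prod>a\<in>A. p a x"] by simp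
qed (simp_all add: Polys_const)

lemma Pol_times: "(\<lambda>x. p x) \<in> Pol m \<Longrightarrow> (\<lambda>x. q x) \<in> Pol k \<Longrightarrow> (\<lambda>x. p x * q x) \<in> Pol (m + k)"
  using Pol_mult[of p m q k] by (simp add: times_fun_def)

lemma Pol_prod_coord: "finite A \<Longrightarrow> card A \<le> m \<Longrightarrow> (\<lambda>x. \<Prod>k\<in>A. x $ j k) \<in> Pol m"
proof (induction A arbitrary: m rule: finite_induct)
  case empty
  then show ?case by (simp add: Pol_const)
next
  case (insert k A)
  then obtain m' where "m = Suc m'" "card A \<le> m'" by (cases m) auto
  then show ?case using Pol_times[OF Pol_coord[of 1 "j k"] insert.IH[of m']] insert by simp
qed

section \<open>Normal forms modulo an ideal\<close>

definition Bexp :: "nat \<Rightarrow> ('n::finite \<Rightarrow> nat) set" where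
  "Bexp e = {a. \<forall>i. a i < e}"

definition Bsp :: "nat \<Rightarrow> (complex ^ 'n::finite \<Rightarrow> complex) set" where
  "Bsp e = fn.span (mon ` Bexp e)"

text \<open>The bound is on the multipliers, hence on all intermediate terms. A member of the ideal
  of low degree may need multipliers of high degree whose leading terms cancel, so
  \<open>Idl F k\<close> can be smaller than the part of the ideal of the matching degree.\<close>

definition Idl :: "('i \<Rightarrow> complex ^ 'n::finite \<Rightarrow> complex) \<Rightarrow> nat \<Rightarrow> (complex ^ 'n \<Rightarrow> complex) set" where
  "Idl F k = fn.span {mon c * F i | c i. deg c \<le> k}"

definition Ideal :: "('i \<Rightarrow> complex ^ 'n::finite \<Rightarrow> complex) \<Rightarrow> (complex ^ 'n \<Rightarrow> complex) set" where
  "Ideal F = fn.span {mon c * F i | c i. True}"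

lemma Idl_add: "p \<in> Idl F k \<Longrightarrow> q \<in> Idl F k \<Longrightarrow> p + q \<in> Idl F k"
  and Idl_diff: "p \<in> Idl F k \<Longrightarrow> q \<in> Idl F k \<Longrightarrow> p - q \<in> Idl F k"
  and Idl_scale: "p \<in> Idl F k \<Longrightarrow> fscale c p \<in> Idl F k"
  and Idl_zero: "0 \<in> Idl F k"
  unfolding Idl_def by (simp_all add: fn.span_add fn.span_diff fn.span_scale fn.span_zero)

lemma Ideal_add: "p \<in> Ideal F \<Longrightarrow> q \<in> Ideal F \<Longrightarrow> p + q \<in> Ideal F"
  and Ideal_diff: "p \<in> Ideal F \<Longrightarrow> q \<in> Ideal F \<Longrightarrow> p - q \<in> Ideal F"
  and Ideal_scale: "p \<in> Ideal F \<Longrightarrow> fscale c p \<in> Ideal F"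
  and Ideal_zero: "0 \<in> Ideal F"
  and Ideal_sum: "(\<And>a. a \<in> A \<Longrightarrow> g a \<in> Ideal F) \<Longrightarrow> sum g A \<in> Ideal F"
  unfolding Ideal_def
  by (simp_all add: fn.span_add fn.span_diff fn.span_scale fn.span_zero fn.span_sum)

lemma Bsp_add: "p \<in> Bsp k \<Longrightarrow> q \<in> Bsp k \<Longrightarrow> p + q \<in> Bsp k"
  and Bsp_diff: "p \<in> Bsp k \<Longrightarrow> q \<in> Bsp k \<Longrightarrow> p - q \<in> Bsp k"
  and Bsp_scale: "p \<in> Bsp k \<Longrightarrow> fscale c p \<in> Bsp k"
  and Bsp_zero: "0 \<in> Bsp k"
  unfolding Bsp_def
  by (simp_all add: fn.span_add fn.span_diff fn.span_scale fn.span_zero)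

lemma Idl_mono: "k \<le> l \<Longrightarrow> Idl F k \<subseteq> Idl F l"
  unfolding Idl_def by (rule fn.span_mono) (blast intro: order_trans)

lemma Idl_Ideal: "Idl F k \<subseteq> Ideal F"
  unfolding Idl_def Ideal_def by (rule fn.span_mono) auto

lemma Idl_gen: "deg c \<le> k \<Longrightarrow> mon c * F i \<in> Idl F k"
  unfolding Idl_def by (rule fn.span_base) auto

lemma F_in_Idl: "F i \<in> Idl F k"
  using Idl_gen[of 0 k F i] by simp

lemma Idl_mult:
  fixes F :: "'i \<Rightarrow> complex ^ 'n::finite \<Rightarrow> complex"
  shows "p \<in> Pol m \<Longrightarrow> r \<in> Idl F k \<Longrightarrow> p * r \<in> Idl F (m + k)"
  unfolding Pol_def Idl_def
proof (erule (1) mult_span)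
  fix s t :: "complex ^ 'n \<Rightarrow> complex" assume "s \<in> mon ` Mon m" "t \<in> {mon c * F i |c i. deg c \<le> k}"
  then obtain a c i where "s = mon a" "deg a \<le> m" "t = mon c * F i" "deg c \<le> k"
    by (auto simp: Mon_def)
  then have "s * t = mon (a + c) * F i" "deg (a + c) \<le> m + k"
    by (auto simp: mon_add mult.assoc)
  then show "s * t \<in> fn.span {mon c * F i |c i. deg c \<le> m + k}"
    by (intro fn.span_base) auto
qed

lemma Ideal_mult:
  fixes F :: "'i \<Rightarrow> complex ^ 'n::finite \<Rightarrow> complex"
  shows "p \<in> Polys \<Longrightarrow> r \<in> Ideal F \<Longrightarrow> p * r \<in> Ideal F"
  unfolding Polys_def Ideal_def
proof (erule (1) mult_span)
  fix s t :: "complex ^ 'n \<Rightarrow> complex" assume "s \<in> range mon" "t \<in> {mon c * F i |c i. True}"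
  then obtain a c i where "s = mon a" "t = mon c * F i" by auto
  then have "s * t = mon (a + c) * F i" by (auto simp: mon_add mult.assoc)
  then show "s * t \<in> fn.span {mon c * F i |c i. True}"
    by (intro fn.span_base) auto
qed

lemma Ideal_gen: "p \<in> Polys \<Longrightarrow> p * F i \<in> Ideal F"
  using Ideal_mult[of p "F i" F] F_in_Idl[of F i 0] Idl_Ideal[of F 0] by blast

lemma Ideal_vanishes:
  assumes "p \<in> Ideal F" "\<And>i. F i v = 0" shows "p v = 0"
  using assms(1) unfolding Ideal_def
  by (induction rule: fn.span_induct_alt) (auto simp: assms(2))

text \<open>The degree of the monomial with all exponents equal to \<open>e - 1\<close>, the largest
  in \<open>Bexp e\<close>; a variable times a reduced polynomial needs one degree more.\<close>

definition top_deg :: "nat \<Rightarrow> 'n::finite itself \<Rightarrow> nat" where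
  "top_deg e _ = CARD('n) * (e - 1)"

lemma finite_Bexp [simp]: "finite (Bexp e :: ('n::finite \<Rightarrow> nat) set)"
  and Bexp_deg: "(a :: 'n \<Rightarrow> nat) \<in> Bexp e \<Longrightarrow> deg a \<le> top_deg e TYPE('n)"
proof -
  have d: "deg a \<le> top_deg e TYPE('n)" if "a \<in> Bexp e" for a :: "'n \<Rightarrow> nat"
  proof -
    have "deg a \<le> (\<Sum>i\<in>(UNIV::'n set). e - 1)"
      unfolding deg_def
    proof (rule sum_mono)
      fix i
      have "a i < e" using that by (simp add: Bexp_def)
      then show "a i \<le> e - 1" by simp
    qed
    then show ?thesis by (simp add: top_deg_def)
  qed
  then have "(Bexp e :: ('n \<Rightarrow> nat) set) \<subseteq> Mon (top_deg e TYPE('n))" by (auto simp: Mon_def)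
  then show "finite (Bexp e :: ('n \<Rightarrow> nat) set)" by (rule finite_subset) simp
  show "deg a \<le> top_deg e TYPE('n)" if "a \<in> Bexp e" for a :: "'n \<Rightarrow> nat" using d[OF that] .
qed

lemma Bsp_Pol: "(Bsp e :: (complex ^ 'n::finite \<Rightarrow> complex) set) \<subseteq> Pol (top_deg e TYPE('n))"
  unfolding Bsp_def Pol_def by (rule fn.span_mono) (auto simp: Mon_def Bexp_deg)

lemma mon_Bsp: "a \<in> Bexp e \<Longrightarrow> mon a \<in> Bsp e"
  unfolding Bsp_def by (rule fn.span_base) auto

text \<open>The monomial with exponents \<open>a\<close> evaluated at the operators
  \<open>M\<close>. A list fixes the order of application because the operators will commute only on
  a subspace.\<close>

primrec iter_ops :: "('i \<Rightarrow> 'v \<Rightarrow> 'v) \<Rightarrow> 'i list \<Rightarrow> ('i \<Rightarrow> nat) \<Rightarrow> 'v \<Rightarrow> 'v" where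
  "iter_ops M [] a b = b"
| "iter_ops M (j # js) a b = (M j ^^ a j) (iter_ops M js a b)"

lemma iter_ops_commute:
  assumes "\<And>i b. b \<in> V \<Longrightarrow> M i b \<in> V"
    and "\<And>i j b. b \<in> V \<Longrightarrow> M i (M j b) = M j (M i b)"
    and "b \<in> V"
  shows "iter_ops M js a b \<in> V"
    and "i \<in> set js \<Longrightarrow> distinct js \<Longrightarrow> iter_ops M js (unit_exp i + a) b = M i (iter_ops M js a b)"
proof -
  have pow: "(M j ^^ n) v \<in> V" "M i ((M j ^^ n) v) = (M j ^^ n) (M i v)" if "v \<in> V" for i j n v
  proof -
    show "(M j ^^ n) v \<in> V" for n using that by (induction n) (auto simp: assms(1))
    then show "M i ((M j ^^ n) v) = (M j ^^ n) (M i v)"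
      by (induction n) (simp_all add: assms(2)[of _ i j])
  qed
  show V: "iter_ops M js a b \<in> V" for js by (induction js) (auto simp: assms pow)
  have off: "iter_ops M js (unit_exp i + a) b = iter_ops M js a b" if "i \<notin> set js" for js
    using that by (induction js) auto
  show "iter_ops M js (unit_exp i + a) b = M i (iter_ops M js a b)" if "i \<in> set js" "distinct js"
    using that
  proof (induction js)
    case (Cons j js)
    show ?case
    proof (cases "i = j")
      case True
      then have "iter_ops M (j # js) (unit_exp i + a) b = (M i ^^ Suc (a i)) (iter_ops M js (unit_exp i + a) b)"
        by (simp only: iter_ops.simps) simp
      also have "\<dots> = M i (iter_ops M (j # js) a b)" using off[of js] Cons.prems True by simp
      finally show ?thesis .
    next
      case False
      then have "iter_ops M js (unit_exp i + a) b = M i (iter_ops M js a b)"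
        using Cons.prems by (intro Cons.IH) simp_all
      moreover have "(unit_exp i + a) j = a j" using False by simp
      ultimately show ?thesis by (simp only: iter_ops.simps pow(2)[OF V])
    qed
  qed simp
qed

text \<open>A border basis argument. Multiplication by a variable followed by reduction gives
  operators \<open>M i\<close> on \<open>Bsp e\<close>. Their commutators have values in
  \<open>Bsp e\<close> and in the ideal with bounded multipliers, so \<open>D\<close> makes them
  commute, and the polynomials act on \<open>Bsp e\<close>. The action on 1 is a linear map
  \<open>\<pi>\<close> that kills the whole ideal and differs from the identity only by bounded
  multiples of the \<open>F i\<close>; on \<open>b\<close> this allows a last use of
  \<open>D\<close>.\<close>

lemma Bsp_int_Ideal:
  fixes F :: "'i \<Rightarrow> complex ^ 'n::finite \<Rightarrow> complex" and e :: nat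
  defines "T \<equiv> top_deg e TYPE('n)"
  assumes e: "0 < e" and F: "\<And>i. F i \<in> Pol e"
    and S: "\<And>p. p \<in> Pol (T + 1) \<Longrightarrow> \<exists>b\<in>Bsp e. p - b \<in> Idl F (T + 1)"
    and D: "\<And>b. b \<in> Bsp e \<Longrightarrow> b \<in> Idl F (2 * T + e + 2) \<Longrightarrow> b = 0"
    and b: "b \<in> Bsp e" "b \<in> Ideal F"
  shows "b = 0"
proof -
  let ?X = "\<lambda>i. mon (unit_exp i) :: complex ^ 'n \<Rightarrow> complex"
  have X1: "?X i \<in> Pol 1" for i by (rule mon_Pol) simp
  have "\<forall>i. \<exists>L. flinear L \<and> (\<forall>b\<in>mon ` Bexp e. L b \<in> Bsp e \<and> ?X i * b - L b \<in> Idl F (T + 1))"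
  proof
    fix i
    have ex: "\<exists>b'. b' \<in> Bsp e \<and> ?X i * b - b' \<in> Idl F (T + 1)" if "b \<in> mon ` Bexp e" for b
    proof -
      have "b \<in> Pol T" using that Bexp_deg by (auto simp: T_def intro!: mon_Pol)
      then have "?X i * b \<in> Pol (T + 1)" using Pol_mult[OF X1] by (simp add: add.commute)
      then show ?thesis using S by blast
    qed
    \<comment> \<open>Remainders are chosen for the basis monomials only and then extended linearly,
      since a choice for all polynomials need not be linear.\<close>
    define f where "f b = (SOME b'. b' \<in> Bsp e \<and> ?X i * b - b' \<in> Idl F (T + 1))" for b
    have f: "f b \<in> Bsp e \<and> ?X i * b - f b \<in> Idl F (T + 1)" if "b \<in> mon ` Bexp e" for b
      unfolding f_def by (rule someI_ex[OF ex[OF that]])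
    obtain L where "flinear L" "\<forall>b\<in>mon ` Bexp e. L b = f b"
      using fp.linear_independent_extend[OF independent_mon, of "Bexp e" f] by blast
    then show "\<exists>L. flinear L \<and> (\<forall>b\<in>mon ` Bexp e. L b \<in> Bsp e \<and> ?X i * b - L b \<in> Idl F (T + 1))"
      using f by (intro exI[of _ L]) auto
  qed
  from choice[OF this] obtain M where M: "\<forall>i. flinear (M i) \<and>
      (\<forall>b\<in>mon ` Bexp e. M i b \<in> Bsp e \<and> ?X i * b - M i b \<in> Idl F (T + 1))" ..
  have lin: "flinear (M i)" for i using spec[OF M, of i] by (rule conjunct1)
  have M0: "M i b \<in> Bsp e" if "b \<in> mon ` Bexp e" for i b
    by (rule conjunct1[OF bspec[OF conjunct2[OF spec[OF M]] that]])
  have M0': "?X i * b - M i b \<in> Idl F (T + 1)" if "b \<in> mon ` Bexp e" for i b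
    by (rule conjunct2[OF bspec[OF conjunct2[OF spec[OF M]] that]])
  have M1: "M i b \<in> Bsp e" if "b \<in> Bsp e" for i b
    using that unfolding Bsp_def
    by (rule span_induct_linear[OF _ lin]) (rule M0[unfolded Bsp_def])
  have M2: "?X i * b - M i b \<in> Idl F (T + 1)" if "b \<in> Bsp e" for i b
  proof -
    have "flinear (\<lambda>b. ?X i * b - M i b)"
      by (rule flinearI)
        (auto simp: fp.linear_add[OF lin] fp.linear_scale[OF lin] fun_eq_iff algebra_simps)
    with that show ?thesis
      unfolding Bsp_def Idl_def
      by (rule span_induct_linear[where L = "\<lambda>b. ?X i * b - M i b"]) (rule M0'[unfolded Idl_def])
  qed
  have MM: "?X i * (?X j * b) - M i (M j b) \<in> Idl F (T + 2)" if "b \<in> Bsp e" for i j b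
  proof -
    have "?X i * (?X j * b - M j b) \<in> Idl F (T + 2)"
      using Idl_mult[OF X1 M2[OF that]] by (simp add: add.commute)
    moreover have "?X i * M j b - M i (M j b) \<in> Idl F (T + 2)"
      using M2[OF M1[OF that]] Idl_mono[of "T + 1" "T + 2" F] by auto
    ultimately have "?X i * (?X j * b - M j b) + (?X i * M j b - M i (M j b)) \<in> Idl F (T + 2)"
      by (rule Idl_add)
    then show ?thesis by (simp add: algebra_simps)
  qed
  \<comment> \<open>Both composites are remainders of the same polynomial, a product of two
    variables with \<open>b\<close>, with multipliers of degree at most
    \<open>T + 2\<close>.\<close>
  have comm: "M i (M j b) = M j (M i b)" if "b \<in> Bsp e" for i j b
  proof -
    have "(?X j * (?X i * b) - M j (M i b)) - (?X i * (?X j * b) - M i (M j b)) \<in> Idl F (T + 2)"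
      by (rule Idl_diff[OF MM[OF that] MM[OF that]])
    then have "M i (M j b) - M j (M i b) \<in> Idl F (T + 2)" by (simp add: mult.left_commute)
    then have "M i (M j b) - M j (M i b) \<in> Idl F (2 * T + e + 2)"
      using Idl_mono[of "T + 2" "2 * T + e + 2" F] by auto
    then have "M i (M j b) - M j (M i b) = 0"
      using Bsp_diff[OF M1[OF M1[OF that]] M1[OF M1[OF that]]] D by blast
    then show ?thesis by simp
  qed
  obtain js :: "'n list" where js: "set js = UNIV" "distinct js"
    using finite_distinct_list[of "UNIV :: 'n set"] by auto
  define \<phi> where "\<phi> a = iter_ops M js a 1" for a
  have one: "1 \<in> Bsp e" using mon_Bsp[of 0 e] e by (simp add: Bexp_def)
  have \<phi>B: "\<phi> a \<in> Bsp e" for a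
    unfolding \<phi>_def using iter_ops_commute(1)[of "Bsp e" M 1 js a] M1 comm one by blast
  have \<phi>0: "\<phi> 0 = 1" unfolding \<phi>_def by (induction js) auto
  have \<phi>S: "\<phi> (unit_exp i + a) = M i (\<phi> a)" for i a
    unfolding \<phi>_def using iter_ops_commute(2)[of "Bsp e" M 1 i js a] M1 comm one js by blast
  obtain \<pi> where \<pi>: "flinear \<pi>" "\<And>a. \<pi> (mon a) = \<phi> a"
  proof -
    obtain L where "flinear L" "\<forall>b\<in>range mon. L b = \<phi> (inv mon b)"
      using fp.linear_independent_extend[OF independent_mon, of UNIV "\<lambda>b. \<phi> (inv mon b)"] by blast
    then show ?thesis by (intro that[of L]) (simp_all add: inv_f_f[OF inj_mon])
  qed
  have \<pi>B: "\<pi> p \<in> Bsp e" if "p \<in> Polys" for p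
    using that unfolding Polys_def Bsp_def
    by (rule span_induct_linear[OF _ \<pi>(1)]) (use \<phi>B in \<open>auto simp: \<pi>(2) Bsp_def\<close>)
  have mon_diff: "mon a - \<phi> a \<in> Idl F (T + 1 + deg a)" for a
  proof (induction a rule: exp_induct)
    case 0
    show ?case by (simp only: \<phi>0 mon_0 diff_self Idl_zero)
  next
    case (add a i)
    have "?X i * (mon a - \<phi> a) \<in> Idl F (1 + (T + 1 + deg a))" by (rule Idl_mult[OF X1 add])
    moreover have "?X i * \<phi> a - M i (\<phi> a) \<in> Idl F (1 + (T + 1 + deg a))"
      using M2[OF \<phi>B] Idl_mono[of "T + 1" "1 + (T + 1 + deg a)" F] by auto
    ultimately have "?X i * (mon a - \<phi> a) + (?X i * \<phi> a - M i (\<phi> a)) \<in> Idl F (1 + (T + 1 + deg a))"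
      by (rule Idl_add)
    moreover have "?X i * (mon a - \<phi> a) + (?X i * \<phi> a - M i (\<phi> a)) = mon (unit_exp i + a) - \<phi> (unit_exp i + a)"
      by (simp only: \<phi>S mon_add) (simp add: algebra_simps)
    moreover have "1 + (T + 1 + deg a) = T + 1 + deg (unit_exp i + a)" by simp
    ultimately show ?case by (simp only:)
  qed
  have pol_diff: "p - \<pi> p \<in> Idl F (T + 1 + m)" if "p \<in> Pol m" for p m
  proof -
    have "flinear (\<lambda>p. p - \<pi> p)"
      by (rule flinearI)
        (auto simp: fp.linear_add[OF \<pi>(1)] fp.linear_scale[OF \<pi>(1)] fun_eq_iff algebra_simps)
    with that show ?thesis
      unfolding Pol_def Idl_def
    proof (rule span_induct_linear)
      fix s :: "complex ^ 'n \<Rightarrow> complex" assume "s \<in> mon ` Mon m"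
      then obtain a where a: "s = mon a" "deg a \<le> m" by (auto simp: Mon_def)
      have "mon a - \<phi> a \<in> Idl F (T + 1 + m)"
        using mon_diff[of a] Idl_mono[of "T + 1 + deg a" "T + 1 + m" F] a(2) by auto
      then show "s - \<pi> s \<in> fn.span {mon c * F i |c i. deg c \<le> T + 1 + m}"
        by (simp only: a(1) \<pi>(2) Idl_def)
    qed
  qed
  \<comment> \<open>\<open>F i\<close> has degree \<open>e\<close>, so it differs from its image by
    multipliers of degree up to \<open>T + 1 + e\<close>. This, \<open>T + 2\<close> for the
    commutators and \<open>2 * T + 1\<close> for \<open>b\<close> all stay below
    \<open>2 * T + e + 2\<close>.\<close>
  have \<pi>F: "\<pi> (F i) = 0" for i
  proof (rule D)
    show "\<pi> (F i) \<in> Bsp e" using F Pol_Polys by (intro \<pi>B) auto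
    have "F i - (F i - \<pi> (F i)) \<in> Idl F (T + 1 + e)"
      by (rule Idl_diff[OF F_in_Idl pol_diff[OF F]])
    then show "\<pi> (F i) \<in> Idl F (2 * T + e + 2)" using Idl_mono[of "T + 1 + e" "2 * T + e + 2" F] by auto
  qed
  have \<pi>X: "\<pi> (?X i * p) = M i (\<pi> p)" if "p \<in> Polys" for i p
  proof -
    have "flinear (\<lambda>p. \<pi> (?X i * p) - M i (\<pi> p))"
      by (rule flinearI)
        (auto simp: fp.linear_add[OF \<pi>(1)] fp.linear_scale[OF \<pi>(1)] fp.linear_add[OF lin]
          fp.linear_scale[OF lin] distrib_left fn.scale_right_diff_distrib
          mult.left_commute[of _ "fscale _ _"] flinear_mult_left[THEN fp.linear_scale])
    with that have "\<pi> (?X i * p) - M i (\<pi> p) \<in> fn.span {}"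
      unfolding Polys_def
    proof (rule span_induct_linear)
      fix s assume "s \<in> range (mon :: ('n \<Rightarrow> nat) \<Rightarrow> _)"
      then obtain a where s: "s = mon a" by blast
      have "\<pi> (?X i * s) = M i (\<pi> s)"
        unfolding s mon_add[symmetric] \<pi>(2) by (rule \<phi>S)
      then show "\<pi> (?X i * s) - M i (\<pi> s) \<in> fn.span {}" by simp
    qed
    then show ?thesis by simp
  qed
  have "\<pi> (mon c * F i) = 0" for c i
  proof (induction c rule: exp_induct)
    case 0
    show ?case by (simp only: mon_0 mult_1_left \<pi>F)
  next
    case (add c j)
    have "mon c * F i \<in> Polys" using F[of i] Pol_Polys by (intro Polys_mult mon_Polys) auto
    then have "\<pi> (?X j * (mon c * F i)) = M j 0" by (simp only: \<pi>X add)
    then show ?case by (simp only: mon_add mult.assoc fp.linear_0[OF lin])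
  qed
  note \<pi>gen = this
  have "\<pi> b \<in> fn.span {}"
    using b(2) unfolding Ideal_def
  proof (rule span_induct_linear[OF _ \<pi>(1)])
    fix s assume "s \<in> {mon c * F i |c i. True}"
    then show "\<pi> s \<in> fn.span {}" by (auto simp only: \<pi>gen fn.span_zero mem_Collect_eq)
  qed
  then have "\<pi> b = 0" by simp
  \<comment> \<open>There is no need to know that \<open>\<pi>\<close> fixes \<open>b\<close>: that
    it differs from \<open>b\<close> by bounded multiples is enough, as its value is 0.\<close>
  then have "b \<in> Idl F (T + 1 + T)"
    using pol_diff[of b T] b(1) Bsp_Pol[where e=e] by (auto simp: T_def)
  then show ?thesis using Idl_mono[of "T + 1 + T" "2 * T + e + 2" F] b(1) by (intro D) auto
qed

text \<open>A variable times an element of \<open>Bsp e\<close> has degree at most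
  \<open>T + 1\<close>, so reducing after each multiplication never leaves the range of
  \<open>S\<close>.\<close>

lemma Polys_decomp:
  fixes F :: "'i \<Rightarrow> complex ^ 'n::finite \<Rightarrow> complex" and e :: nat
  defines "T \<equiv> top_deg e TYPE('n)"
  assumes e: "0 < e"
    and S: "\<And>p. p \<in> Pol (T + 1) \<Longrightarrow> \<exists>b\<in>Bsp e. p - b \<in> Idl F (T + 1)"
    and p: "p \<in> Polys"
  shows "\<exists>b\<in>Bsp e. p - b \<in> Ideal F"
proof -
  let ?V = "{p. \<exists>b\<in>Bsp e. p - b \<in> Ideal F}"
  have "fn.subspace ?V"
    unfolding fn.subspace_def
  proof (intro conjI ballI allI)
    show "0 \<in> ?V" using Bsp_zero[of e] Ideal_zero[of F] by force
    fix p assume "p \<in> ?V"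
    then obtain b where b: "b \<in> Bsp e" "p - b \<in> Ideal F" by blast
    show "fscale c p \<in> ?V" for c
      using Bsp_scale[OF b(1)] Ideal_scale[OF b(2), of c] by (auto simp: fn.scale_right_diff_distrib)
    fix q assume "q \<in> ?V"
    then obtain b' where b': "b' \<in> Bsp e" "q - b' \<in> Ideal F" by blast
    have "(p + q) - (b + b') \<in> Ideal F" using Ideal_add[OF b(2) b'(2)] by (simp add: algebra_simps)
    then show "p + q \<in> ?V" using Bsp_add[OF b(1) b'(1)] by blast
  qed
  moreover have "mon a \<in> ?V" for a
  proof (induction a rule: exp_induct)
    case 0
    have "(1 :: complex ^ 'n \<Rightarrow> complex) \<in> Bsp e" using mon_Bsp[of 0 e] e by (simp add: Bexp_def)
    moreover have "mon 0 - 1 \<in> Ideal F" using Ideal_zero[of F] by (simp only: mon_0 diff_self)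
    ultimately show ?case by blast
  next
    case (add a i)
    let ?X = "mon (unit_exp i)"
    obtain b where b: "b \<in> Bsp e" "mon a - b \<in> Ideal F" using add by blast
    have "?X * b \<in> Pol (1 + T)" using b(1) Bsp_Pol by (intro Pol_mult mon_Pol) (auto simp: T_def)
    then obtain b' where b': "b' \<in> Bsp e" "?X * b - b' \<in> Idl F (T + 1)"
      using S by (metis add.commute)
    have "?X * (mon a - b) + (?X * b - b') \<in> Ideal F"
      using Ideal_mult[OF mon_Polys b(2)] b'(2) Idl_Ideal by (intro Ideal_add) auto
    moreover have "?X * (mon a - b) + (?X * b - b') = mon (unit_exp i + a) - b'"
      by (simp only: mon_add) (simp add: algebra_simps)
    ultimately show ?case using b'(1) by (simp only: mem_Collect_eq) blast
  qed
  ultimately have "Polys \<subseteq> ?V" unfolding Polys_def by (intro fn.span_minimal) auto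
  then show ?thesis using p by blast
qed

section \<open>Zeros of an ideal with finite-dimensional quotient\<close>

text \<open>The quotient has dimension at most the number of reduced monomials, and one polynomial
  more than that is taken.\<close>

lemma dependent_mod_Ideal:
  fixes F :: "'i \<Rightarrow> complex ^ 'n::finite \<Rightarrow> complex"
  assumes BI: "\<And>p. p \<in> Polys \<Longrightarrow> \<exists>b\<in>Bsp e. p - b \<in> Ideal F"
    and p: "\<And>k. p k \<in> Polys"
  shows "\<exists>c N. (\<exists>k\<le>N. c k \<noteq> 0) \<and> (\<Sum>k\<le>N::nat. fscale (c k) (p k)) \<in> Ideal F"
proof -
  have "\<forall>k. \<exists>b. b \<in> Bsp e \<and> p k - b \<in> Ideal F" using BI[OF p] by blast
  from choice[OF this] obtain b where b: "\<forall>k. b k \<in> Bsp e \<and> p k - b k \<in> Ideal F" ..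
  define N where "N = card (Bexp e :: ('n \<Rightarrow> nat) set)"
  have red: "(\<Sum>k\<le>N. fscale (c k) (p k)) \<in> Ideal F" if "(\<Sum>k\<le>N. fscale (c k) (b k)) = 0" for c
  proof -
    have "(\<Sum>k\<le>N. fscale (c k) (p k - b k)) \<in> Ideal F"
      using b by (intro Ideal_sum Ideal_scale) blast
    then show ?thesis using that by (simp add: fn.scale_right_diff_distrib sum_subtractf)
  qed
  have "\<exists>c. (\<exists>k\<le>N. c k \<noteq> 0) \<and> (\<Sum>k\<le>N. fscale (c k) (b k)) = 0"
  proof (cases "inj_on b {..N}")
    \<comment> \<open>Linear dependence is a property of sets, so two equal remainders need a
      relation of their own.\<close>
    case False
    then obtain k l where kl: "k \<le> N" "l \<le> N" "k \<noteq> l" "b k = b l" by (auto simp: inj_on_def)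
    let ?c = "\<lambda>j. if j = k then 1 else if j = l then -1 else 0 :: complex"
    have "(\<Sum>j\<le>N. fscale (?c j) (b j)) = (\<Sum>j\<in>{k,l}. fscale (?c j) (b j))"
      using kl by (intro sum.mono_neutral_right) auto
    also have "\<dots> = 0" using kl by simp
    finally have "(\<exists>j\<le>N. ?c j \<noteq> 0) \<and> (\<Sum>j\<le>N. fscale (?c j) (b j)) = 0"
      using kl(1) by (intro conjI exI[of _ k]) auto
    then show ?thesis by (intro exI)
  next
    case True
    have "fn.dependent (b ` {..N})"
    proof (rule ccontr)
      assume "\<not> ?thesis"
      moreover have "b ` {..N} \<subseteq> fn.span (mon ` Bexp e)" using b unfolding Bsp_def by blast
      ultimately have "card (b ` {..N}) \<le> card (mon ` (Bexp e :: ('n \<Rightarrow> nat) set))"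
        using fn.independent_span_bound[of "mon ` Bexp e" "b ` {..N}"] by simp
      also have "\<dots> \<le> N" unfolding N_def by (rule card_image_le) simp
      finally show False using card_image[OF True] by simp
    qed
    then obtain u where u: "\<exists>v\<in>b ` {..N}. u v \<noteq> 0" "(\<Sum>v\<in>b ` {..N}. fscale (u v) v) = 0"
      using fn.dependent_finite[of "b ` {..N}"] by auto
    have "(\<Sum>k\<le>N. fscale (u (b k)) (b k)) = 0"
      using u(2) by (subst (asm) sum.reindex[OF True]) simp
    then show ?thesis using u(1) by (intro exI[of _ "\<lambda>k. u (b k)"]) auto
  qed
  then show ?thesis using red by blast
qed

lemma Polys_poly: "(\<lambda>x. poly P (x $ i)) \<in> Polys"
proof (induction P)
  case 0
  show ?case using Polys_const[of 0] by simp
next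
  case (pCons a P)
  have "(\<lambda>x. a + x $ i * poly P (x $ i)) = (\<lambda>_. a) + (\<lambda>x. x $ i * poly P (x $ i))"
    by (simp add: plus_fun_def)
  also have "\<dots> \<in> Polys" by (intro Polys_add Polys_const Polys_times Polys_coord pCons)
  finally show ?case by simp
qed

text \<open>The minimal polynomial \<open>P\<close> of the variable acting on the class of
  \<open>w\<close> has a root \<open>r\<close>. By minimality the cofactor of the linear factor at
  \<open>r\<close> does not kill the class, so it produces an eigenvector.\<close>

lemma eigen_mod_Ideal:
  fixes F :: "'i \<Rightarrow> complex ^ 'n::finite \<Rightarrow> complex"
  assumes BI: "\<And>p. p \<in> Polys \<Longrightarrow> \<exists>b\<in>Bsp e. p - b \<in> Ideal F"
    and w: "w \<in> Polys" "w \<notin> Ideal F"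
  shows "\<exists>r q. q \<in> Polys \<and> q * w \<notin> Ideal F \<and> (\<lambda>x. x $ i - r) * (q * w) \<in> Ideal F"
proof -
  let ?ev = "\<lambda>P :: complex poly. (\<lambda>x :: complex ^ 'n. poly P (x $ i))"
  let ?A = "\<lambda>P. P \<noteq> 0 \<and> ?ev P * w \<in> Ideal F"
  have "\<exists>P. ?A P"
  proof -
    obtain c N where c: "\<exists>k\<le>N. c k \<noteq> 0"
      and I: "(\<Sum>k\<le>N::nat. fscale (c k) (?ev (monom 1 k) * w)) \<in> Ideal F"
      using dependent_mod_Ideal[of e F "\<lambda>k. ?ev (monom 1 k) * w", OF BI Polys_mult[OF Polys_poly w(1)]]
      by blast
    let ?P = "\<Sum>k\<le>N. monom (c k) k"
    have "coeff ?P k = c k" if "k \<le> N" for k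
      using that by (simp add: coeff_sum)
    then have "?P \<noteq> 0" using c by (metis coeff_0)
    moreover have "?ev ?P * w = (\<Sum>k\<le>N::nat. fscale (c k) (?ev (monom 1 k) * w))"
      by (simp add: fun_eq_iff sum_fun_eq poly_sum poly_monom sum_distrib_right mult.assoc)
    ultimately show ?thesis using I by (intro exI[of _ ?P]) simp
  qed
  then obtain P where P: "?A P" and min: "\<And>Q. ?A Q \<Longrightarrow> degree P \<le> degree Q"
    using ex_has_least_nat[of ?A _ degree] by metis
  have "degree P \<noteq> 0"
  proof
    assume "degree P = 0"
    then obtain a where a: "P = [:a:]" by (auto elim: degree_eq_zeroE)
    then have "fscale (1 / a) (?ev P * w) = w" using P by (auto simp: fun_eq_iff)
    then show False using Ideal_scale[of "?ev P * w" F "1 / a"] P w(2) by simp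
  qed
  then have "\<not> constant (poly P)" by (simp add: constant_degree)
  then obtain r where "poly P r = 0" using fundamental_theorem_of_algebra by blast
  then obtain Q where Q: "P = [:- r, 1:] * Q" by (auto simp: poly_eq_0_iff_dvd)
  have "Q \<noteq> 0" using P Q by auto
  then have "degree P = Suc (degree Q)" unfolding Q by (subst degree_mult_eq) auto
  then have "?ev Q * w \<notin> Ideal F" using min[of Q] \<open>Q \<noteq> 0\<close> by auto
  moreover have "(\<lambda>x. x $ i - r) * (?ev Q * w) = ?ev P * w"
    by (auto simp: fun_eq_iff Q algebra_simps)
  ultimately show ?thesis using P Polys_poly by (intro exI[of _ r] exI[of _ "?ev Q"]) auto
qed

text \<open>The variables are treated one at a time; multiplying by a further polynomial preserves
  the relations already obtained because they hold modulo an ideal.\<close>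

lemma joint_eigen:
  fixes F :: "'i \<Rightarrow> complex ^ 'n::finite \<Rightarrow> complex"
  assumes BI: "\<And>p. p \<in> Polys \<Longrightarrow> \<exists>b\<in>Bsp e. p - b \<in> Ideal F"
    and w: "w \<in> Polys" "w \<notin> Ideal F" and "finite A"
  shows "\<exists>v q. q \<in> Polys \<and> q * w \<notin> Ideal F \<and> (\<forall>i\<in>A. (\<lambda>x. x $ i - v i) * (q * w) \<in> Ideal F)"
  using \<open>finite A\<close>
proof (induction A rule: finite_induct)
  case empty
  have "1 * w \<notin> Ideal F" using w(2) by (simp only: mult_1_left not_False_eq_True)
  then show ?case using Polys_one by blast
next
  case (insert j A)
  then obtain v q where q: "q \<in> Polys" "q * w \<notin> Ideal F"
    and v: "\<forall>i\<in>A. (\<lambda>x. x $ i - v i) * (q * w) \<in> Ideal F" by blast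
  obtain r s where s: "s \<in> Polys" "s * (q * w) \<notin> Ideal F" "(\<lambda>x. x $ j - r) * (s * (q * w)) \<in> Ideal F"
    using eigen_mod_Ideal[OF BI Polys_mult[OF q(1) w(1)] q(2), of j] by blast
  have "(\<lambda>x. x $ i - (v(j := r)) i) * ((s * q) * w) \<in> Ideal F" if "i \<in> insert j A" for i
  proof (cases "i = j")
    case True
    then show ?thesis using s(3) by (simp add: mult.assoc)
  next
    case False
    then have "(\<lambda>x. x $ i - v i) * (q * w) \<in> Ideal F" using v that by blast
    then have "s * ((\<lambda>x. x $ i - v i) * (q * w)) \<in> Ideal F" by (rule Ideal_mult[OF s(1)])
    then show ?thesis using False by (simp add: mult.assoc mult.left_commute)
  qed
  moreover have "s * q \<in> Polys" "(s * q) * w \<notin> Ideal F"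
    using s q by (auto intro: Polys_mult simp: mult.assoc)
  ultimately show ?case by blast
qed

lemma eigen_value:
  fixes F :: "'i \<Rightarrow> complex ^ 'n::finite \<Rightarrow> complex"
  assumes "\<And>i. (\<lambda>x. x $ i - v $ i) * w \<in> Ideal F" and "p \<in> Polys"
  shows "(\<lambda>x. p x - p v) * w \<in> Ideal F"
  using assms(2) unfolding Polys_def Ideal_def
proof (rule span_induct_linear[where L = "\<lambda>p. (\<lambda>x. p x - p v) * w"])
  show "flinear (\<lambda>p. (\<lambda>x. p x - p v) * w)"
    by (rule flinearI) (auto simp: fun_eq_iff algebra_simps)
  fix s :: "complex ^ 'n \<Rightarrow> complex" assume "s \<in> range mon"
  then obtain a where s: "s = mon a" by blast
  have "(\<lambda>x. mon a x - mon a v) * w \<in> Ideal F"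
  proof (induction a rule: exp_induct)
    case 0
    have "(\<lambda>x. mon 0 x - mon 0 v) * w = 0" by (simp add: fun_eq_iff)
    then show ?case using Ideal_zero by (simp only:)
  next
    case (add a i)
    have "mon a * ((\<lambda>x. x $ i - v $ i) * w) + fscale (v $ i) ((\<lambda>x. mon a x - mon a v) * w) \<in> Ideal F"
      by (intro Ideal_add Ideal_scale Ideal_mult mon_Polys assms(1) add)
    moreover have "mon a * ((\<lambda>x. x $ i - v $ i) * w) + fscale (v $ i) ((\<lambda>x. mon a x - mon a v) * w)
      = (\<lambda>x. mon (unit_exp i + a) x - mon (unit_exp i + a) v) * w"
      unfolding mon_add mon_unit_exp by (simp add: fun_eq_iff algebra_simps)
    ultimately show ?case by (simp only:)
  qed
  then show "(\<lambda>x. s x - s v) * w \<in> fn.span {mon c * F i |c i. True}" by (simp only: s Ideal_def)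
qed

text \<open>An algebraic form of a reduced isolated zero: \<open>s\<close> is invertible near
  \<open>v\<close> and multiplies the maximal ideal of \<open>v\<close> into the ideal, so the local
  ring of the quotient at \<open>v\<close> is the field of constants.\<close>

definition simple_zero :: "('i \<Rightarrow> complex ^ 'n::finite \<Rightarrow> complex) \<Rightarrow> complex ^ 'n \<Rightarrow> bool" where
  "simple_zero F v \<longleftrightarrow> (\<exists>s\<in>Polys. s v \<noteq> 0 \<and> (\<forall>p\<in>Polys. p v = 0 \<longrightarrow> s * p \<in> Ideal F))"

text \<open>If \<open>b\<close> were outside the ideal, some multiple \<open>q * b\<close> would be
  a joint eigenvector with eigenvalues \<open>v\<close>. Each \<open>F i\<close> acts on it both as
  0 and as \<open>F i v\<close>, so \<open>v\<close> is a zero. There \<open>b\<close> vanishes, so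
  the \<open>s\<close> of the simple zero kills \<open>q * b\<close> although its eigenvalue
  \<open>s v\<close> is not 0.\<close>

lemma nullstellensatz:
  fixes F :: "'i \<Rightarrow> complex ^ 'n::finite \<Rightarrow> complex"
  assumes BI: "\<And>p. p \<in> Polys \<Longrightarrow> \<exists>b\<in>Bsp e. p - b \<in> Ideal F"
    and F: "\<And>i. F i \<in> Polys"
    and simple: "\<And>v. (\<And>i. F i v = 0) \<Longrightarrow> simple_zero F v"
    and b: "b \<in> Polys" "\<And>v. (\<And>i. F i v = 0) \<Longrightarrow> b v = 0"
  shows "b \<in> Ideal F"
proof (rule ccontr)
  assume "b \<notin> Ideal F"
  then obtain v' q where q: "q \<in> Polys" "q * b \<notin> Ideal F"
    and v': "\<forall>i\<in>UNIV. (\<lambda>x. x $ i - v' i) * (q * b) \<in> Ideal F"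
    using joint_eigen[OF BI b(1), of "UNIV :: 'n set"] by auto
  define v where "v = (\<chi> i. v' i)"
  have ev: "(\<lambda>x. p x - p v) * (q * b) \<in> Ideal F" if "p \<in> Polys" for p
    by (rule eigen_value[OF _ that]) (use v' in \<open>simp add: v_def\<close>)
  have val: "p v = 0" if "p \<in> Polys" "p * (q * b) \<in> Ideal F" for p
  proof (rule ccontr)
    assume nz: "p v \<noteq> 0"
    have "p * (q * b) - (\<lambda>x. p x - p v) * (q * b) = fscale (p v) (q * b)"
      by (simp add: fun_eq_iff algebra_simps)
    then have "fscale (p v) (q * b) \<in> Ideal F"
      using Ideal_diff[OF that(2) ev[OF that(1)]] by (simp only:)
    then have "fscale (1 / p v) (fscale (p v) (q * b)) \<in> Ideal F" by (rule Ideal_scale)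
    moreover have "fscale (1 / p v) (fscale (p v) (q * b)) = q * b" using nz by (simp add: fun_eq_iff)
    ultimately show False using q(2) by (simp only:)
  qed
  have zero: "F i v = 0" for i
    using val[OF F] Ideal_gen[of "q * b" F i] Polys_mult[OF q(1) b(1)] by (simp add: mult.commute)
  then obtain s where s: "s \<in> Polys" "s v \<noteq> 0" "s * b \<in> Ideal F"
    using simple[of v] b unfolding simple_zero_def by blast
  have "s * (q * b) \<in> Ideal F" using Ideal_mult[OF q(1) s(3)] by (simp add: mult.left_commute)
  then show False using val s by blast
qed

text \<open>A first-order Taylor formula with polynomial quotients \<open>L\<close> in place of
  limits, which makes it usable inside an ideal; \<open>J\<close> is the gradient at
  \<open>v\<close>.\<close>

definition has_grad :: "(complex ^ 'n::finite \<Rightarrow> complex) \<Rightarrow> ('n \<Rightarrow> complex) \<Rightarrow> complex ^ 'n \<Rightarrow> bool" where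
  "has_grad p J v \<longleftrightarrow> (\<exists>L. (\<forall>l. L l \<in> Polys \<and> L l v = J l) \<and>
     (\<forall>x. p x - p v = (\<Sum>l\<in>UNIV. L l x * (x $ l - v $ l))))"

text \<open>At a zero, \<open>F\<close> is the matrix \<open>A x\<close> of quotients applied to
  \<open>x - v\<close>. Cramer's rule writes \<open>det (A x)\<close> times each coordinate of
  \<open>x - v\<close> as a combination of the \<open>F i\<close>, and \<open>det (A v)\<close> is
  the Jacobian determinant.\<close>

lemma simple_zeroI:
  fixes F :: "'n \<Rightarrow> complex ^ 'n::finite \<Rightarrow> complex"
  assumes grad: "\<And>i. has_grad (F i) (J i) v" and zero: "\<And>i. F i v = 0"
    and det: "det (\<chi> i l. J i l) \<noteq> 0"
  shows "simple_zero F v"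
proof -
  have "\<forall>i. \<exists>L. (\<forall>l. L l \<in> Polys \<and> L l v = J i l) \<and>
     (\<forall>x. F i x - F i v = (\<Sum>l\<in>UNIV. L l x * (x $ l - v $ l)))"
    using grad by (simp add: has_grad_def)
  from choice[OF this] obtain L where L: "\<And>i l. L i l \<in> Polys" "\<And>i l. L i l v = J i l"
    and FL: "\<And>i x. F i x - F i v = (\<Sum>l\<in>UNIV. L i l x * (x $ l - v $ l))" by blast
  define A where "A x = (\<chi> i l. L i l x)" for x
  define s where "s x = det (A x)" for x
  have s: "s \<in> Polys"
    unfolding s_def A_def det_def
    by (intro Polys_sum Polys_times Polys_prod Polys_const) (simp add: L)
  have sv: "s v \<noteq> 0" using det by (simp add: s_def A_def L)
  have "(\<lambda>x. x $ k - v $ k) * s \<in> Ideal F" for k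
  proof -
    \<comment> \<open>One term of the determinant with column \<open>k\<close> replaced, without the
      factor in the row that \<open>p\<close> sends to \<open>k\<close>.\<close>
    define G where "G p x = of_int (sign p) * (\<Prod>i\<in>UNIV - {inv p k}. L i (p i) x)" for p x
    have G: "G p \<in> Polys" for p unfolding G_def by (intro Polys_times Polys_prod Polys_const) (simp add: L)
    have "(x $ k - v $ k) * s x = (\<Sum>p\<in>{p. p permutes UNIV}. G p x * F (inv p k) x)" for x
    proof -
      have Ay: "(A x *v (x - v)) $ i = F i x" for i
        using FL[of i x] by (simp add: matrix_vector_mult_def A_def zero)
      have "(x $ k - v $ k) * s x = det (\<chi> i j. if j = k then (A x *v (x - v)) $ i else A x $ i $ j)"
        unfolding s_def by (subst cramer_lemma) simp
      also have "\<dots> = (\<Sum>p\<in>{p. p permutes UNIV}. of_int (sign p) *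
          (\<Prod>i\<in>UNIV. if p i = k then F i x else L i (p i) x))"
        unfolding det_def Ay by (intro sum.cong prod.cong arg_cong2[of _ _ _ _ "(*)"]) (auto simp: A_def)
      also have "\<dots> = (\<Sum>p\<in>{p. p permutes UNIV}. G p x * F (inv p k) x)"
      proof (rule sum.cong)
        fix p :: "'n \<Rightarrow> 'n" assume "p \<in> {p. p permutes UNIV}"
        then have p: "p permutes UNIV" by simp
        have eq: "p i = k \<longleftrightarrow> i = inv p k" for i using permutes_inv_eq[OF p, of k i] by auto
        have "(\<Prod>i\<in>UNIV. if p i = k then F i x else L i (p i) x)
            = F (inv p k) x * (\<Prod>i\<in>UNIV - {inv p k}. L i (p i) x)"
          by (subst prod.remove[of UNIV "inv p k"]) (auto simp: eq intro!: prod.cong)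
        then show "of_int (sign p) * (\<Prod>i\<in>UNIV. if p i = k then F i x else L i (p i) x)
            = G p x * F (inv p k) x" by (simp add: G_def)
      qed simp
      finally show ?thesis .
    qed
    then have "(\<lambda>x. x $ k - v $ k) * s = (\<Sum>p\<in>{p. p permutes UNIV}. G p * F (inv p k))"
      by (simp add: fun_eq_iff sum_fun_eq)
    also have "\<dots> \<in> Ideal F" by (intro Ideal_sum Ideal_gen G)
    finally show ?thesis .
  qed
  then have "(\<lambda>x. p x - p v) * s \<in> Ideal F" if "p \<in> Polys" for p by (rule eigen_value[OF _ that])
  moreover have "(\<lambda>x. p x - p v) * s = s * p" if "p v = 0" for p
    using that by (simp add: fun_eq_iff)
  ultimately have "s * p \<in> Ideal F" if "p \<in> Polys" "p v = 0" for p using that by metis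
  then show ?thesis using s sv unfolding simple_zero_def by blast
qed

section \<open>Polynomial families and general position\<close>

text \<open>The coefficients are real because the exceptional set has to be real algebraic, while
  the functions have complex values.\<close>

definition polyfam :: "'k set \<Rightarrow> ('k \<Rightarrow> 'z \<Rightarrow> complex) \<Rightarrow> ('f::real_normed_vector \<Rightarrow> 'z \<Rightarrow> complex) \<Rightarrow> bool" where
  "polyfam K w g \<longleftrightarrow> (\<exists>G. (\<forall>k. real_polynomial_function (\<lambda>f. G f k)) \<and>
     (\<forall>f. g f = (\<Sum>k\<in>K. fscale (of_real (G f k)) (w k))))"

lemma polyfam_zero: "polyfam K w (\<lambda>f. 0)"
  unfolding polyfam_def by (rule exI[of _ "\<lambda>f k. 0"]) (simp add: real_polynomial_function.intros(2))

lemma polyfam_base: "finite K \<Longrightarrow> k \<in> K \<Longrightarrow> polyfam K w (\<lambda>f. w k)"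
  unfolding polyfam_def
  by (rule exI[of _ "\<lambda>f l. if l = k then 1 else 0"])
    (auto simp: if_distrib[of of_real] if_distrib[of "\<lambda>a. fscale a _"] cong: if_cong
      intro: real_polynomial_function.intros(2))

lemma polyfam_add:
  assumes "polyfam K w g" "polyfam K w h" shows "polyfam K w (\<lambda>f. g f + h f)"
proof -
  obtain G where "\<forall>k. real_polynomial_function (\<lambda>f. G f k)"
    "\<forall>f. g f = (\<Sum>k\<in>K. fscale (of_real (G f k)) (w k))" using assms(1) unfolding polyfam_def by blast
  moreover obtain H where "\<forall>k. real_polynomial_function (\<lambda>f. H f k)"
    "\<forall>f. h f = (\<Sum>k\<in>K. fscale (of_real (H f k)) (w k))" using assms(2) unfolding polyfam_def by blast
  ultimately show ?thesis unfolding polyfam_def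
    by (intro exI[of _ "\<lambda>f k. G f k + H f k"])
      (auto simp: fn.scale_left_distrib sum.distrib intro: real_polynomial_function.intros)
qed

lemma polyfam_scale:
  assumes "real_polynomial_function r" "polyfam K w g"
  shows "polyfam K w (\<lambda>f. fscale (of_real (r f)) (g f))"
proof -
  obtain G where "\<forall>k. real_polynomial_function (\<lambda>f. G f k)"
    "\<forall>f. g f = (\<Sum>k\<in>K. fscale (of_real (G f k)) (w k))" using assms(2) unfolding polyfam_def by blast
  then show ?thesis unfolding polyfam_def
    using assms(1) by (intro exI[of _ "\<lambda>f k. r f * G f k"])
      (auto simp: fn.scale_sum_right intro: real_polynomial_function.intros)
qed

lemma polyfam_scale_const: "polyfam K w g \<Longrightarrow> polyfam K w (\<lambda>f. fscale (of_real r) (g f))"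
  by (rule polyfam_scale) (rule real_polynomial_function.intros(2))

lemma polyfam_diff: "polyfam K w g \<Longrightarrow> polyfam K w h \<Longrightarrow> polyfam K w (\<lambda>f. g f - h f)"
  using polyfam_add[of K w g "\<lambda>f. fscale (of_real (-1)) (h f)"] polyfam_scale_const[of K w h "-1"]
  by (simp add: fn.scale_minus_left)

lemma polyfam_sum: "(\<And>a. a \<in> A \<Longrightarrow> polyfam K w (g a)) \<Longrightarrow> polyfam K w (\<lambda>f. \<Sum>a\<in>A. g a f)"
  by (induction A rule: infinite_finite_induct) (simp_all add: polyfam_zero polyfam_add)

lemma polyfam_linear:
  fixes g :: "'f::real_normed_vector \<Rightarrow> 'z \<Rightarrow> complex"
  assumes "polyfam K w g" "flinear L" "\<And>k. k \<in> K \<Longrightarrow> polyfam K' w' (\<lambda>f::'f. L (w k))"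
  shows "polyfam K' w' (\<lambda>f. L (g f))"
proof -
  obtain G where "\<forall>k. real_polynomial_function (\<lambda>f. G f k)"
    and g: "\<forall>f. g f = (\<Sum>k\<in>K. fscale (of_real (G f k)) (w k))" using assms(1) unfolding polyfam_def by blast
  then have "polyfam K' w' (\<lambda>f. \<Sum>k\<in>K. fscale (of_real (G f k)) (L (w k)))"
    by (intro polyfam_sum) (rule polyfam_scale[OF _ assms(3)], auto)
  then show ?thesis
    using g by (simp add: flinear_sum[OF assms(2)] fp.linear_scale[OF assms(2)])
qed

lemma polyfam_mult:
  fixes g h :: "'f::real_normed_vector \<Rightarrow> 'z \<Rightarrow> complex"
  assumes "polyfam K w g" "polyfam K' w' h" "\<And>k l. k \<in> K \<Longrightarrow> l \<in> K' \<Longrightarrow> polyfam K'' w'' (\<lambda>f::'f. w k * w' l)"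
  shows "polyfam K'' w'' (\<lambda>f. g f * h f)"
proof -
  obtain G where G: "\<forall>k. real_polynomial_function (\<lambda>f. G f k)"
    "\<forall>f. g f = (\<Sum>k\<in>K. fscale (of_real (G f k)) (w k))" using assms(1) unfolding polyfam_def by blast
  obtain H where H: "\<forall>k. real_polynomial_function (\<lambda>f. H f k)"
    "\<forall>f. h f = (\<Sum>k\<in>K'. fscale (of_real (H f k)) (w' k))" using assms(2) unfolding polyfam_def by blast
  have "polyfam K'' w'' (\<lambda>f. \<Sum>k\<in>K. \<Sum>l\<in>K'. fscale (of_real (G f k)) (fscale (of_real (H f l)) (w k * w' l)))"
    using G(1) H(1) by (intro polyfam_sum) (rule polyfam_scale[OF _ polyfam_scale[OF _ assms(3)]], auto)
  moreover have "g f * h f = (\<Sum>k\<in>K. \<Sum>l\<in>K'. fscale (of_real (G f k)) (fscale (of_real (H f l)) (w k * w' l)))" for f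
    by (simp add: G(2) H(2) fun_eq_iff sum_fun_eq sum_product mult_ac)
  ultimately show ?thesis by simp
qed

text \<open>The point \<open>f0\<close> is part of the notion: conditions that share it can be
  combined by multiplying their polynomials without the product becoming identically 0.\<close>

definition generic :: "'f::real_normed_vector \<Rightarrow> ('f \<Rightarrow> bool) \<Rightarrow> bool" where
  "generic f0 S \<longleftrightarrow> (\<exists>P. real_polynomial_function P \<and> P f0 \<noteq> 0 \<and> (\<forall>f. P f \<noteq> 0 \<longrightarrow> S f))"

lemma generic_mono: "generic f0 S \<Longrightarrow> (\<And>f. S f \<Longrightarrow> S' f) \<Longrightarrow> generic f0 S'"
  unfolding generic_def by blast

lemma generic_conj: "generic f0 S \<Longrightarrow> generic f0 S' \<Longrightarrow> generic f0 (\<lambda>f. S f \<and> S' f)"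
  unfolding generic_def
proof (elim exE conjE)
  fix P Q assume "real_polynomial_function P" "P f0 \<noteq> 0" "\<forall>f. P f \<noteq> 0 \<longrightarrow> S f"
    "real_polynomial_function Q" "Q f0 \<noteq> 0" "\<forall>f. Q f \<noteq> 0 \<longrightarrow> S' f"
  then show "\<exists>P. real_polynomial_function P \<and> P f0 \<noteq> 0 \<and> (\<forall>f. P f \<noteq> 0 \<longrightarrow> S f \<and> S' f)"
    by (intro exI[of _ "\<lambda>f. P f * Q f"]) (auto intro: real_polynomial_function.intros)
qed

text \<open>Gaussian elimination, with the pivots recorded in a polynomial.\<close>

lemma generic_span:
  assumes "finite K" "finite J" "inj_on w K" "fn.independent (w ` K)"
    and "\<And>j. j \<in> J \<Longrightarrow> polyfam K w (g j)"
    and "\<And>k. k \<in> K \<Longrightarrow> w k \<in> fn.span ((\<lambda>j. g j f0) ` J)"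
  shows "generic f0 (\<lambda>f. \<forall>k\<in>K. w k \<in> fn.span ((\<lambda>j. g j f) ` J))"
  using assms
proof (induction K arbitrary: g rule: finite_induct)
  case empty
  show ?case unfolding generic_def
    by (rule exI[of _ "\<lambda>_. 1"]) (simp add: real_polynomial_function.intros(2))
next
  case (insert k0 K)
  let ?W = "w ` insert k0 K"
  have w0: "w k0 \<notin> w ` K" using insert.hyps insert.prems(2) by auto
  have "\<forall>j. \<exists>G. j \<in> J \<longrightarrow> (\<forall>k. real_polynomial_function (\<lambda>f. G f k)) \<and>
     (\<forall>f. g j f = (\<Sum>k\<in>insert k0 K. fscale (of_real (G f k)) (w k)))"
    using insert.prems(4) unfolding polyfam_def by blast
  from choice[OF this] obtain G
    where "\<forall>j. j \<in> J \<longrightarrow> (\<forall>k. real_polynomial_function (\<lambda>f. G j f k)) \<and>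
     (\<forall>f. g j f = (\<Sum>k\<in>insert k0 K. fscale (of_real (G j f k)) (w k)))" ..
  then have G: "\<And>j k. j \<in> J \<Longrightarrow> real_polynomial_function (\<lambda>f. G j f k)"
    and g: "\<And>j f. j \<in> J \<Longrightarrow> g j f = fscale (of_real (G j f k0)) (w k0) + (\<Sum>k\<in>K. fscale (of_real (G j f k)) (w k))"
    using insert.hyps by auto
  obtain L where L: "flinear L" and L0: "L (w k0) = w k0" and LK: "\<And>k. k \<in> K \<Longrightarrow> L (w k) = 0"
  proof -
    obtain L where "flinear L" "\<forall>b\<in>?W. L b = (if b = w k0 then w k0 else 0)"
      using fp.linear_independent_extend[OF insert.prems(3), of "\<lambda>b. if b = w k0 then w k0 else 0"] by blast
    moreover have "w k \<noteq> w k0" if "k \<in> K" for k using w0 that by (metis imageI)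
    ultimately show ?thesis by (intro that[of L]) simp_all
  qed
  have Lg: "L (g j f) = fscale (of_real (G j f k0)) (w k0)" if "j \<in> J" for j f
  proof -
    have "L (g j f) = fscale (of_real (G j f k0)) (L (w k0)) + (\<Sum>k\<in>K. fscale (of_real (G j f k)) (L (w k)))"
      unfolding g[OF that] by (simp only: fp.linear_add[OF L] flinear_sum[OF L] fp.linear_scale[OF L])
    then show ?thesis using L0 LK by simp
  qed
  have wk0: "w k0 \<noteq> 0" using insert.prems(3) fn.dependent_zero[of ?W] by (metis imageI insertI1)
  have "\<exists>j0\<in>J. G j0 f0 k0 \<noteq> 0"
  proof (rule ccontr)
    assume none: "\<not> ?thesis"
    obtain c where c: "w k0 = (\<Sum>j\<in>J. fscale (c j) (g j f0))"
      using span_family[OF insert.prems(1), of "w k0" "\<lambda>j. g j f0"] insert.prems(5) by blast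
    have "L (w k0) = (\<Sum>j\<in>J. fscale (c j) (L (g j f0)))"
      by (subst c) (simp only: flinear_sum[OF L] fp.linear_scale[OF L])
    also have "\<dots> = 0" using none Lg by (intro sum.neutral) simp
    finally show False using L0 wk0 by simp
  qed
  then obtain j0 where j0: "j0 \<in> J" "G j0 f0 k0 \<noteq> 0" by blast
  \<comment> \<open>Cross-multiplication instead of division keeps the coefficients polynomial in
    \<open>f\<close>.\<close>
  define g' where "g' j f = fscale (of_real (G j0 f k0)) (g j f) - fscale (of_real (G j f k0)) (g j0 f)" for j f
  have "generic f0 (\<lambda>f. \<forall>k\<in>K. w k \<in> fn.span ((\<lambda>j. g' j f) ` J))"
  proof (rule insert.IH)
    show "finite J" "inj_on w K" using insert.prems by auto
    show "fn.independent (w ` K)" using insert.prems(3) by (rule fn.independent_mono) auto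
    show "polyfam K w (g' j)" if "j \<in> J" for j
      unfolding polyfam_def
    proof (intro exI conjI allI)
      show "real_polynomial_function (\<lambda>f. G j0 f k0 * G j f k - G j f k0 * G j0 f k)" for k
        using G that j0(1) by (intro real_polynomial_function_diff real_polynomial_function.intros(4))
      show "g' j f = (\<Sum>k\<in>K. fscale (of_real (G j0 f k0 * G j f k - G j f k0 * G j0 f k)) (w k))" for f
        by (simp add: g'_def g[OF that] g[OF j0(1)] fun_eq_iff sum_fun_eq algebra_simps sum_distrib_left sum_subtractf)
    qed
    fix k assume k: "k \<in> K"
    obtain c where c: "w k = (\<Sum>j\<in>J. fscale (c j) (g j f0))"
      using span_family[OF insert.prems(1), of "w k" "\<lambda>j. g j f0"] insert.prems(5) k by blast
    \<comment> \<open>Projecting a representation of \<open>w k\<close> to the pivot direction shows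
      that the multiples of the pivot row subtracted by the elimination add up to 0 at
      \<open>f0\<close>.\<close>
    have "0 = L (w k)" using LK[OF k] by simp
    also have "L (w k) = (\<Sum>j\<in>J. fscale (c j) (L (g j f0)))"
      by (subst c) (simp only: flinear_sum[OF L] fp.linear_scale[OF L])
    also have "\<dots> = (\<Sum>j\<in>J. fscale (c j * of_real (G j f0 k0)) (w k0))"
      using Lg by (intro sum.cong) simp_all
    also have "\<dots> = fscale (\<Sum>j\<in>J. c j * of_real (G j f0 k0)) (w k0)"
      by (rule fn.scale_sum_left[symmetric])
    finally have 0: "(\<Sum>j\<in>J. c j * of_real (G j f0 k0)) = 0" using wk0 by (metis fn.scale_eq_0_iff)
    have "(\<Sum>j\<in>J. fscale (c j) (g' j f0)) = fscale (of_real (G j0 f0 k0)) (\<Sum>j\<in>J. fscale (c j) (g j f0))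
        - fscale (\<Sum>j\<in>J. c j * of_real (G j f0 k0)) (g j0 f0)"
      by (simp add: g'_def fun_eq_iff sum_fun_eq algebra_simps sum_distrib_left sum_distrib_right sum_subtractf)
    also have "\<dots> = fscale (of_real (G j0 f0 k0)) (w k)" using 0 c by simp
    finally have "w k = (\<Sum>j\<in>J. fscale (c j / of_real (G j0 f0 k0)) (g' j f0))"
      using j0(2) by (simp add: fun_eq_iff sum_fun_eq sum_divide_distrib[symmetric] divide_simps)
    also have "\<dots> \<in> fn.span ((\<lambda>j. g' j f0) ` J)"
      by (intro fn.span_sum fn.span_scale fn.span_base imageI)
    finally show "w k \<in> fn.span ((\<lambda>j. g' j f0) ` J)" .
  qed
  moreover have "generic f0 (\<lambda>f. G j0 f k0 \<noteq> 0)"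
    unfolding generic_def using G[OF j0(1)] j0(2) by (intro exI[of _ "\<lambda>f. G j0 f k0"]) auto
  ultimately have "generic f0 (\<lambda>f. (\<forall>k\<in>K. w k \<in> fn.span ((\<lambda>j. g' j f) ` J)) \<and> G j0 f k0 \<noteq> 0)"
    by (rule generic_conj)
  then show ?case
  proof (rule generic_mono)
    fix f assume f: "(\<forall>k\<in>K. w k \<in> fn.span ((\<lambda>j. g' j f) ` J)) \<and> G j0 f k0 \<noteq> 0"
    let ?S = "fn.span ((\<lambda>j. g j f) ` J)"
    have gS: "g j f \<in> ?S" if "j \<in> J" for j using that by (intro fn.span_base) auto
    have "(\<lambda>j. g' j f) ` J \<subseteq> ?S"
      unfolding g'_def using gS j0(1) by (auto intro!: fn.span_diff fn.span_scale)
    then have "fn.span ((\<lambda>j. g' j f) ` J) \<subseteq> ?S" by (rule fn.span_minimal) (rule fn.subspace_span)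
    then have K: "w k \<in> ?S" if "k \<in> K" for k using f that by blast
    have "fscale (1 / of_real (G j0 f k0)) (g j0 f - (\<Sum>k\<in>K. fscale (of_real (G j0 f k)) (w k))) \<in> ?S"
      using gS[OF j0(1)] K by (intro fn.span_scale fn.span_diff fn.span_sum) auto
    moreover have "fscale (1 / of_real (G j0 f k0)) (g j0 f - (\<Sum>k\<in>K. fscale (of_real (G j0 f k)) (w k))) = w k0"
      unfolding g[OF j0(1)] using f by (simp add: fun_eq_iff)
    ultimately have "w k0 \<in> ?S" by (simp only:)
    then show "\<forall>k\<in>insert k0 K. w k \<in> ?S" using K by blast
  qed
qed

text \<open>By counting: a repetition or a dependence would leave a spanning set with fewer elements
  than \<open>K\<close>.\<close>

lemma spanning_family_independent:
  assumes "finite J" "finite K" "inj_on w K" "fn.independent (w ` K)"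
    and sp: "\<And>k. k \<in> K \<Longrightarrow> w k \<in> fn.span (g ` J)" and "card J \<le> card K"
  shows "inj_on g J \<and> fn.independent (g ` J)"
proof -
  have bound: "card K \<le> card S" if "finite S" "g ` J \<subseteq> fn.span S" for S
  proof -
    have "fn.span (g ` J) \<subseteq> fn.span S" using that(2) by (rule fn.span_minimal) (rule fn.subspace_span)
    then have "w ` K \<subseteq> fn.span S" using sp by blast
    then have "card (w ` K) \<le> card S" using fn.independent_span_bound[OF that(1) assms(4)] by blast
    then show ?thesis by (simp add: card_image[OF assms(3)])
  qed
  have "card K \<le> card (g ` J)" using assms(1) by (intro bound) (auto intro: fn.span_base)
  then have c: "card (g ` J) = card J" using assms(6) card_image_le[OF assms(1), of g] by simp
  have "fn.independent (g ` J)"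
  proof
    assume "fn.dependent (g ` J)"
    then obtain a where a: "a \<in> g ` J" "a \<in> fn.span (g ` J - {a})" unfolding fn.dependent_def by blast
    have "g ` J \<subseteq> fn.span (g ` J - {a})"
    proof
      fix x assume "x \<in> g ` J"
      then show "x \<in> fn.span (g ` J - {a})" using a(2) by (cases "x = a") (auto intro: fn.span_base)
    qed
    then have "card K \<le> card (g ` J - {a})" using assms(1) by (intro bound) auto
    moreover have "card (g ` J - {a}) < card (g ` J)" using a(1) assms(1) by (intro psubset_card_mono) auto
    ultimately show False using c assms(6) by simp
  qed
  then show ?thesis using eq_card_imp_inj_on[OF assms(1) c] by blast
qed

lemma independent_familyI:
  assumes "finite K" "\<And>c. (\<Sum>k\<in>K. fscale (c k) (w k)) = 0 \<Longrightarrow> \<forall>k\<in>K. c k = 0"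
  shows "inj_on w K \<and> fn.independent (w ` K)"
proof -
  have inj: "inj_on w K"
  proof (rule inj_onI, rule ccontr)
    fix k l assume kl: "k \<in> K" "l \<in> K" "w k = w l" "k \<noteq> l"
    let ?c = "\<lambda>j. if j = k then 1 else if j = l then -1 else 0 :: complex"
    have "(\<Sum>j\<in>K. fscale (?c j) (w j)) = (\<Sum>j\<in>{k,l}. fscale (?c j) (w j))"
      using kl assms(1) by (intro sum.mono_neutral_right) auto
    also have "\<dots> = 0" using kl by simp
    finally have "\<forall>j\<in>K. ?c j = 0" by (rule assms(2))
    then have "?c k = 0" using kl(1) by (rule bspec)
    then show False by simp
  qed
  have "fn.independent (w ` K)"
  proof
    assume "fn.dependent (w ` K)"
    then obtain u where u: "\<exists>v\<in>w ` K. u v \<noteq> 0" "(\<Sum>v\<in>w ` K. fscale (u v) v) = 0"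
      using fn.dependent_finite[of "w ` K"] assms(1) by auto
    have "(\<Sum>k\<in>K. fscale (u (w k)) (w k)) = 0"
      using u(2) by (subst (asm) sum.reindex[OF inj]) simp
    then have "\<forall>k\<in>K. u (w k) = 0" by (rule assms(2)[of "\<lambda>k. u (w k)"])
    then show False using u(1) by auto
  qed
  then show ?thesis using inj by blast
qed

text \<open>The projection that fixes \<open>A\<close> and kills \<open>B\<close> both fixes and
  kills \<open>p\<close>.\<close>

lemma span_Int_independent:
  assumes "fn.independent (A \<union> B)" "A \<inter> B = {}" "p \<in> fn.span A" "p \<in> fn.span B"
  shows "p = 0"
proof -
  obtain L where L: "flinear L" "\<forall>b\<in>A \<union> B. L b = (if b \<in> A then b else 0)"
    using fp.linear_independent_extend[OF assms(1), of "\<lambda>b. if b \<in> A then b else 0"] by blast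
  have "L p \<in> fn.span {}"
    by (rule span_induct_linear[OF assms(4) L(1)]) (use L(2) assms(2) in \<open>auto simp: fn.span_zero\<close>)
  moreover have "L p - p \<in> fn.span {}"
  proof (rule span_induct_linear[OF assms(3), where L = "\<lambda>p. L p - p"])
    show "flinear (\<lambda>p. L p - p)"
      by (rule flinearI) (auto simp: fp.linear_add[OF L(1)] fp.linear_scale[OF L(1)] fn.scale_right_diff_distrib)
  qed (use L(2) in auto)
  ultimately show ?thesis by simp
qed

section \<open>Perturbations of a system of pure powers\<close>

definition pw :: "nat \<Rightarrow> 'n \<Rightarrow> 'n \<Rightarrow> nat" where
  "pw e i j = (if j = i then e else 0)"

lemma deg_pw [simp]: "deg (pw e i) = e"
  by (simp add: deg_def pw_def)

text \<open>The first variable that occurs with exponent at least \<open>e\<close>.\<close>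

definition lead :: "nat \<Rightarrow> ('n::finite \<Rightarrow> nat) \<Rightarrow> 'n" where
  "lead e a = arg_min to_nat (\<lambda>i. e \<le> a i)"

definition red :: "nat \<Rightarrow> ('n::finite \<Rightarrow> nat) \<Rightarrow> 'n \<Rightarrow> nat" where
  "red e a j = a j - pw e (lead e a) j"

lemma lead_ge: "a \<notin> Bexp e \<Longrightarrow> e \<le> a (lead e a)"
  and lead_le: "e \<le> a i \<Longrightarrow> to_nat (lead e a) \<le> to_nat i"
proof -
  show "to_nat (lead e a) \<le> to_nat i" if "e \<le> a i" for i
    unfolding lead_def using that by (rule arg_min_nat_le)
  show "e \<le> a (lead e a)" if "a \<notin> Bexp e"
  proof -
    from that obtain i where "e \<le> a i" by (auto simp: Bexp_def not_less)
    then show ?thesis unfolding lead_def by (rule arg_min_natI)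
  qed
qed

lemma red_add: "a \<notin> Bexp e \<Longrightarrow> red e a + pw e (lead e a) = a"
proof
  fix j assume "a \<notin> Bexp e"
  then show "(red e a + pw e (lead e a)) j = a j" using lead_ge[of a e] by (auto simp: red_def pw_def)
qed

lemma deg_red: "a \<notin> Bexp e \<Longrightarrow> deg (red e a) + e = deg a"
  using red_add[of a e] by (metis deg_add deg_pw)

text \<open>This inverts the passage from an exponent to its leading variable and reduced exponent,
  so that products of such \<open>c\<close> with \<open>F i\<close> can be found again in the square
  system.\<close>

lemma lead_add_pw:
  assumes "\<And>j. to_nat j < to_nat i \<Longrightarrow> c j < e"
  shows "lead e (c + pw e i) = i" "red e (c + pw e i) = c" "0 < e \<Longrightarrow> c + pw e i \<notin> Bexp e"
proof -
  have i: "e \<le> (c + pw e i) i" by (simp add: pw_def)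
  show l: "lead e (c + pw e i) = i"
  proof (rule ccontr)
    let ?l = "lead e (c + pw e i)"
    assume n: "?l \<noteq> i"
    have "to_nat ?l \<le> to_nat i" using i by (rule lead_le)
    moreover have "to_nat ?l \<noteq> to_nat i" using n by simp
    ultimately have "to_nat ?l < to_nat i" by (rule le_neq_trans)
    then have "c ?l < e" by (rule assms)
    moreover have "e \<le> (c + pw e i) ?l" unfolding lead_def using i by (rule arg_min_natI)
    ultimately show False using n by (simp add: pw_def)
  qed
  show "red e (c + pw e i) = c" by (rule ext) (simp add: red_def l)
  show "c + pw e i \<notin> Bexp e" using i by (auto simp: Bexp_def not_less)
qed

text \<open>An abstraction of the eigenvector equations with \<open>e = d - 1\<close>. The point
  \<open>f0\<close> stands for the diagonal form, where division by the equations is explicit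
  because the leading part of each is a power of its own variable.\<close>

locale perturbed_powers =
  fixes F :: "'n::finite \<Rightarrow> 'f::real_normed_vector \<Rightarrow> complex ^ 'n \<Rightarrow> complex"
    and e :: nat and f0 :: 'f and \<gamma> :: "'n \<Rightarrow> complex"
  assumes e: "2 \<le> e" and F_polyfam: "\<And>i. polyfam (Mon e) mon (F i)"
    and F_f0: "\<And>i. F i f0 = fscale (\<gamma> i) (mon (pw e i)) - mon (unit_exp i)"
    and \<gamma>: "\<And>i. \<gamma> i \<noteq> 0"
begin

abbreviation (input) Fs :: "'f \<Rightarrow> 'n \<Rightarrow> complex ^ 'n \<Rightarrow> complex" where
  "Fs f \<equiv> \<lambda>i. F i f"

definition T :: nat where "T = top_deg e TYPE('n)"

lemma F_Pol: "F i f \<in> Pol e"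
proof -
  obtain G where "\<forall>f. F i f = (\<Sum>k\<in>Mon e. fscale (of_real (G f k)) (mon k))"
    using F_polyfam[of i] unfolding polyfam_def by blast
  then show ?thesis unfolding Pol_def by (auto intro!: fn.span_sum fn.span_scale intro: fn.span_base)
qed

lemma mon_mult_polyfam: "polyfam (Mon k) mon g \<Longrightarrow> deg c + k \<le> m \<Longrightarrow> polyfam (Mon m) mon (\<lambda>f. mon c * g f)"
  by (erule polyfam_linear[OF _ flinear_mult_left]) (auto simp flip: mon_add intro!: polyfam_base simp: Mon_def[of k], simp add: Mon_def)

text \<open>One function for every exponent: a reduced monomial itself, or the multiple of an
  equation whose leading exponent at \<open>f0\<close> is the given one. Since \<open>lead\<close>
  picks a single equation, there are as many functions as monomials, and spanning amounts to the
  invertibility of a square matrix.\<close>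

definition gfam :: "('n \<Rightarrow> nat) \<Rightarrow> 'f \<Rightarrow> complex ^ 'n \<Rightarrow> complex" where
  "gfam \<beta> f = (if \<beta> \<in> Bexp e then mon \<beta> else mon (red e \<beta>) * F (lead e \<beta>) f)"

lemma gfam_polyfam: "\<beta> \<in> Mon m \<Longrightarrow> polyfam (Mon m) mon (gfam \<beta>)"
proof (cases "\<beta> \<in> Bexp e")
  case True
  assume "\<beta> \<in> Mon m"
  with True show ?thesis by (simp add: gfam_def[abs_def] polyfam_base)
next
  case False
  assume "\<beta> \<in> Mon m"
  with False show ?thesis using deg_red[OF False]
    by (simp add: gfam_def[abs_def]) (rule mon_mult_polyfam[OF F_polyfam], simp add: Mon_def)
qed

lemma mult_F_f0: "mon c * F i f0 = fscale (\<gamma> i) (mon (c + pw e i)) - mon (c + unit_exp i)"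
  unfolding F_f0 mon_add by (simp add: fun_eq_iff algebra_simps)

text \<open>Solving for the leading monomial replaces a factor of degree \<open>e\<close> by one of
  degree 1, so the total degree falls because \<open>2 \<le> e\<close>.\<close>

lemma gfam_f0: "\<beta> \<in> Mon m \<Longrightarrow> mon \<beta> \<in> fn.span ((\<lambda>\<beta>. gfam \<beta> f0) ` Mon m)"
proof (induction "deg \<beta>" arbitrary: \<beta> rule: less_induct)
  case less
  let ?S = "fn.span ((\<lambda>\<beta>. gfam \<beta> f0) ` Mon m)"
  have g: "gfam \<beta> f0 \<in> ?S" using less.prems by (intro fn.span_base) auto
  show ?case
  proof (cases "\<beta> \<in> Bexp e")
    case True
    then show ?thesis using g by (simp add: gfam_def)
  next
    case False
    let ?i = "lead e \<beta>" let ?b = "red e \<beta> + unit_exp ?i"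
    have "deg ?b < deg \<beta>" using deg_red[OF False] e by simp
    then have b: "mon ?b \<in> ?S" using less by (simp add: Mon_def)
    have "gfam \<beta> f0 = fscale (\<gamma> ?i) (mon \<beta>) - mon ?b"
      using False by (simp only: gfam_def if_False mult_F_f0 red_add[OF False])
    then have "mon \<beta> = fscale (1 / \<gamma> ?i) (gfam \<beta> f0 + mon ?b)" using \<gamma>[of ?i] by (simp add: fun_eq_iff)
    also have "\<dots> \<in> ?S" by (intro fn.span_scale fn.span_add g b)
    finally show ?thesis .
  qed
qed

definition square :: "nat \<Rightarrow> 'f \<Rightarrow> bool" where
  "square m f \<longleftrightarrow> (\<forall>\<beta>\<in>Mon m. mon \<beta> \<in> fn.span ((\<lambda>\<beta>. gfam \<beta> f) ` Mon m))"

lemma generic_square: "generic f0 (square m)"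
  unfolding square_def
  by (rule generic_span) (auto simp: gfam_polyfam gfam_f0 independent_mon intro: inj_on_subset[OF inj_mon])

lemma square_indep: "square m f \<Longrightarrow> inj_on (\<lambda>\<beta>. gfam \<beta> f) (Mon m) \<and> fn.independent ((\<lambda>\<beta>. gfam \<beta> f) ` Mon m)"
  by (rule spanning_family_independent[of "Mon m" "Mon m" mon])
    (auto simp: square_def independent_mon intro: inj_on_subset[OF inj_mon])

lemma square_decomp:
  assumes "square m f" "p \<in> Pol m"
  shows "\<exists>b\<in>Bsp e. p - b \<in> Idl (Fs f) (m - e)"
proof -
  have "mon ` Mon m \<subseteq> fn.span ((\<lambda>\<beta>. gfam \<beta> f) ` Mon m)" using assms(1) by (auto simp: square_def)
  then have "Pol m \<subseteq> fn.span ((\<lambda>\<beta>. gfam \<beta> f) ` Mon m)"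
    unfolding Pol_def by (rule fn.span_minimal) (rule fn.subspace_span)
  then obtain c where "p = (\<Sum>\<beta>\<in>Mon m. fscale (c \<beta>) (gfam \<beta> f))"
    using span_family[of "Mon m" p "\<lambda>\<beta>. gfam \<beta> f"] assms(2) by auto
  also have "\<dots> = (\<Sum>\<beta>\<in>Mon m \<inter> Bexp e. fscale (c \<beta>) (gfam \<beta> f)) + (\<Sum>\<beta>\<in>Mon m - Bexp e. fscale (c \<beta>) (gfam \<beta> f))"
    by (rule sum.Int_Diff) simp
  finally have p: "p - (\<Sum>\<beta>\<in>Mon m \<inter> Bexp e. fscale (c \<beta>) (gfam \<beta> f)) = (\<Sum>\<beta>\<in>Mon m - Bexp e. fscale (c \<beta>) (gfam \<beta> f))"
    by simp
  have "fscale (c \<beta>) (gfam \<beta> f) \<in> Idl (Fs f) (m - e)" if "\<beta> \<in> Mon m - Bexp e" for \<beta>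
  proof (rule Idl_scale)
    have "deg (red e \<beta>) \<le> m - e" using that deg_red[of \<beta> e] unfolding Mon_def by (simp, linarith)
    then have "mon (red e \<beta>) * Fs f (lead e \<beta>) \<in> Idl (Fs f) (m - e)" by (rule Idl_gen)
    then show "gfam \<beta> f \<in> Idl (Fs f) (m - e)" using that by (simp add: gfam_def)
  qed
  then have "(\<Sum>\<beta>\<in>Mon m - Bexp e. fscale (c \<beta>) (gfam \<beta> f)) \<in> Idl (Fs f) (m - e)"
    unfolding Idl_def by (intro fn.span_sum)
  moreover have "(\<Sum>\<beta>\<in>Mon m \<inter> Bexp e. fscale (c \<beta>) (gfam \<beta> f)) \<in> Bsp e"
    unfolding Bsp_def by (intro fn.span_sum fn.span_scale fn.span_base) (auto simp: gfam_def)
  ultimately show ?thesis using p by (intro bexI) auto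
qed

text \<open>Tuples of polynomials, as functions of an index and a point. The second family below trades
  a term \<open>x\<^sub>j\<^sup>e\<close> in component \<open>i\<close> for one in an earlier component \<open>j\<close> along a Koszul relation.\<close>

definition place :: "'n \<Rightarrow> (complex ^ 'n \<Rightarrow> complex) \<Rightarrow> 'n \<times> (complex ^ 'n) \<Rightarrow> complex" where
  "place i p z = (if fst z = i then p (snd z) else 0)"

lemma flinear_place: "flinear (place i)"
  by (rule flinearI) (auto simp: place_def fun_eq_iff)

definition tup :: "('n \<Rightarrow> nat) \<times> 'n \<Rightarrow> 'n \<times> (complex ^ 'n) \<Rightarrow> complex" where
  "tup ci = place (snd ci) (mon (fst ci))"

text \<open>These are the multipliers \<open>c\<close> of \<open>F i\<close> for which the product
  is a member of \<open>gfam\<close>, namely the one at the exponent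
  \<open>c + pw e i\<close>.\<close>

definition normal :: "('n \<Rightarrow> nat) \<times> 'n \<Rightarrow> bool" where
  "normal ci \<longleftrightarrow> (\<forall>j. to_nat j < to_nat (snd ci) \<longrightarrow> fst ci j < e)"

definition koszul :: "('n \<Rightarrow> nat) \<times> 'n \<Rightarrow> 'f \<Rightarrow> 'n \<times> (complex ^ 'n) \<Rightarrow> complex" where
  "koszul ci f = (if normal ci then tup ci else
     place (snd ci) (mon (red e (fst ci)) * F (lead e (fst ci)) f)
     - place (lead e (fst ci)) (mon (red e (fst ci)) * F (snd ci) f))"

lemma tup_indep: "inj_on tup (Mon k \<times> UNIV) \<and> fn.independent (tup ` (Mon k \<times> UNIV))"
proof (rule independent_familyI)
  fix c assume s: "(\<Sum>ci\<in>Mon k \<times> UNIV. fscale (c ci) (tup ci)) = 0"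
  have "c (a, i) = 0" if "a \<in> Mon k" for a i
  proof (rule mon_indep[of "Mon k" "\<lambda>a. c (a, i)", OF _ _ that])
    fix x
    have "0 = (\<Sum>ci\<in>Mon k \<times> UNIV. fscale (c ci) (tup ci)) (i, x)" using s by simp
    also have "\<dots> = (\<Sum>a\<in>Mon k. \<Sum>j\<in>UNIV. c (a, j) * (if i = j then mon a x else 0))"
      by (simp add: sum_fun_eq sum.cartesian_product tup_def place_def case_prod_unfold del: sum.cong)
        (simp only: snd_conv)
    also have "\<dots> = (\<Sum>a\<in>Mon k. c (a, i) * mon a x)" by (simp add: if_distrib cong: if_cong)
    finally show "(\<Sum>a\<in>Mon k. c (a, i) * mon a x) = 0" by simp
  qed simp
  then show "\<forall>ci\<in>Mon k \<times> UNIV. c ci = 0" by auto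
qed simp

lemma not_normal:
  assumes "\<not> normal (c, i)"
  shows "c \<notin> Bexp e" "to_nat (lead e c) < to_nat i"
proof -
  obtain j where j: "to_nat j < to_nat i" "e \<le> c j" using assms by (auto simp: normal_def not_less)
  then show "c \<notin> Bexp e" by (auto simp: Bexp_def not_less)
  show "to_nat (lead e c) < to_nat i" using lead_le[of e c j] j by simp
qed

lemma place_polyfam:
  fixes g :: "'f \<Rightarrow> complex ^ 'n \<Rightarrow> complex"
  assumes "polyfam (Mon k) mon g" shows "polyfam (Mon k \<times> UNIV) tup (\<lambda>f. place i (g f))"
proof (rule polyfam_linear[OF assms flinear_place])
  fix c :: "'n \<Rightarrow> nat" assume "c \<in> Mon k"
  then have "polyfam (Mon k \<times> UNIV) tup (\<lambda>f::'f. tup (c, i))" by (intro polyfam_base) auto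
  then show "polyfam (Mon k \<times> UNIV) tup (\<lambda>f::'f. place i (mon c))" by (simp add: tup_def)
qed

lemma koszul_polyfam: "ci \<in> Mon k \<times> UNIV \<Longrightarrow> polyfam (Mon k \<times> UNIV) tup (koszul ci)"
proof (cases "normal ci")
  case True
  assume "ci \<in> Mon k \<times> UNIV"
  with True show ?thesis by (simp add: koszul_def[abs_def] polyfam_base)
next
  case False
  assume ci: "ci \<in> Mon k \<times> UNIV"
  have "fst ci \<notin> Bexp e" using not_normal[of "fst ci" "snd ci"] False by simp
  then have "deg (red e (fst ci)) + e \<le> k" using deg_red[of "fst ci" e] ci by (auto simp: Mon_def)
  then have "polyfam (Mon k \<times> UNIV) tup (\<lambda>f. place (snd ci) (mon (red e (fst ci)) * F (lead e (fst ci)) f)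
     - place (lead e (fst ci)) (mon (red e (fst ci)) * F (snd ci) f))"
    by (intro polyfam_diff place_polyfam mon_mult_polyfam[OF F_polyfam])
  then show ?thesis using False by (simp add: koszul_def[abs_def])
qed

text \<open>One exchange suffices in top degree. After component \<open>i\<close> is traded for the
  earlier component \<open>lead e c\<close>, no variable before that one has exponent
  \<open>e\<close> or more, so the new term is normal; all other terms have lower degree.\<close>

lemma koszul_f0: "c \<in> Mon k \<Longrightarrow> tup (c, i) \<in> fn.span ((\<lambda>ci. koszul ci f0) ` (Mon k \<times> UNIV))"
proof (induction "deg c" arbitrary: c i rule: less_induct)
  case less
  let ?S = "fn.span ((\<lambda>ci. koszul ci f0) ` (Mon k \<times> UNIV))"
  have g: "koszul (c, i) f0 \<in> ?S" if "c \<in> Mon k" for c i using that by (intro fn.span_base) auto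
  show ?case
  proof (cases "normal (c, i)")
    case True
    then show ?thesis using g[OF less.prems, of i] by (simp add: koszul_def)
  next
    case False
    note cB = not_normal(1)[OF False] and ji = not_normal(2)[OF False]
    let ?j = "lead e c" let ?r = "red e c"
    have lower: "tup (?r + unit_exp l, l') \<in> ?S" for l l'
      using deg_red[OF cB] e less.prems by (intro less.hyps) (auto simp: Mon_def)
    have nrm: "tup (?r + pw e i, ?j) \<in> ?S"
    proof -
      have "normal (?r + pw e i, ?j)"
        unfolding normal_def
      proof (intro allI impI)
        fix l :: 'n assume "to_nat l < to_nat (snd (?r + pw e i, ?j))"
        then have l: "to_nat l < to_nat ?j" by simp
        then have "c l < e" using lead_le[of e c l] by (meson not_less)
        moreover have "l \<noteq> i" using l ji by auto
        ultimately show "fst (?r + pw e i, ?j) l < e" by (simp add: red_def pw_def)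
      qed
      moreover have "?r + pw e i \<in> Mon k" using deg_red[OF cB] less.prems by (simp add: Mon_def)
      ultimately show ?thesis using g[of "?r + pw e i" ?j] by (simp add: koszul_def)
    qed
    have "koszul (c, i) f0 = place i (fscale (\<gamma> ?j) (mon c) - mon (?r + unit_exp ?j))
        - place ?j (fscale (\<gamma> i) (mon (?r + pw e i)) - mon (?r + unit_exp i))"
      using False by (simp only: koszul_def if_False mult_F_f0 red_add[OF cB] fst_conv snd_conv)
    also have "\<dots> = fscale (\<gamma> ?j) (tup (c, i)) - tup (?r + unit_exp ?j, i)
        - (fscale (\<gamma> i) (tup (?r + pw e i, ?j)) - tup (?r + unit_exp i, ?j))"
      by (simp only: fp.linear_diff[OF flinear_place] fp.linear_scale[OF flinear_place] tup_def fst_conv snd_conv)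
    finally have "tup (c, i) = fscale (1 / \<gamma> ?j) (koszul (c, i) f0 + tup (?r + unit_exp ?j, i)
        + (fscale (\<gamma> i) (tup (?r + pw e i, ?j)) - tup (?r + unit_exp i, ?j)))"
      using \<gamma>[of ?j] by (simp add: fun_eq_iff)
    also have "\<dots> \<in> ?S"
      by (intro fn.span_scale fn.span_add fn.span_diff g less.prems lower nrm)
    finally show ?thesis .
  qed
qed

definition koszul_spans :: "nat \<Rightarrow> 'f \<Rightarrow> bool" where
  "koszul_spans k f \<longleftrightarrow> (\<forall>ci\<in>Mon k \<times> UNIV. tup ci \<in> fn.span ((\<lambda>ci. koszul ci f) ` (Mon k \<times> UNIV)))"

lemma generic_koszul: "generic f0 (koszul_spans k)"
  unfolding koszul_spans_def
  by (rule generic_span) (use tup_indep koszul_polyfam in \<open>auto intro: koszul_f0\<close>)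

definition contract :: "'f \<Rightarrow> ('n \<times> (complex ^ 'n) \<Rightarrow> complex) \<Rightarrow> complex ^ 'n \<Rightarrow> complex" where
  "contract f \<tau> x = (\<Sum>i\<in>UNIV. \<tau> (i, x) * F i f x)"

lemma flinear_contract: "flinear (contract f)"
  by (rule flinearI) (auto simp: contract_def fun_eq_iff algebra_simps sum.distrib sum_distrib_left)

lemma contract_place: "contract f (place i p) = p * F i f"
  by (auto simp: contract_def place_def fun_eq_iff if_distrib[of "\<lambda>a. a * _"] cong: if_cong)

text \<open>Tuples of multipliers are spanned by normal ones and Koszul relations, and
  \<open>contract\<close> sends the latter to 0. Multipliers can thus be made normal without raising
  the bound on their degree.\<close>

lemma Idl_normal:
  assumes "koszul_spans k f" "p \<in> Idl (Fs f) k"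
  shows "p \<in> fn.span {mon c * F i f | c i. c \<in> Mon k \<and> normal (c, i)}" (is "_ \<in> fn.span ?N")
proof -
  have gen: "mon c * F i f \<in> fn.span ?N" if "c \<in> Mon k" for c i
  proof -
    have "contract f (tup (c, i)) \<in> fn.span ?N"
    proof (rule span_induct_linear[OF _ flinear_contract])
      show "tup (c, i) \<in> fn.span ((\<lambda>ci. koszul ci f) ` (Mon k \<times> UNIV))"
        using assms(1) that by (auto simp: koszul_spans_def)
      fix s assume "s \<in> (\<lambda>ci. koszul ci f) ` (Mon k \<times> UNIV)"
      then obtain a l where a: "a \<in> Mon k" "s = koszul (a, l) f" by auto
      show "contract f s \<in> fn.span ?N"
      proof (cases "normal (a, l)")
        case True
        then have "contract f s = mon a * F l f" by (simp add: a(2) koszul_def tup_def contract_place)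
        also have "\<dots> \<in> fn.span ?N" using True a(1) by (intro fn.span_base) auto
        finally show ?thesis .
      next
        case False
        have "contract f s = mon (red e a) * F (lead e a) f * F l f - mon (red e a) * F l f * F (lead e a) f"
          using False by (simp only: a(2) koszul_def if_False fp.linear_diff[OF flinear_contract] contract_place fst_conv snd_conv)
        then have "contract f s = 0" by (simp add: mult_ac)
        then show ?thesis by (simp only: fn.span_zero)
      qed
    qed
    then show ?thesis by (simp add: tup_def contract_place)
  qed
  have "{mon c * Fs f i |c i. deg c \<le> k} \<subseteq> fn.span ?N" using gen by (auto simp: Mon_def)
  then have "Idl (Fs f) k \<subseteq> fn.span ?N"
    unfolding Idl_def by (rule fn.span_minimal) (rule fn.subspace_span)
  then show ?thesis using assms(2) by blast
qed

text \<open>Reduced monomials and normal multiples of the equations are disjoint parts of the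
  independent family \<open>gfam\<close>; the bounds on \<open>m\<close> place both parts inside the
  family.\<close>

lemma Bsp_int_Idl:
  assumes "square m f" "koszul_spans k f" "k + e \<le> m" "T \<le> m"
    and "b \<in> Bsp e" "b \<in> Idl (Fs f) k"
  shows "b = 0"
proof (rule span_Int_independent)
  let ?g = "\<lambda>\<beta>. gfam \<beta> f" let ?A = "Mon m \<inter> Bexp e" let ?B = "Mon m - Bexp e"
  note ind = square_indep[OF assms(1)]
  have "?g ` ?A \<union> ?g ` ?B = ?g ` Mon m" by blast
  then show "fn.independent (?g ` ?A \<union> ?g ` ?B)" using ind by simp
  show "?g ` ?A \<inter> ?g ` ?B = {}" using ind by (auto simp: inj_on_def)
  have "mon ` Bexp e \<subseteq> ?g ` ?A"
    using Bexp_deg[where e = e and 'n = 'n] assms(4) by (force simp: gfam_def Mon_def T_def)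
  then show "b \<in> fn.span (?g ` ?A)" using assms(5) fn.span_mono unfolding Bsp_def by blast
  have "{mon c * F i f | c i. c \<in> Mon k \<and> normal (c, i)} \<subseteq> ?g ` ?B"
  proof
    fix p assume "p \<in> {mon c * F i f | c i. c \<in> Mon k \<and> normal (c, i)}"
    then obtain c i where ci: "p = mon c * F i f" "c \<in> Mon k" "normal (c, i)" by auto
    have n: "\<And>j. to_nat j < to_nat i \<Longrightarrow> c j < e" using ci(3) by (simp add: normal_def)
    have nb: "c + pw e i \<notin> Bexp e" using lead_add_pw(3)[OF n] e by simp
    then have "p = ?g (c + pw e i)"
      by (simp only: gfam_def if_False lead_add_pw(1)[OF n] lead_add_pw(2)[OF n] ci(1))
    moreover have "c + pw e i \<in> ?B" using nb ci(2) assms(3) by (simp add: Mon_def)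
    ultimately show "p \<in> ?g ` ?B" by (rule image_eqI)
  qed
  then show "b \<in> fn.span (?g ` ?B)" using Idl_normal[OF assms(2,6)] fn.span_mono by blast
qed

definition K where "K = 2 * T + e + 2"

text \<open>Finitely many conditions that control the whole ideal: degree \<open>T + 1\<close> for a
  variable times a reduced polynomial, \<open>e + 1 = d\<close> for the form to be tested,
  \<open>K\<close> and \<open>K + e\<close> for the uniqueness of remainders demanded by
  \<open>Bsp_int_Ideal\<close>, and \<open>m\<close> for one further degree of choice.\<close>

definition good :: "nat \<Rightarrow> 'f \<Rightarrow> bool" where
  "good m f \<longleftrightarrow> square (T + 1) f \<and> square (e + 1) f \<and> square (K + e) f \<and> koszul_spans K f \<and> square m f"

lemma generic_good: "generic f0 (good m)"
  unfolding good_def[abs_def] by (intro generic_conj generic_square generic_koszul)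

lemma good_small: "good m f \<Longrightarrow> p \<in> Pol (T + 1) \<Longrightarrow> \<exists>b\<in>Bsp e. p - b \<in> Idl (Fs f) (T + 1)"
  using square_decomp[of "T + 1" f p] Idl_mono[of "T + 1 - e" "T + 1" "Fs f"] by (auto simp: good_def)

lemma good_Bsp_int_Ideal: "good m f \<Longrightarrow> b \<in> Bsp e \<Longrightarrow> b \<in> Ideal (Fs f) \<Longrightarrow> b = 0"
proof (rule Bsp_int_Ideal[of e "Fs f"])
  assume g: "good m f"
  show "\<exists>b\<in>Bsp e. p - b \<in> Idl (Fs f) (top_deg e TYPE('n) + 1)" if "p \<in> Pol (top_deg e TYPE('n) + 1)" for p
    using good_small[OF g, of p] that by (simp add: T_def)
  show "b = 0" if "b \<in> Bsp e" "b \<in> Idl (Fs f) (2 * top_deg e TYPE('n) + e + 2)" for b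
    using Bsp_int_Idl[of "K + e" f K b] g that by (simp add: good_def K_def T_def)
qed (use e F_Pol in auto)

lemma good_Polys_decomp: "good m f \<Longrightarrow> p \<in> Polys \<Longrightarrow> \<exists>b\<in>Bsp e. p - b \<in> Ideal (Fs f)"
  using Polys_decomp[of e "Fs f" p] good_small[of m f] e by (simp add: T_def)

lemma good_nullstellensatz:
  assumes "good m f" "\<And>v. (\<And>i. F i f v = 0) \<Longrightarrow> simple_zero (Fs f) v"
    and "p \<in> Polys" "\<And>v. (\<And>i. F i f v = 0) \<Longrightarrow> p v = 0"
  shows "p \<in> Ideal (Fs f)"
  using nullstellensatz[of e "Fs f" p] good_Polys_decomp[OF assms(1)] assms(2-) F_Pol Pol_Polys by blast

text \<open>Here the unbounded multipliers from the Nullstellensatz become bounded ones: the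
  remainder of the bounded division is reduced and lies in the ideal, hence is 0.\<close>

lemma good_vanishing:
  assumes "good m f" "\<And>v. (\<And>i. F i f v = 0) \<Longrightarrow> simple_zero (Fs f) v"
    and "square M f" "p \<in> Pol M" "\<And>v. (\<And>i. F i f v = 0) \<Longrightarrow> p v = 0"
  shows "p \<in> Idl (Fs f) (M - e)"
proof -
  obtain b where b: "b \<in> Bsp e" "p - b \<in> Idl (Fs f) (M - e)" using square_decomp[OF assms(3,4)] by blast
  have "p \<in> Ideal (Fs f)"
    using assms(4) Pol_Polys by (intro good_nullstellensatz[OF assms(1,2) _ assms(5)]) auto
  moreover have "p - b \<in> Ideal (Fs f)" using b(2) Idl_Ideal by blast
  ultimately have "p - (p - b) \<in> Ideal (Fs f)" by (rule Ideal_diff)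
  then have "b \<in> Ideal (Fs f)" by simp
  then have "b = 0" by (rule good_Bsp_int_Ideal[OF assms(1) b(1)])
  then show ?thesis using b(2) by simp
qed

end

section \<open>A test polynomial without zeros among the nonzero solutions\<close>

lemma generic_at: "generic f0 S \<Longrightarrow> S f0"
  unfolding generic_def by blast

text \<open>In the application \<open>h\<close> is the Jacobian determinant times (v|v). The
  equations and \<open>h\<close> vanish at the origin for every \<open>f\<close>, so
  \<open>h\<close> can be asked to be nonzero only at the other zeros.\<close>

locale perturbed_powers_test = perturbed_powers +
  fixes h :: "'b \<Rightarrow> complex ^ 'a \<Rightarrow> complex" and H :: nat
  assumes h_polyfam: "polyfam (Mon H) mon h"
    and simple_f0: "\<And>v. (\<And>i. F i f0 v = 0) \<Longrightarrow> simple_zero (\<lambda>i. F i f0) v"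
    and h_f0: "\<And>v. (\<And>i. F i f0 v = 0) \<Longrightarrow> v \<noteq> 0 \<Longrightarrow> h f0 v \<noteq> 0"
    and F_0: "\<And>i f. F i f 0 = 0" and h_0: "\<And>f. h f 0 = 0"
begin

text \<open>\<open>H + T\<close> is the degree of \<open>h\<close> times a reduced polynomial, and
  the summand \<open>e\<close> keeps \<open>M - e\<close> from truncating.\<close>

definition M :: nat where "M = H + T + e + 1"

text \<open>At a common zero of the \<open>F i\<close> and \<open>h\<close> each of these functions
  has the same value as at the origin. If they span the polynomials of degree at most
  \<open>M\<close>, which include the coordinates, the origin is therefore the only such zero. The
  nested index type merges the three kinds into one family, as \<open>generic_span\<close>
  requires.\<close>

definition hfam :: "(('a \<Rightarrow> nat) + (('a \<Rightarrow> nat) \<times> 'a)) option \<Rightarrow> 'b \<Rightarrow> complex ^ 'a \<Rightarrow> complex" where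
  "hfam j f = (case j of None \<Rightarrow> 1 | Some (Inl \<beta>) \<Rightarrow> h f * mon \<beta> | Some (Inr (c, i)) \<Rightarrow> mon c * F i f)"

definition J :: "(('a \<Rightarrow> nat) + (('a \<Rightarrow> nat) \<times> 'a)) option set" where
  "J = insert None (Some ` (Inl ` Bexp e \<union> Inr ` (Mon (M - e) \<times> UNIV)))"

lemma hfam_polyfam: "j \<in> J \<Longrightarrow> polyfam (Mon M) mon (hfam j)"
proof -
  have 1: "polyfam (Mon M) mon (\<lambda>f::'b. 1 :: complex ^ 'a \<Rightarrow> complex)"
    using polyfam_base[of "Mon M" 0 mon] by (simp add: Mon_def[of M, THEN eq_reflection] flip: mon_0)
      (simp add: finite_Mon[unfolded Mon_def])
  have 2: "polyfam (Mon M) mon (\<lambda>f. h f * mon \<beta>)" if "\<beta> \<in> Bexp e" for \<beta>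
    using mon_mult_polyfam[OF h_polyfam, of \<beta> M] Bexp_deg[OF that] by (simp add: M_def T_def mult.commute)
  have 3: "polyfam (Mon M) mon (\<lambda>f. mon c * F i f)" if "c \<in> Mon (M - e)" for c i
    using mon_mult_polyfam[OF F_polyfam, of c M i] that by (simp add: M_def Mon_def)
  assume "j \<in> J"
  then show ?thesis using 1 2 3 by (auto simp: J_def hfam_def[abs_def])
qed

lemma h_Pol: "h f \<in> Pol H"
proof -
  obtain G where "\<forall>f. h f = (\<Sum>k\<in>Mon H. fscale (of_real (G f k)) (mon k))"
    using h_polyfam unfolding polyfam_def by blast
  then show ?thesis unfolding Pol_def by (auto intro!: fn.span_sum fn.span_scale intro: fn.span_base)
qed

lemma span_hfam:
  shows one_hfam: "1 \<in> fn.span ((\<lambda>j. hfam j f) ` J)"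
    and h_hfam: "b \<in> Bsp e \<Longrightarrow> h f * b \<in> fn.span ((\<lambda>j. hfam j f) ` J)"
    and Idl_hfam: "p \<in> Idl (\<lambda>i. F i f) (M - e) \<Longrightarrow> p \<in> fn.span ((\<lambda>j. hfam j f) ` J)"
proof -
  let ?S = "fn.span ((\<lambda>j. hfam j f) ` J)"
  have gen: "hfam j f \<in> ?S" if "j \<in> J" for j using that by (intro fn.span_base) auto
  show "1 \<in> ?S" using gen[of None] by (simp add: J_def hfam_def)
  have "h f * mon \<beta> \<in> ?S" if "\<beta> \<in> Bexp e" for \<beta>
    using gen[of "Some (Inl \<beta>)"] that by (simp add: J_def hfam_def)
  then show "b \<in> Bsp e \<Longrightarrow> h f * b \<in> ?S" unfolding Bsp_def
    by (erule_tac span_induct_linear[OF _ flinear_mult_left]) blast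
  have "mon c * F i f \<in> ?S" if "c \<in> Mon (M - e)" for c i
    using gen[of "Some (Inr (c, i))"] that by (simp add: J_def hfam_def)
  then have "{mon c * F i f |c i. deg c \<le> M - e} \<subseteq> ?S" by (auto simp: Mon_def)
  then have "Idl (\<lambda>i. F i f) (M - e) \<subseteq> ?S"
    unfolding Idl_def by (rule fn.span_minimal) (rule fn.subspace_span)
  then show "p \<in> Idl (\<lambda>i. F i f) (M - e) \<Longrightarrow> p \<in> ?S" by blast
qed

text \<open>The powers \<open>h\<^sup>k b\<close> are dependent modulo the ideal. Dividing a relation by the lowest power
  of \<open>h\<close> is possible because \<open>h\<close> vanishes at no zero other than the origin.\<close>

lemma div_h_f0:
  assumes b: "b \<in> Bsp e" "b 0 = 0"
  shows "b \<in> fn.span ((\<lambda>j. hfam j f0) ` J)"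
proof -
  let ?h = "h f0" let ?F = "\<lambda>i. F i f0" let ?S = "fn.span ((\<lambda>j. hfam j f0) ` J)"
  have g: "good M f0" using generic_good by (rule generic_at)
  have hP: "?h \<in> Polys" and bP: "b \<in> Polys" using h_Pol Bsp_Pol Pol_Polys b(1) by blast+
  have hk: "?h ^ k \<in> Polys" for k
    by (induction k) (simp_all only: power_0 power_Suc Polys_one Polys_mult hP)
  have "\<exists>c N. (\<exists>k\<le>N. c k \<noteq> 0) \<and> (\<Sum>k\<le>N::nat. fscale (c k) (?h ^ k * b)) \<in> Ideal ?F"
    by (rule dependent_mod_Ideal) (rule good_Polys_decomp[OF g], assumption, rule Polys_mult[OF hk bP])
  then obtain c N where c: "\<exists>k\<le>N. c k \<noteq> 0"
    and I: "(\<Sum>k\<le>N::nat. fscale (c k) (?h ^ k * b)) \<in> Ideal ?F"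
    by - ((erule exE)+, erule conjE, rule that)
  define k0 where "k0 = (LEAST k. c k \<noteq> 0)"
  have k0: "c k0 \<noteq> 0" "k0 \<le> N" "\<And>k. k < k0 \<Longrightarrow> c k = 0"
  proof -
    obtain k where k: "k \<le> N" "c k \<noteq> 0" using c by (elim exE conjE) (rule that)
    show "c k0 \<noteq> 0" unfolding k0_def by (rule LeastI[where P = "\<lambda>k. c k \<noteq> 0", OF k(2)])
    show "k0 \<le> N" using Least_le[where P = "\<lambda>k. c k \<noteq> 0", OF k(2)] k(1) by (simp add: k0_def)
    show "c k = 0" if "k < k0" for k
      using not_less_Least[of k "\<lambda>k. c k \<noteq> 0"] that by (simp add: k0_def)
  qed
  \<comment> \<open>The terms above the lowest power \<open>k0\<close>, with
    \<open>?h ^ Suc k0\<close> divided out.\<close>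
  define s where "s = (\<lambda>x. \<Sum>k\<in>{Suc k0..N}. c k * (?h ^ (k - Suc k0)) x)"
  have s: "s \<in> Polys" unfolding s_def by (intro Polys_sum Polys_times Polys_const hk)
  have rel: "(\<Sum>k\<le>N. fscale (c k) (?h ^ k * b)) = ?h ^ k0 * (fscale (c k0) b + ?h * (s * b))"
  proof
    fix x
    have "(\<Sum>k\<le>N. c k * (?h ^ k * b) x) = (\<Sum>k\<in>{k0..N}. c k * (?h ^ k * b) x)"
      using k0 by (intro sum.mono_neutral_right) auto
    also have "\<dots> = c k0 * (?h ^ k0 * b) x + (\<Sum>k\<in>{Suc k0..N}. c k * (?h ^ k * b) x)"
      using k0(2) by (simp add: sum.atLeast_Suc_atMost)
    also have "(\<Sum>k\<in>{Suc k0..N}. c k * (?h ^ k * b) x)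
        = (\<Sum>k\<in>{Suc k0..N}. (?h ^ k0) x * ?h x * (c k * (?h ^ (k - Suc k0)) x) * b x)"
    proof (rule sum.cong)
      fix k assume "k \<in> {Suc k0..N}"
      then have "k = Suc k0 + (k - Suc k0)" by simp
      then have "?h ^ k = ?h ^ k0 * ?h * ?h ^ (k - Suc k0)" by (metis power_add power_Suc2)
      then show "c k * (?h ^ k * b) x = (?h ^ k0) x * ?h x * (c k * (?h ^ (k - Suc k0)) x) * b x"
        by simp
    qed simp
    finally show "(\<Sum>k\<le>N. fscale (c k) (?h ^ k * b)) x = (?h ^ k0 * (fscale (c k0) b + ?h * (s * b))) x"
      by (simp add: sum_fun_eq s_def sum_distrib_left sum_distrib_right algebra_simps)
  qed
  \<comment> \<open>The division takes place in the values at the zeros, and membership is recovered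
    from their simplicity at \<open>f0\<close>. The origin, where \<open>?h\<close> vanishes, is
    covered by \<open>b 0 = 0\<close>.\<close>
  have "fscale (c k0) b + ?h * (s * b) \<in> Ideal ?F"
  proof (rule good_nullstellensatz[OF g simple_f0])
    show "fscale (c k0) b + ?h * (s * b) \<in> Polys"
      by (intro Polys_add Polys_scale Polys_mult bP hP s)
    fix v assume z: "\<And>i. F i f0 v = 0"
    show "(fscale (c k0) b + ?h * (s * b)) v = 0"
    proof (cases "v = 0")
      case True
      then show ?thesis using b(2) by simp
    next
      case False
      have "(?h ^ k0) v = (?h v) ^ k0" by (induction k0) auto
      then have "(?h ^ k0) v \<noteq> 0" using h_f0[OF z False] by simp
      then show ?thesis using Ideal_vanishes[OF I[unfolded rel] z] by simp
    qed
  qed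
  \<comment> \<open>Replacing \<open>s * b\<close> by its remainder brings the relation down to
    degree \<open>H + T\<close>, within reach of the bounded division.\<close>
  moreover obtain b' where b': "b' \<in> Bsp e" "s * b - b' \<in> Ideal ?F"
    using good_Polys_decomp[OF g Polys_mult[OF s bP]] by blast
  have "?h * (s * b - b') \<in> Ideal ?F" by (rule Ideal_mult[OF hP b'(2)])
  ultimately have "(fscale (c k0) b + ?h * (s * b)) - ?h * (s * b - b') \<in> Ideal ?F" by (rule Ideal_diff)
  then have r: "fscale (c k0) b + ?h * b' \<in> Ideal ?F" by (simp add: algebra_simps)
  have "?h * b' \<in> Pol (H + T)" using h_Pol b'(1) Bsp_Pol unfolding T_def by (intro Pol_mult) auto
  moreover have "b \<in> Pol (H + T)" using b(1) Bsp_Pol Pol_mono[of T "H + T"] unfolding T_def by auto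
  ultimately have "fscale (c k0) b + ?h * b' \<in> Pol (H + T)" by (intro Pol_add Pol_scale)
  then have "fscale (c k0) b + ?h * b' \<in> Pol M" using Pol_mono[of "H + T" M] by (auto simp: M_def)
  moreover have "square M f0" using g by (simp add: good_def)
  ultimately have "fscale (c k0) b + ?h * b' \<in> Idl ?F (M - e)"
    using Ideal_vanishes[OF r] by (intro good_vanishing[OF g simple_f0]) auto
  then have "fscale (1 / c k0) ((fscale (c k0) b + ?h * b') - ?h * b') \<in> ?S"
    by (intro fn.span_scale fn.span_diff h_hfam Idl_hfam b'(1))
  moreover have "fscale (1 / c k0) ((fscale (c k0) b + ?h * b') - ?h * b') = b"
    using k0(1) by (simp add: fun_eq_iff)
  ultimately show ?thesis by (simp only:)
qed

lemma hfam_f0: "\<alpha> \<in> Mon M \<Longrightarrow> mon \<alpha> \<in> fn.span ((\<lambda>j. hfam j f0) ` J)"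
proof -
  let ?S = "fn.span ((\<lambda>j. hfam j f0) ` J)"
  assume "\<alpha> \<in> Mon M"
  then have "mon \<alpha> \<in> Pol M" by (simp add: mon_Pol Mon_def)
  moreover have "square M f0" using generic_square by (rule generic_at)
  ultimately obtain b where b: "b \<in> Bsp e" "mon \<alpha> - b \<in> Idl (\<lambda>i. F i f0) (M - e)"
    using square_decomp by blast
  have one: "1 \<in> Bsp e" using mon_Bsp[of 0 e] e by (simp add: Bexp_def)
  \<comment> \<open>The division needs a polynomial that vanishes at the origin; the constant comes
    back through the index \<open>None\<close>.\<close>
  have "b - fscale (b 0) 1 \<in> ?S" by (rule div_h_f0) (auto intro!: Bsp_diff Bsp_scale b one)
  then have "(b - fscale (b 0) 1) + fscale (b 0) 1 + (mon \<alpha> - b) \<in> ?S"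
    by (rule fn.span_add[OF fn.span_add[OF _ fn.span_scale[OF one_hfam]] Idl_hfam[OF b(2)]])
  then show ?thesis by simp
qed

lemma generic_h_nonzero: "generic f0 (\<lambda>f. \<forall>v. (\<forall>i. F i f v = 0) \<longrightarrow> v \<noteq> 0 \<longrightarrow> h f v \<noteq> 0)"
proof -
  have fJ: "finite J" by (simp add: J_def)
  have "generic f0 (\<lambda>f. \<forall>\<alpha>\<in>Mon M. mon \<alpha> \<in> fn.span ((\<lambda>j. hfam j f) ` J))"
    by (rule generic_span) (auto simp: fJ hfam_polyfam hfam_f0 independent_mon intro: inj_on_subset[OF inj_mon])
  then show ?thesis
  proof (rule generic_mono, intro allI impI notI)
    fix f v assume sp: "\<forall>\<alpha>\<in>Mon M. mon \<alpha> \<in> fn.span ((\<lambda>j. hfam j f) ` J)"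
      and z: "\<forall>i. F i f v = 0" and "v \<noteq> 0" and hv: "h f v = 0"
    \<comment> \<open>Apart from 1, all members of the family vanish both at \<open>v\<close> and at
      0.\<close>
    have const: "p v = p 0" if "p \<in> fn.span ((\<lambda>j. hfam j f) ` J)" for p
      using that
    proof (induction rule: fn.span_induct_alt)
      case (step c s q)
      then obtain j where "j \<in> J" "s = hfam j f" by blast
      then have "s v = s 0" using z hv by (auto simp: J_def hfam_def F_0 h_0)
      then show ?case using step by simp
    qed simp
    have "v $ i = 0" for i
    proof -
      have "unit_exp i \<in> Mon M" by (simp add: Mon_def M_def)
      then have "mon (unit_exp i) v = mon (unit_exp i) 0" using sp by (intro const) blast
      then show ?thesis by (simp add: mon_unit_exp)
    qed
    then have "v = 0" by (simp add: vec_eq_iff)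
    then show False using \<open>v \<noteq> 0\<close> by blast
  qed
qed

text \<open>A polynomial of degree \<open>e + 1\<close>, divided by equations of degree
  \<open>e\<close>, leaves multipliers of degree at most 1; this is the only membership bound that
  the skew-symmetric argument needs.\<close>

lemma generic_vanishing:
  assumes "\<And>f v. (\<And>i. F i f v = 0) \<Longrightarrow> v \<noteq> 0 \<Longrightarrow> h f v \<noteq> 0 \<Longrightarrow> simple_zero (\<lambda>i. F i f) v"
    and "\<And>f. simple_zero (\<lambda>i. F i f) 0"
  shows "generic f0 (\<lambda>f. (\<forall>v. (\<forall>i. F i f v = 0) \<longrightarrow> v \<noteq> 0 \<longrightarrow> h f v \<noteq> 0) \<and>
    (\<forall>u\<in>Pol (e + 1). (\<forall>v. (\<forall>i. F i f v = 0) \<longrightarrow> u v = 0) \<longrightarrow> u \<in> Idl (\<lambda>i. F i f) 1))"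
  using generic_conj[OF generic_h_nonzero generic_good[of 0]]
proof (rule generic_mono)
  fix f assume f: "(\<forall>v. (\<forall>i. F i f v = 0) \<longrightarrow> v \<noteq> 0 \<longrightarrow> h f v \<noteq> 0) \<and> good 0 f"
  have simple: "simple_zero (\<lambda>i. F i f) v" if "\<And>i. F i f v = 0" for v
    using assms f that by (cases "v = 0") auto
  have "u \<in> Idl (\<lambda>i. F i f) 1" if "u \<in> Pol (e + 1)" "\<forall>v. (\<forall>i. F i f v = 0) \<longrightarrow> u v = 0" for u
    using good_vanishing[of 0 f "e + 1" u] f simple that by (auto simp: good_def)
  then show "(\<forall>v. (\<forall>i. F i f v = 0) \<longrightarrow> v \<noteq> 0 \<longrightarrow> h f v \<noteq> 0) \<and>
    (\<forall>u\<in>Pol (e + 1). (\<forall>v. (\<forall>i. F i f v = 0) \<longrightarrow> u v = 0) \<longrightarrow> u \<in> Idl (\<lambda>i. F i f) 1)"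
    using f by blast
qed

end

section \<open>Contractions of tensors\<close>

text \<open>All slots except \<open>k\<close> are contracted with \<open>x\<close>. For symmetric
  \<open>t\<close> these are, up to the factor \<open>CARD('d)\<close>, the partial derivatives of
  the form given by \<open>t\<close>.\<close>

definition contr :: "'d \<Rightarrow> 'a::comm_ring_1 ^ ('d::finite \<Rightarrow> 'n::finite) \<Rightarrow> 'n \<Rightarrow> 'a ^ 'n \<Rightarrow> 'a" where
  "contr k t l x = (\<Sum>j\<in>UNIV. if j k = l then t $ j * (\<Prod>m\<in>-{k}. x $ j m) else 0)"

lemma contr_symmetric:
  fixes t :: "'a::comm_ring_1 ^ ('d::finite \<Rightarrow> 'n::finite)"
  assumes "t \<in> symmetric_tensors"
  shows "contr k t l x = contr k' t l x"
proof -
  define p where "p m = (if m = k then k' else if m = k' then k else m)" for m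
  have pp: "p (p m) = m" for m by (simp add: p_def)
  then have bij: "bij p" by (intro o_bij[of p p]) (auto simp: fun_eq_iff)
  have bb: "bij_betw p (-{k}) (-{k'})"
    by (rule bij_betw_byWitness[of _ p]) (auto simp: p_def split: if_splits)
  have "bij (\<lambda>j :: 'd \<Rightarrow> 'n. j \<circ> p)"
    by (intro o_bij[of "\<lambda>j. j \<circ> p"]) (auto simp: fun_eq_iff pp)
  then have "contr k t l x = (\<Sum>j\<in>UNIV. if (j \<circ> p) k = l then t $ (j \<circ> p) * (\<Prod>m\<in>-{k}. x $ (j \<circ> p) m) else 0)"
    unfolding contr_def by (intro sum.reindex_bij_betw[symmetric])
  also have "\<dots> = contr k' t l x"
    unfolding contr_def
  proof (rule sum.cong)
    fix j :: "'d \<Rightarrow> 'n"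
    have "t $ (j \<circ> p) = t $ j" using assms bij by (auto simp: symmetric_tensors_def)
    moreover have "(\<Prod>m\<in>-{k}. x $ (j \<circ> p) m) = (\<Prod>m\<in>-{k'}. x $ j m)"
      using prod.reindex_bij_betw[OF bb, of "\<lambda>m. x $ j m"] by simp
    moreover have "(j \<circ> p) k = j k'" by (simp add: p_def)
    ultimately show "(if (j \<circ> p) k = l then t $ (j \<circ> p) * (\<Prod>m\<in>-{k}. x $ (j \<circ> p) m) else 0)
      = (if j k' = l then t $ j * (\<Prod>m\<in>-{k'}. x $ j m) else 0)" by simp
  qed simp
  finally show ?thesis .
qed

lemma sum_contr:
  fixes t :: "'a::comm_ring_1 ^ ('d::finite \<Rightarrow> 'n::finite)"
  shows "(\<Sum>j\<in>UNIV. t $ j * (y $ j k * (\<Prod>m\<in>-{k}. x $ j m))) = (\<Sum>l\<in>UNIV. y $ l * contr k t l x)"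
proof -
  have "(\<Sum>l\<in>UNIV. y $ l * contr k t l x)
      = (\<Sum>l\<in>UNIV. \<Sum>j\<in>UNIV. if j k = l then y $ l * (t $ j * (\<Prod>m\<in>-{k}. x $ j m)) else 0)"
    by (simp add: contr_def sum_distrib_left if_distrib[of "\<lambda>a. y $ _ * a"] cong: if_cong)
  also have "\<dots> = (\<Sum>j\<in>UNIV. t $ j * (y $ j k * (\<Prod>m\<in>-{k}. x $ j m)))"
    by (subst sum.swap) (simp add: mult.left_commute)
  finally show ?thesis by simp
qed

lemma sum_contr_all:
  fixes t :: "'a::comm_ring_1 ^ ('d::finite \<Rightarrow> 'n::finite)"
  assumes "t \<in> symmetric_tensors"
  shows "(\<Sum>j\<in>UNIV. t $ j * (\<Sum>k\<in>UNIV. y $ j k * (\<Prod>m\<in>-{k}. x $ j m)))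
    = of_nat CARD('d) * (\<Sum>l\<in>UNIV. y $ l * contr k0 t l x)"
proof -
  have "(\<Sum>j\<in>UNIV. t $ j * (\<Sum>k\<in>UNIV. y $ j k * (\<Prod>m\<in>-{k}. x $ j m)))
      = (\<Sum>k\<in>UNIV. \<Sum>j\<in>UNIV. t $ j * (y $ j k * (\<Prod>m\<in>-{k}. x $ j m)))"
    by (simp add: sum_distrib_left) (rule sum.swap)
  also have "\<dots> = (\<Sum>k\<in>(UNIV::'d set). \<Sum>l\<in>UNIV. y $ l * contr k0 t l x)"
    unfolding sum_contr using contr_symmetric[OF assms] by (intro sum.cong refl) metis
  finally show ?thesis by simp
qed

section \<open>Polynomial dependence on the tensor, and algebraic gradients\<close>

definition cexp :: "'d set \<Rightarrow> ('d \<Rightarrow> 'n) \<Rightarrow> 'n \<Rightarrow> nat" where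
  "cexp A j = (\<Sum>k\<in>A. unit_exp (j k))"

lemma prod_coord_mon:
  fixes j :: "'d::finite \<Rightarrow> 'n::finite"
  shows "(\<lambda>x. \<Prod>k\<in>A. x $ j k) = mon (cexp A j)" and "deg (cexp A j) = card A"
proof -
  have "finite A" by simp
  then have "mon (cexp A j) = (\<lambda>x. \<Prod>k\<in>A. x $ j k) \<and> deg (cexp A j) = card A"
  proof (induction A rule: finite_induct)
    case empty
    have "cexp {} j = 0" by (simp add: cexp_def)
    then have "mon (cexp {} j) = 1" "deg (cexp {} j) = 0" by (simp_all only: mon_0 deg_0)
    then show ?case by (intro conjI ext) (simp_all only: prod.empty card.empty one_fun_apply)
  next
    case (insert k A)
    have "cexp (insert k A) j = unit_exp (j k) + cexp A j" using insert.hyps by (simp add: cexp_def)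
    then have "mon (cexp (insert k A) j) = mon (unit_exp (j k)) * mon (cexp A j)"
      "deg (cexp (insert k A) j) = 1 + deg (cexp A j)" by (simp_all only: mon_add deg_add deg_unit_exp)
    then show ?case using insert by (simp add: fun_eq_iff mon_unit_exp)
  qed
  then show "(\<lambda>x. \<Prod>k\<in>A. x $ j k) = mon (cexp A j)" "deg (cexp A j) = card A" by auto
qed

lemma polyfam_prod_coord:
  fixes j :: "'d::finite \<Rightarrow> 'n::finite"
  assumes "card A \<le> m"
  shows "polyfam (Mon m) mon (\<lambda>f::'f::real_normed_vector. \<lambda>x. \<Prod>k\<in>A. x $ j k)"
  unfolding prod_coord_mon(1) using assms prod_coord_mon(2)[of A j] by (intro polyfam_base) (auto simp: Mon_def[of m, THEN eq_reflection] finite_Mon[unfolded Mon_def])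

lemma polyfam_coord: "1 \<le> m \<Longrightarrow> polyfam (Mon m) mon (\<lambda>f::'f::real_normed_vector. \<lambda>x. x $ i)"
  unfolding mon_unit_exp[symmetric] by (intro polyfam_base finite_Mon) (simp add: Mon_def)

lemma polyfam_one: "polyfam (Mon m) mon (\<lambda>f::'f::real_normed_vector. 1)"
  unfolding mon_0[symmetric] by (intro polyfam_base finite_Mon) (simp add: Mon_def)

lemma polyfam_Mon_mult: "polyfam (Mon m) mon g \<Longrightarrow> polyfam (Mon k) mon h \<Longrightarrow> polyfam (Mon (m + k)) mon (\<lambda>f. g f * h f)"
  by (erule (1) polyfam_mult) (simp only: mon_add[symmetric], intro polyfam_base finite_Mon, simp add: Mon_def)

lemma polyfam_Mon_prod:
  assumes "finite S" "\<And>s. s \<in> S \<Longrightarrow> polyfam (Mon m) mon (g s)"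
  shows "polyfam (Mon (card S * m)) mon (\<lambda>f::'f::real_normed_vector. \<Prod>s\<in>S. g s f)"
  using assms
proof (induction S rule: finite_induct)
  case empty
  show ?case using polyfam_one[of 0] by (simp only: prod.empty card.empty mult_0)
next
  case (insert a S)
  have "polyfam (Mon (m + card S * m)) mon (\<lambda>f. g a f * (\<Prod>s\<in>S. g s f))"
    using insert by (intro polyfam_Mon_mult) auto
  then show ?case by (simp only: prod.insert[OF insert.hyps] card_insert_disjoint[OF insert.hyps] mult_Suc)
qed

lemma prod_fun_eq: "prod f A = (\<lambda>x. \<Prod>i\<in>A. f i x)"
  by (induction A rule: infinite_finite_induct) (auto simp: fun_eq_iff)

lemma polyfam_det:
  fixes g :: "'n::finite \<Rightarrow> 'n \<Rightarrow> 'f::real_normed_vector \<Rightarrow> complex ^ 'n \<Rightarrow> complex"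
  assumes "\<And>i l. polyfam (Mon m) mon (g i l)"
  shows "polyfam (Mon (CARD('n) * m)) mon (\<lambda>f x. det (\<chi> i l. g i l f x))"
proof -
  have "polyfam (Mon (CARD('n) * m)) mon (\<lambda>f. \<Sum>p\<in>{p. p permutes (UNIV::'n set)}.
      fscale (of_real (of_int (sign p))) (\<Prod>i\<in>UNIV. g i (p i) f))"
    by (intro polyfam_sum polyfam_scale_const polyfam_Mon_prod assms) simp
  moreover have "(\<Sum>p\<in>{p. p permutes (UNIV::'n set)}.
      fscale (of_real (of_int (sign p))) (\<Prod>i\<in>UNIV. g i (p i) f)) = (\<lambda>x. det (\<chi> i l. g i l f x))" for f
    by (simp add: det_def fun_eq_iff sum_fun_eq prod_fun_eq)
  ultimately show ?thesis by simp
qed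

lemma has_grad_const: "has_grad (\<lambda>_. c) (\<lambda>_. 0) v"
  unfolding has_grad_def using Polys_const[of 0] by (intro exI[of _ "\<lambda>_ _. 0"]) auto

lemma has_grad_coord: "has_grad (\<lambda>x. x $ i) (\<lambda>l. if l = i then 1 else 0) v"
  unfolding has_grad_def
proof (rule exI[of _ "\<lambda>l _. if l = i then 1 else 0"], intro conjI allI)
  show "(\<lambda>_. if l = i then 1 else 0) \<in> Polys" for l by (rule Polys_const)
qed (auto simp: if_distrib[of "\<lambda>a. a * _"] cong: if_cong)

lemma has_grad_add:
  assumes "has_grad p J v" "has_grad q K v"
  shows "has_grad (\<lambda>x. p x + q x) (\<lambda>l. J l + K l) v"
proof -
  obtain L L' where
    L: "\<forall>l. L l \<in> Polys \<and> L l v = J l" "\<forall>x. p x - p v = (\<Sum>l\<in>UNIV. L l x * (x $ l - v $ l))"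
    and L': "\<forall>l. L' l \<in> Polys \<and> L' l v = K l" "\<forall>x. q x - q v = (\<Sum>l\<in>UNIV. L' l x * (x $ l - v $ l))"
    using assms unfolding has_grad_def by blast
  have "p x + q x - (p v + q v) = (\<Sum>l\<in>UNIV. (L l + L' l) x * (x $ l - v $ l))" for x
  proof -
    have "(\<Sum>l\<in>UNIV. (L l + L' l) x * (x $ l - v $ l)) = (p x - p v) + (q x - q v)"
      using L(2) L'(2) by (simp add: distrib_right sum.distrib)
    then show ?thesis by simp
  qed
  then show ?thesis unfolding has_grad_def
    using L(1) L'(1) by (intro exI[of _ "\<lambda>l. L l + L' l"]) (simp add: Polys_add)
qed

lemma has_grad_mult:
  assumes "has_grad p J v" "has_grad q K v" "q \<in> Polys"
  shows "has_grad (\<lambda>x. p x * q x) (\<lambda>l. J l * q v + p v * K l) v"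
proof -
  obtain L L' where
    L: "\<forall>l. L l \<in> Polys \<and> L l v = J l" "\<forall>x. p x - p v = (\<Sum>l\<in>UNIV. L l x * (x $ l - v $ l))"
    and L': "\<forall>l. L' l \<in> Polys \<and> L' l v = K l" "\<forall>x. q x - q v = (\<Sum>l\<in>UNIV. L' l x * (x $ l - v $ l))"
    using assms unfolding has_grad_def by blast
  have "p x * q x - p v * q v = (\<Sum>l\<in>UNIV. (L l * q + fscale (p v) (L' l)) x * (x $ l - v $ l))" for x
  proof -
    have "p x * q x - p v * q v = (p x - p v) * q x + p v * (q x - q v)" by (simp add: algebra_simps)
    also have "\<dots> = (\<Sum>l\<in>UNIV. L l x * (x $ l - v $ l)) * q x + p v * (\<Sum>l\<in>UNIV. L' l x * (x $ l - v $ l))"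
      using L(2) L'(2) by simp
    also have "\<dots> = (\<Sum>l\<in>UNIV. (L l * q + fscale (p v) (L' l)) x * (x $ l - v $ l))"
      by (simp add: sum_distrib_left sum_distrib_right sum.distrib[symmetric] algebra_simps)
    finally show ?thesis .
  qed
  moreover have "L l * q + fscale (p v) (L' l) \<in> Polys" for l
    using L(1) L'(1) assms(3) by (intro Polys_add Polys_mult Polys_scale) auto
  ultimately show ?thesis unfolding has_grad_def
    using L(1) L'(1) by (intro exI[of _ "\<lambda>l. L l * q + fscale (p v) (L' l)"]) simp
qed

lemma has_grad_scale: "has_grad p J v \<Longrightarrow> has_grad (\<lambda>x. c * p x) (\<lambda>l. c * J l) v"
  unfolding has_grad_def
proof (elim exE conjE)
  fix L assume "\<forall>l. L l \<in> Polys \<and> L l v = J l" "\<forall>x. p x - p v = (\<Sum>l\<in>UNIV. L l x * (x $ l - v $ l))"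
  then show "\<exists>L. (\<forall>l. L l \<in> Polys \<and> L l v = c * J l) \<and>
      (\<forall>x. c * p x - c * p v = (\<Sum>l\<in>UNIV. L l x * (x $ l - v $ l)))"
    by (intro exI[of _ "\<lambda>l. fscale c (L l)"])
      (simp add: Polys_scale mult.assoc flip: sum_distrib_left right_diff_distrib)
qed

lemma has_grad_sum:
  "(\<And>a. a \<in> A \<Longrightarrow> has_grad (p a) (J a) v) \<Longrightarrow> has_grad (\<lambda>x. \<Sum>a\<in>A. p a x) (\<lambda>l. \<Sum>a\<in>A. J a l) v"
  by (induction A rule: infinite_finite_induct) (simp_all add: has_grad_const has_grad_add)

lemma has_grad_prod_coord:
  fixes j :: "'d::finite \<Rightarrow> 'n::finite"
  shows "has_grad (\<lambda>x. \<Prod>k\<in>A. x $ j k)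
    (\<lambda>l. \<Sum>k\<in>A. if j k = l then \<Prod>m\<in>A - {k}. v $ j m else 0) v"
proof -
  have "finite A" by simp
  then show ?thesis
  proof (induction A rule: finite_induct)
    case empty
    then show ?case using has_grad_const[of 1] by simp
  next
    case (insert a A)
    have "has_grad (\<lambda>x. x $ j a * (\<Prod>k\<in>A. x $ j k))
        (\<lambda>l. (if l = j a then 1 else 0) * (\<Prod>k\<in>A. v $ j k) +
          v $ j a * (\<Sum>k\<in>A. if j k = l then \<Prod>m\<in>A - {k}. v $ j m else 0)) v"
      by (intro has_grad_mult has_grad_coord insert.IH Polys_prod Polys_coord)
    moreover have "(\<Sum>k\<in>insert a A. if j k = l then \<Prod>m\<in>insert a A - {k}. v $ j m else 0)
      = (if l = j a then 1 else 0) * (\<Prod>k\<in>A. v $ j k) +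
          v $ j a * (\<Sum>k\<in>A. if j k = l then \<Prod>m\<in>A - {k}. v $ j m else 0)" for l
    proof -
      have "(\<Sum>k\<in>A. if j k = l then \<Prod>m\<in>insert a A - {k}. v $ j m else 0)
          = v $ j a * (\<Sum>k\<in>A. if j k = l then \<Prod>m\<in>A - {k}. v $ j m else 0)"
        unfolding sum_distrib_left
      proof (rule sum.cong)
        fix k assume "k \<in> A"
        then have "insert a A - {k} = insert a (A - {k})" "a \<notin> A - {k}" using insert.hyps by auto
        then show "(if j k = l then \<Prod>m\<in>insert a A - {k}. v $ j m else 0)
            = v $ j a * (if j k = l then \<Prod>m\<in>A - {k}. v $ j m else 0)" using insert.hyps by simp
      qed simp
      moreover have "insert a A - {a} = A" using insert.hyps by auto
      ultimately show ?thesis using insert.hyps by auto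
    qed
    ultimately show ?case using insert.hyps by simp
  qed
qed

section \<open>The eigenvector equations\<close>

definition eig :: "'d::finite \<Rightarrow> 'n::finite \<Rightarrow> real ^ ('d \<Rightarrow> 'n) \<Rightarrow> complex ^ 'n \<Rightarrow> complex" where
  "eig k0 i f = (\<lambda>x. contr k0 (complexify f) i x - x $ i)"

definition jac :: "'d::finite \<Rightarrow> 'n::finite \<Rightarrow> 'n \<Rightarrow> real ^ ('d \<Rightarrow> 'n) \<Rightarrow> complex ^ 'n \<Rightarrow> complex" where
  "jac k0 i l f = (\<lambda>x. (\<Sum>j\<in>UNIV. if j k0 = i then complex_of_real (f $ j) *
     (\<Sum>k\<in>-{k0}. if j k = l then \<Prod>m\<in>-{k0} - {k}. x $ j m else 0) else 0) - (if i = l then 1 else 0))"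

text \<open>One polynomial for two demands on an eigenvector: a nonsingular Jacobian matrix makes
  the zero simple, and (x|x) different from 0 allows rescaling to a critical power.\<close>

definition test :: "'d::finite \<Rightarrow> real ^ ('d \<Rightarrow> 'n::finite) \<Rightarrow> complex ^ 'n \<Rightarrow> complex" where
  "test k0 f = (\<lambda>x. det (\<chi> i l. jac k0 i l f x) * (\<Sum>i\<in>UNIV. x $ i * x $ i))"

lemma real_polynomial_function_nth: "real_polynomial_function (\<lambda>f :: real ^ 'm::finite. f $ j)"
  by (rule real_polynomial_function.intros(1)) (rule bounded_linear_vec_nth)

lemma card_compl [simp]: "card (- {k0} :: 'd::finite set) = CARD('d) - 1"
  by (simp add: card_Diff_singleton Compl_eq_Diff_UNIV)

lemma card_compl2: "k \<in> - {k0} \<Longrightarrow> card (- {k0} - {k} :: 'd::finite set) = CARD('d) - 2"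
  by (simp add: card_Diff_singleton)

lemma eig_polyfam:
  assumes "3 \<le> CARD('d)"
  shows "polyfam (Mon (CARD('d) - 1)) mon (eig (k0::'d::finite) (i::'n::finite))"
proof -
  have "polyfam (Mon (CARD('d) - 1)) mon (\<lambda>f :: real ^ ('d \<Rightarrow> 'n). (\<Sum>j\<in>{j. j k0 = i}. fscale (complex_of_real (f $ j))
      (\<lambda>x. \<Prod>m\<in>-{k0}. x $ j m)) - (\<lambda>x. x $ i))"
    using assms by (intro polyfam_diff polyfam_sum polyfam_scale real_polynomial_function_nth polyfam_prod_coord polyfam_coord) simp_all
  moreover have "(\<Sum>j\<in>{j. j k0 = i}. fscale (complex_of_real (f $ j)) (\<lambda>x. \<Prod>m\<in>-{k0}. x $ j m)) - (\<lambda>x. x $ i)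
      = eig k0 i f" for f :: "real ^ ('d \<Rightarrow> 'n)"
    by (simp add: eig_def contr_def complexify_def fun_eq_iff sum_fun_eq sum.If_cases)
  ultimately show ?thesis by simp
qed

lemma jac_polyfam:
  "polyfam (Mon (CARD('d) - 1)) mon (jac (k0::'d::finite) (i::'n::finite) l)"
proof -
  have "polyfam (Mon (CARD('d) - 1)) mon (\<lambda>f :: real ^ ('d \<Rightarrow> 'n). (\<Sum>j\<in>{j. j k0 = i}. fscale (complex_of_real (f $ j))
      (\<Sum>k\<in>{k\<in>-{k0}. j k = l}. (\<lambda>x. \<Prod>m\<in>-{k0} - {k}. x $ j m))) - fscale (of_real (if i = l then 1 else 0)) 1)"
    by (intro polyfam_diff polyfam_sum polyfam_scale_const polyfam_one polyfam_scale real_polynomial_function_nth polyfam_prod_coord) (simp add: card_compl2)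
  moreover have "(\<Sum>j\<in>{j. j k0 = i}. fscale (complex_of_real (f $ j))
      (\<Sum>k\<in>{k\<in>-{k0}. j k = l}. (\<lambda>x. \<Prod>m\<in>-{k0} - {k}. x $ j m))) - fscale (of_real (if i = l then 1 else 0)) 1
      = jac k0 i l f" for f :: "real ^ ('d \<Rightarrow> 'n)"
    by (simp add: jac_def fun_eq_iff sum_fun_eq sum.If_cases Int_def)
  ultimately show ?thesis by simp
qed

lemma test_polyfam:
  "polyfam (Mon (CARD('n) * (CARD('d) - 1) + 2)) mon (test (k0::'d::finite) :: real ^ ('d \<Rightarrow> 'n::finite) \<Rightarrow> _)"
proof -
  have "polyfam (Mon (CARD('n) * (CARD('d) - 1) + 2)) mon (\<lambda>f :: real ^ ('d \<Rightarrow> 'n).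
      (\<lambda>x. det (\<chi> i l. jac k0 i l f x)) * (\<Sum>i\<in>UNIV. (\<lambda>x. x $ i) * (\<lambda>x. x $ i)))"
    unfolding one_add_one[symmetric, where 'a = nat]
    by (intro polyfam_Mon_mult polyfam_det jac_polyfam polyfam_sum polyfam_coord) simp_all
  moreover have "(\<lambda>x. det (\<chi> i l. jac k0 i l f x)) * (\<Sum>i\<in>UNIV. (\<lambda>x. x $ i) * (\<lambda>x. x $ i)) = test k0 f"
    for f :: "real ^ ('d \<Rightarrow> 'n)"
    by (simp add: test_def fun_eq_iff sum_fun_eq)
  ultimately show ?thesis by simp
qed

lemma eig_grad: "has_grad (eig k0 i f) (\<lambda>l. jac k0 i l f v) v"
proof -
  have "has_grad (\<lambda>x. (\<Sum>j\<in>{j. j k0 = i}. complex_of_real (f $ j) * (\<Prod>m\<in>-{k0}. x $ j m)) + (-1) * x $ i)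
     (\<lambda>l. (\<Sum>j\<in>{j. j k0 = i}. complex_of_real (f $ j) *
        (\<Sum>k\<in>-{k0}. if j k = l then \<Prod>m\<in>-{k0} - {k}. v $ j m else 0)) + (-1) * (if l = i then 1 else 0)) v"
    by (intro has_grad_add has_grad_sum has_grad_scale has_grad_prod_coord has_grad_coord)
  moreover have "(\<lambda>x. (\<Sum>j\<in>{j. j k0 = i}. complex_of_real (f $ j) * (\<Prod>m\<in>-{k0}. x $ j m)) + (-1) * x $ i) = eig k0 i f"
    by (simp add: eig_def contr_def complexify_def fun_eq_iff sum.If_cases)
  moreover have "(\<lambda>l. (\<Sum>j\<in>{j. j k0 = i}. complex_of_real (f $ j) *
        (\<Sum>k\<in>-{k0}. if j k = l then \<Prod>m\<in>-{k0} - {k}. v $ j m else 0)) + (-1) * (if l = i then 1 else 0))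
      = (\<lambda>l. jac k0 i l f v)"
    by (auto simp: jac_def fun_eq_iff sum.If_cases)
  ultimately show ?thesis by simp
qed

lemma eig_simple:
  "(\<And>i. eig k0 i f v = 0) \<Longrightarrow> det (\<chi> i l. jac k0 i l f v) \<noteq> 0 \<Longrightarrow> simple_zero (\<lambda>i. eig k0 i f) v"
  by (rule simple_zeroI[of _ "\<lambda>i l. jac k0 i l f v"]) (auto simp: eig_grad)

text \<open>The diagonal form whose eigenvectors have coordinates of modulus \<open>0\<close> or \<open>2\<^bsup>to_nat i\<^esup>\<close>, so that
  none of them is isotropic.\<close>

definition weight :: "nat \<Rightarrow> 'n::finite \<Rightarrow> real" where
  "weight d i = (1/2) ^ (to_nat i * (d - 2))"

text \<open>The combination of the powers of the basis vectors with coefficients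
  \<open>weight\<close>. Here \<open>undefined\<close> is an arbitrary slot, and all slots agree
  where it is used.\<close>

definition diag_form :: "real ^ ('d::finite \<Rightarrow> 'n::finite)" where
  "diag_form = (\<chi> j. if \<exists>i. j = (\<lambda>_. i) then weight CARD('d) (j undefined) else 0)"

lemma sum_diag_form:
  fixes S :: "('d::finite \<Rightarrow> 'n::finite) \<Rightarrow> complex"
  assumes "\<And>j. \<nexists>i. j = (\<lambda>_. i) \<Longrightarrow> S j = 0"
  shows "(\<Sum>j\<in>UNIV. S j) = (\<Sum>i\<in>UNIV. S (\<lambda>_. i))"
proof -
  have "(\<Sum>j\<in>UNIV. S j) = (\<Sum>j\<in>range (\<lambda>i (_::'d). i :: 'n). S j)"
    using assms by (intro sum.mono_neutral_right) auto
  also have "\<dots> = (\<Sum>i\<in>UNIV. S (\<lambda>_. i))"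
    by (subst sum.reindex) (auto simp: inj_def fun_eq_iff)
  finally show ?thesis .
qed

lemma diag_form_nth: "(diag_form :: real ^ ('d::finite \<Rightarrow> 'n::finite)) $ j =
  (if \<exists>i. j = (\<lambda>_. i) then weight CARD('d) (j undefined) else 0)"
  by (simp add: diag_form_def)

lemma diag_form_const: "(diag_form :: real ^ ('d::finite \<Rightarrow> 'n::finite)) $ (\<lambda>_. i) = weight CARD('d) i"
  by (auto simp: diag_form_nth)

lemma diag_form_symmetric: "diag_form \<in> symmetric_tensors"
proof -
  have "(\<exists>i. j \<circ> p = (\<lambda>_. i)) \<longleftrightarrow> (\<exists>i. j = (\<lambda>_. i))" if "bij p" for p :: "'a \<Rightarrow> 'a" and j :: "'a \<Rightarrow> 'b"
  proof -
    have "\<exists>i. j = (\<lambda>_. i)" if e: "j \<circ> p = (\<lambda>_. i)" for i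
    proof -
      have "j m = i" for m
        using fun_cong[OF e, of "inv p m"] \<open>bij p\<close> by (simp add: bij_is_surj surj_f_inv_f)
      then show ?thesis by auto
    qed
    then show ?thesis by auto
  qed
  then show ?thesis by (auto simp: symmetric_tensors_def diag_form_nth)
qed

lemma eig_diag:
  "eig (k0::'d::finite) i diag_form x = of_real (weight CARD('d) i) * (x $ i) ^ (CARD('d) - 1) - x $ (i::'n::finite)"
proof -
  have "contr k0 (complexify diag_form) i x = (\<Sum>i'\<in>UNIV. if i' = i then of_real (weight CARD('d) i') * (\<Prod>m\<in>-{k0}. x $ i') else 0)"
    unfolding contr_def by (subst sum_diag_form) (auto simp: complexify_def diag_form_const diag_form_nth)
  then show ?thesis by (simp add: eig_def)
qed

lemma jac_diag:
  fixes i l :: "'n::finite"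
  assumes "2 \<le> CARD('d)"
  shows "jac (k0::'d::finite) i l diag_form x =
    (if i = l then of_real (weight CARD('d) i) * of_nat (CARD('d) - 1) * (x $ i) ^ (CARD('d) - 2) - 1 else 0)"
proof -
  have "(\<Sum>j\<in>UNIV. if j k0 = i then complex_of_real (diag_form $ j) *
     (\<Sum>k\<in>-{k0}. if j k = l then \<Prod>m\<in>-{k0} - {k}. x $ j m else 0) else 0)
    = (\<Sum>i'\<in>UNIV. if i' = i then complex_of_real (weight CARD('d) i') *
     (\<Sum>k\<in>-{k0}. if i' = l then \<Prod>m\<in>-{k0} - {k}. x $ i' else 0) else 0)"
    by (subst sum_diag_form) (auto simp: diag_form_const diag_form_nth)
  also have "\<dots> = complex_of_real (weight CARD('d) i) * (if i = l then \<Sum>k\<in>-{k0}. \<Prod>m\<in>-{k0} - {k}. x $ i else 0)"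
    by (simp cong: if_cong)
  also have "(\<Sum>k\<in>-{k0}. \<Prod>m\<in>-{k0} - {k}. x $ i) = of_nat (CARD('d) - 1) * (x $ i) ^ (CARD('d) - 2)"
    by (simp add: card_compl2 numeral_2_eq_2)
  finally show ?thesis by (simp add: jac_def)
qed

text \<open>The equations decouple: at a nonzero coordinate, the weight times its power
  \<open>d - 2\<close> is 1. The diagonal Jacobian entries are therefore -1 at zero coordinates and
  \<open>d - 2\<close> at the others, all nonzero for \<open>3 \<le> d\<close>.\<close>

lemma diag_zero:
  assumes d: "3 \<le> CARD('d)" and z: "\<And>i. eig (k0::'d::finite) i diag_form v = 0"
  shows "det (\<chi> i l. jac k0 i l diag_form v) \<noteq> 0"
    and "v $ i = 0 \<or> cmod (v $ i) = 2 ^ to_nat (i::'n::finite)"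
proof -
  let ?w = "\<lambda>i. complex_of_real (weight CARD('d) i)"
  have pw: "v $ i ^ (CARD('d) - 1) = v $ i * v $ i ^ (CARD('d) - 2)" for i
    using d by (metis One_nat_def Suc_1 Suc_diff_le diff_Suc_Suc numeral_3_eq_3 Suc_leD power_Suc)
  have w1: "?w i * v $ i ^ (CARD('d) - 2) = 1" if "v $ i \<noteq> 0" for i
  proof -
    have "v $ i * (?w i * v $ i ^ (CARD('d) - 2)) = v $ i * 1"
      using z[of i, unfolded eig_diag pw] by (simp add: mult.left_commute)
    then show ?thesis using that by (metis mult_left_cancel)
  qed
  have "jac k0 i i diag_form v \<noteq> 0" for i
  proof (cases "v $ i = 0")
    case True
    then show ?thesis using d by (simp add: jac_diag power_0_left)
  next
    case False
    have "jac k0 i i diag_form v = of_nat (CARD('d) - 1) * (?w i * v $ i ^ (CARD('d) - 2)) - 1"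
      using d by (simp add: jac_diag)
    also have "\<dots> = of_nat (CARD('d) - 1) - 1" using w1[OF False] by simp
    finally have "jac k0 i i diag_form v = of_nat (CARD('d) - 1) - 1" .
    moreover have "of_nat (CARD('d) - 1) \<noteq> (1 :: complex)" using d unfolding of_nat_eq_1_iff by simp
    ultimately show ?thesis by (simp only: right_minus_eq not_False_eq_True)
  qed
  moreover have "det (\<chi> i l. jac k0 i l diag_form v) = (\<Prod>i\<in>UNIV. jac k0 i i diag_form v)"
    using d by (subst det_diagonal) (auto simp: jac_diag)
  ultimately show "det (\<chi> i l. jac k0 i l diag_form v) \<noteq> 0" by simp
  show "v $ i = 0 \<or> cmod (v $ i) = 2 ^ to_nat i"
  proof (cases "v $ i = 0")
    case False
    have "cmod (?w i * v $ i ^ (CARD('d) - 2)) = 1" using w1[OF False] by simp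
    then have "cmod (v $ i) ^ (CARD('d) - 2) = (2 ^ to_nat i) ^ (CARD('d) - 2)"
      by (simp add: norm_mult norm_power norm_divide weight_def power_one_over power_mult field_simps)
    then have "cmod (v $ i) = 2 ^ to_nat i"
      by (rule power_eq_imp_eq_base) (use d in auto)
    then show ?thesis ..
  qed simp
qed

lemma sum_pow4: "(\<Sum>m<n. 4 ^ m) < (4 ^ n :: real)"
proof (induction n)
  case (Suc n)
  have "0 < (4 ^ n :: real)" by simp
  then show ?case using Suc by (simp only: sum.lessThan_Suc power_Suc)
qed simp

text \<open>The squares of the nonzero coordinates have distinct powers of 4 as moduli, and the
  largest exceeds the sum of the others, so they cannot cancel.\<close>

lemma diag_not_isotropic:
  fixes v :: "complex ^ 'n::finite"
  assumes m: "\<And>i. v $ i = 0 \<or> cmod (v $ i) = 2 ^ to_nat i" and "v \<noteq> 0"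
  shows "(\<Sum>i\<in>UNIV. v $ i * v $ i) \<noteq> 0"
proof
  assume s: "(\<Sum>i\<in>UNIV. v $ i * v $ i) = 0"
  let ?A = "{i. v $ i \<noteq> 0}"
  have ne: "?A \<noteq> {}" using assms(2) by (auto simp: vec_eq_iff)
  define N where "N = Max (to_nat ` ?A)"
  have "N \<in> to_nat ` ?A" unfolding N_def using ne by (intro Max_in) auto
  then obtain k where k: "v $ k \<noteq> 0" "to_nat k = N" by auto
  have le: "to_nat i \<le> N" if "v $ i \<noteq> 0" for i unfolding N_def using that by (intro Max_ge) auto
  have sq: "cmod (v $ i * v $ i) = 4 ^ to_nat i" if "v $ i \<noteq> 0" for i
    using m[of i] that by (simp add: norm_mult flip: power_mult_distrib)
  have "(\<Sum>i\<in>UNIV. v $ i * v $ i) = v $ k * v $ k + (\<Sum>i\<in>UNIV - {k}. v $ i * v $ i)"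
    by (rule sum.remove) auto
  then have "v $ k * v $ k = - (\<Sum>i\<in>UNIV - {k}. v $ i * v $ i)" using s by (simp add: add_eq_0_iff)
  then have "4 ^ N = cmod (\<Sum>i\<in>UNIV - {k}. v $ i * v $ i)" using sq[OF k(1)] k(2) by simp
  also have "\<dots> = cmod (\<Sum>i\<in>?A - {k}. v $ i * v $ i)"
    by (intro arg_cong[of _ _ cmod] sum.mono_neutral_right) auto
  also have "\<dots> \<le> (\<Sum>i\<in>?A - {k}. cmod (v $ i * v $ i))" by (rule norm_sum)
  also have "\<dots> = (\<Sum>i\<in>?A - {k}. 4 ^ to_nat i)" using sq by (intro sum.cong) auto
  also have "\<dots> = (\<Sum>m\<in>to_nat ` (?A - {k}). 4 ^ m)"
    by (subst sum.reindex) (auto intro: inj_on_subset[OF inj_to_nat])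
  also have "\<dots> \<le> (\<Sum>m<N. 4 ^ m)"
  proof (rule sum_mono2)
    show "to_nat ` (?A - {k}) \<subseteq> {..<N}"
      using le k(2) by (auto simp: less_le)
  qed auto
  also have "\<dots> < 4 ^ N" by (rule sum_pow4)
  finally show False by simp
qed

lemma generic_eigenvectors:
  assumes d: "3 \<le> CARD('d)"
  shows "generic (diag_form :: real ^ ('d::finite \<Rightarrow> 'n::finite))
    (\<lambda>f. (\<forall>v. (\<forall>i. eig k0 i f v = 0) \<longrightarrow> v \<noteq> 0 \<longrightarrow> test k0 f v \<noteq> 0) \<and>
      (\<forall>u\<in>Pol CARD('d). (\<forall>v. (\<forall>i. eig k0 i f v = 0) \<longrightarrow> u v = 0) \<longrightarrow> u \<in> Idl (\<lambda>i. eig k0 i f) 1))"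
proof -
  let ?e = "CARD('d) - 1"
  have eig0: "eig k0 i f 0 = 0" for i :: 'n and f
  proof -
    have "(\<Prod>m\<in>-{k0}. 0 $ j m :: complex) = 0" for j :: "'d \<Rightarrow> 'n"
      using d by (simp add: power_0_left)
    then show ?thesis using d by (simp add: eig_def contr_def power_0_left cong: if_cong)
  qed
  \<comment> \<open>With \<open>3 \<le> d\<close> every term of the derivative of the contraction
    keeps a coordinate as a factor. At the origin the Jacobian matrix is minus the identity for
    every \<open>f\<close>, and the origin is always a simple zero.\<close>
  have jac0: "jac k0 i l f 0 = (if i = l then -1 else 0)" for i l :: 'n and f
  proof -
    have "(\<Prod>m\<in>-{k0} - {k}. 0 $ j m :: complex) = 0" if "k \<in> -{k0}" for j :: "'d \<Rightarrow> 'n" and k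
      using d card_compl2[OF that] by (simp add: power_0_left)
    then have "(\<Sum>k\<in>-{k0}. if j k = l then \<Prod>m\<in>-{k0} - {k}. 0 $ j m :: complex else 0) = 0" for j :: "'d \<Rightarrow> 'n"
      by (intro sum.neutral) auto
    then show ?thesis by (simp only: jac_def mult_zero_right if_cancel sum.neutral_const) simp
  qed
  interpret perturbed_powers_test "eig k0" ?e "diag_form :: real ^ ('d \<Rightarrow> 'n)"
    "\<lambda>i. of_real (weight CARD('d) i)" "test k0" "CARD('n) * (CARD('d) - 1) + 2"
  proof unfold_locales
    show "2 \<le> ?e" using d by simp
    show "polyfam (Mon ?e) mon (eig k0 i)" for i :: 'n by (rule eig_polyfam[OF d])
    show "eig k0 i diag_form = fscale (of_real (weight CARD('d) i)) (mon (pw ?e i)) - mon (unit_exp i)" for i :: 'n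
    proof
      fix x :: "complex ^ 'n"
      have "mon (pw ?e i) x = (\<Prod>j\<in>UNIV. if j = i then x $ j ^ ?e else 1)"
        unfolding mon_def by (intro prod.cong) (auto simp: pw_def)
      then show "eig k0 i diag_form x = (fscale (of_real (weight CARD('d) i)) (mon (pw ?e i)) - mon (unit_exp i)) x"
        by (simp add: eig_diag mon_unit_exp)
    qed
    show "complex_of_real (weight CARD('d) i) \<noteq> 0" for i :: 'n by (simp add: weight_def)
    show "polyfam (Mon (CARD('n) * (CARD('d) - 1) + 2)) mon (test k0 :: real ^ ('d \<Rightarrow> 'n) \<Rightarrow> _)" by (rule test_polyfam)
    fix v :: "complex ^ 'n"
    assume z: "\<And>i. eig k0 i diag_form v = 0"
    show "simple_zero (\<lambda>i. eig k0 i diag_form) v"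
      by (rule eig_simple[OF z diag_zero(1)[OF d z]])
    show "test k0 diag_form v \<noteq> 0" if "v \<noteq> 0"
      using diag_zero(1)[OF d z] diag_not_isotropic[OF diag_zero(2)[OF d z] that] by (simp add: test_def)
  next
    show "eig k0 i f 0 = 0" for i :: 'n and f by (rule eig0)
    show "test k0 f 0 = 0" for f :: "real ^ ('d \<Rightarrow> 'n)" by (simp add: test_def)
  qed
  have "simple_zero (\<lambda>i. eig k0 i f) 0" for f :: "real ^ ('d \<Rightarrow> 'n)"
  proof (rule eig_simple[OF eig0])
    have "det (\<chi> i l. jac k0 i l f 0) = (\<Prod>i\<in>UNIV. (\<chi> i l. jac k0 i l f 0) $ i $ i)"
      by (rule det_diagonal) (simp add: jac0)
    then show "det (\<chi> i l. jac k0 i l f 0) \<noteq> 0" by (simp add: jac0)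
  qed
  moreover have "simple_zero (\<lambda>i. eig k0 i f) v" if "\<And>i. eig k0 i f v = 0" "test k0 f v \<noteq> 0"
    for f :: "real ^ ('d \<Rightarrow> 'n)" and v
    using that by (intro eig_simple) (auto simp: test_def)
  ultimately show ?thesis
    using generic_vanishing d by simp
qed

section \<open>Real rank and best approximations\<close>

lemma symmetric_tensors_add:
  "s \<in> symmetric_tensors \<Longrightarrow> t \<in> symmetric_tensors \<Longrightarrow> s + t \<in> symmetric_tensors"
  by (simp add: symmetric_tensors_def)

lemma symmetric_tensors_diff:
  "s \<in> symmetric_tensors \<Longrightarrow> t \<in> symmetric_tensors \<Longrightarrow> s - t \<in> symmetric_tensors"
  by (simp add: symmetric_tensors_def)

lemma symmetric_tensors_scaleR:
  "s \<in> symmetric_tensors \<Longrightarrow> c *\<^sub>R s \<in> symmetric_tensors"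
  by (simp add: symmetric_tensors_def)

lemma symmetric_tensors_sum:
  fixes s :: "'b \<Rightarrow> real ^ ('d::finite \<Rightarrow> 'n::finite)"
  shows "(\<And>a. a \<in> A \<Longrightarrow> s a \<in> symmetric_tensors) \<Longrightarrow> (\<Sum>a\<in>A. s a) \<in> symmetric_tensors"
proof (induction A rule: infinite_finite_induct)
  case (insert a A)
  then show ?case by (simp add: symmetric_tensors_add)
qed (simp_all add: symmetric_tensors_def)

lemma cexp_eq_imp_perm:
  fixes i j :: "'d::finite \<Rightarrow> 'n::finite"
  assumes "cexp UNIV i = cexp UNIV j"
  shows "\<exists>p. bij p \<and> i = j \<circ> p"
proof -
  have c: "cexp UNIV i l = count (image_mset i (mset_set UNIV)) l" for i :: "'d \<Rightarrow> 'n" and l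
  proof -
    have "cexp UNIV i l = (\<Sum>k\<in>UNIV. if i k = l then 1 else 0)"
      unfolding cexp_def sum_fun_eq by (intro sum.cong) (auto simp: unit_exp_def)
    also have "\<dots> = card {k. i k = l}" by (simp add: sum.If_cases)
    also have "\<dots> = count (image_mset i (mset_set UNIV)) l"
      by (simp add: count_image_mset vimage_def)
    finally show ?thesis .
  qed
  have "image_mset i (mset_set UNIV) = image_mset j (mset_set UNIV)"
    by (rule multiset_eqI) (metis assms c)
  then obtain p where "p permutes UNIV" "\<forall>x\<in>UNIV. i x = j (p x)"
    using image_mset_eq_implies_permutes[of UNIV i j] by auto
  then show ?thesis by (intro exI[of _ p]) (auto simp: permutes_bij)
qed

lemma prod_coord_exp:
  fixes x :: "'a::comm_semiring_1 ^ 'n::finite"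
  assumes "finite A"
  shows "(\<Prod>k\<in>A. x $ j k) = (\<Prod>l\<in>UNIV. (x $ l) ^ cexp A j l)"
  using assms
proof (induction A rule: finite_induct)
  case empty
  then show ?case by (simp add: cexp_def)
next
  case (insert k A)
  have "(\<Prod>l\<in>UNIV. (x $ l) ^ cexp (insert k A) j l)
      = (\<Prod>l\<in>UNIV. (if l = j k then x $ l else 1) * (x $ l) ^ cexp A j l)"
    using insert.hyps by (intro prod.cong) (auto simp: cexp_def unit_exp_def)
  also have "\<dots> = x $ j k * (\<Prod>k\<in>A. x $ j k)" by (simp add: prod.distrib insert.IH)
  finally show ?case using insert.hyps by simp
qed

text \<open>Collected by exponents, the coefficients of the form given by \<open>t\<close> vanish.
  By symmetry the entries collected in one coefficient are equal, so each of them is 0.\<close>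

lemma symmetric_vanishing:
  fixes t :: "real ^ ('d::finite \<Rightarrow> 'n::finite)"
  assumes t: "t \<in> symmetric_tensors" and z: "\<And>v. t \<bullet> tensor_power v = 0"
  shows "t = 0"
proof -
  let ?E = "cexp UNIV ` (UNIV :: ('d \<Rightarrow> 'n) set)"
  have "t $ i = 0" for i
  proof -
    have "(\<Sum>j\<in>{j :: 'd \<Rightarrow> 'n. cexp UNIV j = cexp UNIV i}. t $ j) = 0"
    proof (rule mon_indep_aux[of UNIV ?E "\<lambda>a. \<Sum>j\<in>{j :: 'd \<Rightarrow> 'n. cexp UNIV j = a}. t $ j"])
      fix x :: "real ^ 'n"
      have "0 = (\<Sum>j\<in>UNIV. t $ j * (\<Prod>l\<in>UNIV. (x $ l) ^ cexp UNIV j l))"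
        using z[of x] by (simp add: inner_vec_def tensor_power_def prod_coord_exp)
      also have "\<dots> = (\<Sum>a\<in>?E. \<Sum>j\<in>{j \<in> (UNIV :: ('d \<Rightarrow> 'n) set). cexp UNIV j = a}. t $ j * (\<Prod>l\<in>UNIV. (x $ l) ^ cexp UNIV j l))"
        by (rule sum.image_gen) simp
      also have "\<dots> = (\<Sum>a\<in>?E. (\<Sum>j\<in>{j :: 'd \<Rightarrow> 'n. cexp UNIV j = a}. t $ j) * (\<Prod>l\<in>UNIV. (x $ l) ^ a l))"
        by (auto simp: sum_distrib_right intro!: sum.cong)
      finally show "(\<Sum>a\<in>?E. (\<Sum>j\<in>{j :: 'd \<Rightarrow> 'n. cexp UNIV j = a}. t $ j) * (\<Prod>l\<in>UNIV. (x $ l) ^ a l)) = 0" by simp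
    qed auto
    moreover have "(\<Sum>j\<in>{j :: 'd \<Rightarrow> 'n. cexp UNIV j = cexp UNIV i}. t $ j) = (\<Sum>j\<in>{j :: 'd \<Rightarrow> 'n. cexp UNIV j = cexp UNIV i}. t $ i)"
    proof (rule sum.cong)
      fix j assume "j \<in> {j :: 'd \<Rightarrow> 'n. cexp UNIV j = cexp UNIV i}"
      then show "t $ j = t $ i"
        using cexp_eq_imp_perm[of j i] t by (auto simp: symmetric_tensors_def)
    qed simp
    ultimately have "of_nat (card {j :: 'd \<Rightarrow> 'n. cexp UNIV j = cexp UNIV i}) * t $ i = 0" by simp
    moreover have "card {j :: 'd \<Rightarrow> 'n. cexp UNIV j = cexp UNIV i} \<noteq> 0" by auto
    ultimately show ?thesis by simp
  qed
  then show ?thesis by (simp add: vec_eq_iff)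
qed

definition rank_rep :: "nat \<Rightarrow> real ^ ('d::finite \<Rightarrow> 'n::finite) \<Rightarrow> bool" where
  "rank_rep k t \<longleftrightarrow> (\<exists>(c :: nat \<Rightarrow> real) (v :: nat \<Rightarrow> real ^ 'n). t = (\<Sum>i<k. c i *\<^sub>R tensor_power (v i)))"

lemma rank_repE:
  assumes "rank_rep k t"
  obtains c :: "nat \<Rightarrow> real" and v where "t = (\<Sum>i<k. c i *\<^sub>R tensor_power (v i))"
proof -
  show thesis
    using assms unfolding rank_rep_def
  proof (elim exE)
    fix c :: "nat \<Rightarrow> real" and v :: "nat \<Rightarrow> real ^ 'b"
    assume "t = (\<Sum>i<k. c i *\<^sub>R tensor_power (v i))"
    then show thesis by (rule that)
  qed
qed

text \<open>The component of \<open>t\<close> orthogonal to all powers is itself symmetric, hence 0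
  by \<open>symmetric_vanishing\<close>. This gives meaning to the \<open>LEAST\<close> in the
  definition of rank.\<close>

lemma rank_rep_exists:
  fixes t :: "real ^ ('d::finite \<Rightarrow> 'n::finite)"
  assumes "t \<in> symmetric_tensors"
  shows "\<exists>k. rank_rep k t"
proof -
  let ?P = "range (tensor_power :: real ^ 'n \<Rightarrow> real ^ ('d \<Rightarrow> 'n))"
  obtain y z where y: "y \<in> span ?P" and z: "\<And>w. w \<in> span ?P \<Longrightarrow> orthogonal z w" and t: "t = y + z"
    using orthogonal_subspace_decomp_exists[of ?P t] by blast
  have reps: "\<exists>k. rank_rep k y" and "y \<in> symmetric_tensors"
    using y
  proof (induction rule: span_induct_alt)
    case base
    show "\<exists>k. rank_rep k 0" by (rule exI[of _ 0]) (simp add: rank_rep_def)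
    show "(0 :: real ^ ('d \<Rightarrow> 'n)) \<in> symmetric_tensors" by (simp add: symmetric_tensors_def)
  next
    case (step a x y)
    then obtain v where v: "x = tensor_power v" by blast
    from step(2) obtain k where "rank_rep k y" ..
    then obtain c w where "y = (\<Sum>i<k. c i *\<^sub>R tensor_power (w i))" by (rule rank_repE)
    then have "a *\<^sub>R x + y = (\<Sum>i<Suc k. (c(k := a)) i *\<^sub>R tensor_power ((w(k := v)) i))"
      by (simp add: v)
    then show "\<exists>k. rank_rep k (a *\<^sub>R x + y)" unfolding rank_rep_def by (intro exI)
    show "a *\<^sub>R x + y \<in> symmetric_tensors"
      unfolding v by (intro symmetric_tensors_add symmetric_tensors_scaleR tensor_power_symmetric step)
  qed
  have "z = t - y" using t by simp
  then have "z \<in> symmetric_tensors" using assms \<open>y \<in> symmetric_tensors\<close> by (simp add: symmetric_tensors_diff)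
  moreover have "z \<bullet> tensor_power v = 0" for v
    using z[OF span_base[of "tensor_power v" ?P]] by (simp add: orthogonal_def)
  ultimately have "z = 0" by (rule symmetric_vanishing)
  then show ?thesis using reps t by simp
qed

lemma rank_rep_rank: "t \<in> symmetric_tensors \<Longrightarrow> rank_rep (real_symmetric_rank t) t"
  using rank_rep_exists[of t] unfolding real_symmetric_rank_def rank_rep_def by (rule LeastI_ex)

lemma rank_le: "rank_rep k t \<Longrightarrow> real_symmetric_rank t \<le> k"
  unfolding real_symmetric_rank_def rank_rep_def by (rule Least_le)

section \<open>Rotations and stationarity of best approximations\<close>

definition rot :: "'n \<Rightarrow> 'n \<Rightarrow> real \<Rightarrow> real ^ 'n::finite \<Rightarrow> real ^ 'n" where
  "rot a b \<theta> v = (\<chi> l. if l = a then cos \<theta> * v $ a - sin \<theta> * v $ b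
     else if l = b then sin \<theta> * v $ a + cos \<theta> * v $ b else v $ l)"

lemma rot_inner:
  assumes "a \<noteq> b" shows "rot a b \<theta> v \<bullet> rot a b \<theta> w = v \<bullet> w"
proof -
  have split: "x \<bullet> y = x $ a * y $ a + (x $ b * y $ b + (\<Sum>l\<in>UNIV - {a} - {b}. x $ l * y $ l))" for x y :: "real ^ 'a"
  proof -
    have "x \<bullet> y = x $ a * y $ a + (\<Sum>l\<in>UNIV - {a}. x $ l * y $ l)"
      unfolding inner_vec_def inner_real_def by (rule sum.remove) auto
    also have "(\<Sum>l\<in>UNIV - {a}. x $ l * y $ l) = x $ b * y $ b + (\<Sum>l\<in>UNIV - {a} - {b}. x $ l * y $ l)"
      using assms by (intro sum.remove) auto
    finally show ?thesis .
  qed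
  have rest: "(\<Sum>l\<in>UNIV - {a} - {b}. rot a b \<theta> v $ l * rot a b \<theta> w $ l) = (\<Sum>l\<in>UNIV - {a} - {b}. v $ l * w $ l)"
    by (intro sum.cong) (auto simp: rot_def)
  have gen: "(c * p - s * q) * (c * p' - s * q') + (s * p + c * q) * (s * p' + c * q')
      = (c * c + s * s) * (p * p' + q * q')" for c s p q p' q' :: real
    by (simp add: algebra_simps)
  have "(cos \<theta> * v $ a - sin \<theta> * v $ b) * (cos \<theta> * w $ a - sin \<theta> * w $ b)
      + (sin \<theta> * v $ a + cos \<theta> * v $ b) * (sin \<theta> * w $ a + cos \<theta> * w $ b)
      = v $ a * w $ a + v $ b * w $ b"
    unfolding gen sin_cos_squared_add3 by simp
  then show ?thesis
    unfolding split[of "rot a b \<theta> v"] split[of v] rest using assms by (simp add: rot_def)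
qed

lemma rot_deriv:
  assumes "a \<noteq> b"
  shows "((\<lambda>\<theta>. rot a b \<theta> v $ l) has_real_derivative (if l = a then - v $ b else if l = b then v $ a else 0)) (at 0)"
  using assms by (auto simp: rot_def intro!: derivative_eq_intros)

text \<open>Rotating the powers in a decomposition of a best approximation keeps rank and norm, so the
  inner product with \<open>f\<close> is stationary along every rotation.\<close>

lemma best_approximation_stationary:
  fixes f g :: "real ^ ('d::finite \<Rightarrow> 'n::finite)" and v :: "nat \<Rightarrow> real ^ 'n"
  assumes f: "f \<in> symmetric_tensors"
    and g: "g = (\<Sum>m<K. c m *\<^sub>R tensor_power (v m))" and K: "K \<le> k"
    and min: "\<And>h. h \<in> symmetric_tensors \<Longrightarrow> real_symmetric_rank h \<le> k \<Longrightarrow> norm (f - g) \<le> norm (f - h)"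
  shows "(\<Sum>m<K. c m * (v m $ a * contr k0 f b (v m))) = (\<Sum>m<K. c m * (v m $ b * contr k0 f a (v m)))"
proof (cases "a = b")
  case False
  note ab = this
  define gt where "gt \<theta> = (\<Sum>m<K. c m *\<^sub>R tensor_power (rot a b \<theta> (v m)) :: real ^ ('d \<Rightarrow> 'n))" for \<theta>
  have rot0: "rot a b 0 w = w" for w :: "real ^ 'n" by (simp add: rot_def vec_eq_iff)
  then have gt0: "gt 0 = g" unfolding gt_def g by simp
  have "gt \<theta> \<bullet> gt \<theta> = g \<bullet> g" for \<theta>
    unfolding gt_def g by (simp add: inner_sum_left inner_sum_right inner_tensor_power rot_inner[OF ab])
  moreover have "norm (f - g) \<le> norm (f - gt \<theta>)" for \<theta>
  proof (rule min)
    show "gt \<theta> \<in> symmetric_tensors"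
      unfolding gt_def by (intro symmetric_tensors_sum symmetric_tensors_scaleR tensor_power_symmetric)
    have "rank_rep K (gt \<theta>)"
      unfolding rank_rep_def gt_def by (intro exI[of _ c] exI[of _ "\<lambda>m. rot a b \<theta> (v m)"] refl)
    then show "real_symmetric_rank (gt \<theta>) \<le> k" using rank_le K by (meson le_trans)
  qed
  then have "(f - g) \<bullet> (f - g) \<le> (f - gt \<theta>) \<bullet> (f - gt \<theta>)" for \<theta> by (simp add: norm_le)
  \<comment> \<open>As the norm of \<open>gt\<close> is constant, minimal distance from
    \<open>f\<close> means maximal inner product with \<open>f\<close>.\<close>
  ultimately have le: "f \<bullet> gt \<theta> \<le> f \<bullet> gt 0" for \<theta>
    unfolding gt0 by (simp add: inner_diff inner_commute)
  \<comment> \<open>The velocity of the rotation at angle 0: a skew-symmetric matrix applied to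
    \<open>v m\<close>.\<close>
  define y where "y m = (\<chi> l. if l = a then - v m $ b else if l = b then v m $ a else 0)" for m
  have "((\<lambda>\<theta>. f \<bullet> gt \<theta>) has_real_derivative (\<Sum>m<K. c m * (\<Sum>j\<in>UNIV. f $ j *
      (\<Sum>q\<in>UNIV. y m $ j q * (\<Prod>r\<in>-{q}. v m $ j r))))) (at 0)"
  proof -
    have "((\<lambda>\<theta>. \<Prod>q\<in>UNIV. rot a b \<theta> (v m) $ j q) has_real_derivative
        (\<Sum>q\<in>UNIV. y m $ j q * (\<Prod>r\<in>-{q}. v m $ j r))) (at 0)" for m and j :: "'d \<Rightarrow> 'n"
    proof -
      have "((\<lambda>\<theta>. \<Prod>q\<in>UNIV. rot a b \<theta> (v m) $ j q) has_real_derivative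
        (\<Sum>q\<in>UNIV. y m $ j q * (\<Prod>r\<in>UNIV - {q}. rot a b 0 (v m) $ j r))) (at 0)"
        using rot_deriv[OF ab] by (intro has_field_derivative_prod) (simp add: y_def)
      then show ?thesis by (simp add: rot0 Compl_eq_Diff_UNIV)
    qed
    then have "((\<lambda>\<theta>. \<Sum>m<K. c m * (\<Sum>j\<in>UNIV. f $ j * (\<Prod>q\<in>UNIV. rot a b \<theta> (v m) $ j q))) has_real_derivative
        (\<Sum>m<K. c m * (\<Sum>j\<in>UNIV. f $ j * (\<Sum>q\<in>UNIV. y m $ j q * (\<Prod>r\<in>-{q}. v m $ j r))))) (at 0)"
      by (intro DERIV_sum DERIV_cmult)
    moreover have "f \<bullet> gt \<theta> = (\<Sum>m<K. c m * (\<Sum>j\<in>UNIV. f $ j * (\<Prod>q\<in>UNIV. rot a b \<theta> (v m) $ j q)))" for \<theta>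
      by (simp add: gt_def inner_sum_right) (simp add: inner_vec_def tensor_power_def)
    ultimately show ?thesis by simp
  qed
  then have "(\<Sum>m<K. c m * (\<Sum>j\<in>UNIV. f $ j * (\<Sum>q\<in>UNIV. y m $ j q * (\<Prod>r\<in>-{q}. v m $ j r)))) = 0"
    by (rule DERIV_local_max[where d = 1]) (use le in auto)
  then have "(\<Sum>m<K. c m * (real CARD('d) * (\<Sum>l\<in>UNIV. y m $ l * contr k0 f l (v m)))) = 0"
    by (simp only: sum_contr_all[OF f, where ?k0.0 = k0])
  then have "real CARD('d) * (\<Sum>m<K. c m * (\<Sum>l\<in>UNIV. y m $ l * contr k0 f l (v m))) = 0"
    by (subst sum_distrib_left) (simp only: mult.left_commute[of "real CARD('d)"])
  then have "(\<Sum>m<K. c m * (\<Sum>l\<in>UNIV. y m $ l * contr k0 f l (v m))) = 0" by simp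
  moreover have "(\<Sum>l\<in>UNIV. y m $ l * contr k0 f l (v m)) = v m $ a * contr k0 f b (v m) - v m $ b * contr k0 f a (v m)" for m
  proof -
    have "(\<Sum>l\<in>UNIV. y m $ l * contr k0 f l (v m)) = (\<Sum>l\<in>{a,b}. y m $ l * contr k0 f l (v m))"
      by (intro sum.mono_neutral_right) (auto simp: y_def)
    then show ?thesis using ab by (simp add: y_def)
  qed
  ultimately show ?thesis by (simp add: right_diff_distrib sum_subtractf)
qed simp

section \<open>Critical rank-one tensors\<close>

text \<open>The derivative of \<open>tensor_power\<close> at \<open>v\<close> in direction
  \<open>w\<close>.\<close>

definition polar :: "'a::comm_ring_1 ^ 'n::finite \<Rightarrow> 'a ^ 'n \<Rightarrow> ('d::finite \<Rightarrow> 'n) \<Rightarrow> 'a" where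
  "polar v w j = (\<Sum>k\<in>UNIV. w $ j k * (\<Prod>m\<in>-{k}. v $ j m))"

definition swap_relation ::
  "'a::comm_ring_1 ^ ('d::finite \<Rightarrow> 'n::finite) \<Rightarrow> 'a ^ ('d \<Rightarrow> 'n) \<Rightarrow> bool" where
  "swap_relation x y \<longleftrightarrow> (\<forall>i j k. y $ i * x $ j + x $ i * y $ j =
     y $ (i(k := j k)) * x $ (j(k := i k)) + x $ (i(k := j k)) * y $ (j(k := i k)))"

text \<open>The two-by-two minors \<open>t\<^sub>i t\<^sub>j - t\<^sub>i' t\<^sub>j'\<close>, where \<open>i'\<close> and \<open>j'\<close> arise by exchanging the \<open>k\<close>-th
  entries of \<open>i\<close> and \<open>j\<close>, vanish on powers; these are their differentials.\<close>

lemma tangent_swap_relation: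
  fixes x y :: "complex ^ ('d::finite \<Rightarrow> 'n::finite)"
  assumes "y \<in> tangent_space complex_powers x"
  shows "swap_relation x y"
  unfolding swap_relation_def
proof (intro allI)
  fix i j :: "'d \<Rightarrow> 'n" and k
  let ?i = "i(k := j k)" and ?j = "j(k := i k)"
  define p where "p t = t $ i * t $ j + (-1) * (t $ ?i * t $ ?j)" for t :: "complex ^ ('d \<Rightarrow> 'n)"
  have "complex_polynomial_function p"
    unfolding p_def by (intro complex_polynomial_function.intros)
  moreover have "p z = 0" if "z \<in> complex_powers" for z
  proof -
    obtain v where z: "z = tensor_power v" using \<open>z \<in> complex_powers\<close> by (auto simp: complex_powers_def)
    have split: "z $ l = v $ l k * (\<Prod>m\<in>UNIV - {k}. v $ l m)" for l
      unfolding z tensor_power_def by (simp add: prod.remove[of UNIV k])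
    have upd: "(\<Prod>m\<in>UNIV - {k}. v $ (l(k := a)) m) = (\<Prod>m\<in>UNIV - {k}. v $ l m)" for l a
      by (intro prod.cong) auto
    show ?thesis unfolding p_def split upd by simp
  qed
  ultimately have "frechet_derivative p (at x) y = 0"
    using assms by (auto simp: tangent_space_def)
  moreover have "(p has_derivative (\<lambda>y. y $ i * x $ j + x $ i * y $ j
      - (y $ ?i * x $ ?j + x $ ?i * y $ ?j))) (at x)"
    unfolding p_def
    by (auto intro!: derivative_eq_intros bounded_linear_imp_has_derivative bounded_linear_vec_nth simp: algebra_simps)
  then have "frechet_derivative p (at x) = (\<lambda>y. y $ i * x $ j + x $ i * y $ j
      - (y $ ?i * x $ ?j + x $ ?i * y $ ?j))" by (rule frechet_derivative_at[symmetric])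
  ultimately show "y $ i * x $ j + x $ i * y $ j = y $ ?i * x $ ?j + x $ ?i * y $ ?j" by simp
qed

text \<open>With the slot \<open>k\<close> split off, the remaining factors \<open>Q\<close> and
  \<open>E\<close> do not see the exchange at \<open>k\<close>, and both sides have the same
  expansion.\<close>

lemma polar_swap_relation:
  fixes v w :: "'a::comm_ring_1 ^ 'n::finite"
  shows "swap_relation (tensor_power v :: 'a ^ ('d::finite \<Rightarrow> 'n)) (\<chi> j. polar v w j)"
  unfolding swap_relation_def
proof (intro allI)
  fix i j :: "'d \<Rightarrow> 'n" and k
  let ?i = "i(k := j k)" and ?j = "j(k := i k)"
  define Q where "Q l = (\<Prod>m\<in>UNIV - {k}. v $ l m)" for l :: "'d \<Rightarrow> 'n"
  define E where "E l = (\<Sum>q\<in>UNIV - {k}. w $ l q * (\<Prod>m\<in>UNIV - {k} - {q}. v $ l m))" for l :: "'d \<Rightarrow> 'n"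
  have x: "(tensor_power v :: 'a ^ ('d \<Rightarrow> 'n)) $ l = v $ l k * Q l" for l
    unfolding tensor_power_def Q_def by (simp add: prod.remove[of UNIV k])
  have y: "(\<chi> j. polar v w j) $ l = w $ l k * Q l + v $ l k * E l" for l
  proof -
    have "polar v w l = w $ l k * (\<Prod>m\<in>-{k}. v $ l m) + (\<Sum>q\<in>UNIV - {k}. w $ l q * (\<Prod>m\<in>-{q}. v $ l m))"
      unfolding polar_def by (rule sum.remove) auto
    also have "(\<Sum>q\<in>UNIV - {k}. w $ l q * (\<Prod>m\<in>-{q}. v $ l m)) = v $ l k * E l"
      unfolding E_def sum_distrib_left
    proof (rule sum.cong)
      fix q assume "q \<in> UNIV - {k}"
      then have "- {q} - {k} = UNIV - {k} - {q}" "k \<in> - {q}" by auto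
      then have "(\<Prod>m\<in>-{q}. v $ l m) = v $ l k * (\<Prod>m\<in>UNIV - {k} - {q}. v $ l m)"
        using prod.remove[of "- {q}" k "\<lambda>m. v $ l m"] by simp
      then show "w $ l q * (\<Prod>m\<in>-{q}. v $ l m) = v $ l k * (w $ l q * (\<Prod>m\<in>UNIV - {k} - {q}. v $ l m))"
        by (simp add: mult.left_commute)
    qed simp
    finally show ?thesis by (simp add: Q_def Compl_eq_Diff_UNIV)
  qed
  have Qu: "Q (l(k := a)) = Q l" for l a unfolding Q_def by (intro prod.cong) auto
  have Eu: "E (l(k := a)) = E l" for l a
    unfolding E_def
  proof (rule sum.cong)
    fix q assume "q \<in> UNIV - {k}"
    moreover have "(\<Prod>m\<in>UNIV - {k} - {q}. v $ (l(k := a)) m) = (\<Prod>m\<in>UNIV - {k} - {q}. v $ l m)"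
      by (intro prod.cong) auto
    ultimately show "w $ (l(k := a)) q * (\<Prod>m\<in>UNIV - {k} - {q}. v $ (l(k := a)) m)
      = w $ l q * (\<Prod>m\<in>UNIV - {k} - {q}. v $ l m)" by simp
  qed simp
  show "(\<chi> j. polar v w j) $ i * tensor_power v $ j + tensor_power v $ i * (\<chi> j. polar v w j) $ j
    = (\<chi> j. polar v w j) $ ?i * tensor_power v $ ?j + tensor_power v $ ?i * (\<chi> j. polar v w j) $ ?j"
    unfolding x y Qu Eu by (simp add: algebra_simps)
qed

lemma swap_relation_diff:
  "swap_relation x y \<Longrightarrow> swap_relation x z \<Longrightarrow> swap_relation x (y - z)"
  unfolding swap_relation_def
proof (intro allI)
  fix i j k
  assume a: "\<forall>i j k. y $ i * x $ j + x $ i * y $ j =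
     y $ (i(k := j k)) * x $ (j(k := i k)) + x $ (i(k := j k)) * y $ (j(k := i k))"
    and b: "\<forall>i j k. z $ i * x $ j + x $ i * z $ j =
     z $ (i(k := j k)) * x $ (j(k := i k)) + x $ (i(k := j k)) * z $ (j(k := i k))"
  have "(y $ i * x $ j + x $ i * y $ j) - (z $ i * x $ j + x $ i * z $ j) =
    (y $ (i(k := j k)) * x $ (j(k := i k)) + x $ (i(k := j k)) * y $ (j(k := i k))) -
    (z $ (i(k := j k)) * x $ (j(k := i k)) + x $ (i(k := j k)) * z $ (j(k := i k)))"
    using a b by metis
  then show "(y - z) $ i * x $ j + x $ i * (y - z) $ j =
     (y - z) $ (i(k := j k)) * x $ (j(k := i k)) + x $ (i(k := j k)) * (y - z) $ (j(k := i k))"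
    by (simp add: algebra_simps)
qed

text \<open>Where \<open>v $ s\<close> is nonzero, a tangent vector is determined by its entries at
  indices differing from the constant index \<open>s\<close> in at most one slot. The direction
  \<open>w\<close> is solved from these entries; the difference \<open>z\<close> vanishes there, and
  the swap relations carry this to all indices. Criticality quantifies over tangent vectors, so an
  upper bound for the tangent space is what it takes.\<close>

lemma tangent_polar:
  fixes v :: "complex ^ 'n::finite" and y :: "complex ^ ('d::finite \<Rightarrow> 'n)"
  assumes y: "y \<in> tangent_space complex_powers (tensor_power v)" and v: "v \<noteq> 0"
  shows "\<exists>w. y = (\<chi> j. polar v w j)"
proof -
  let ?d = "CARD('d)"
  obtain s where s: "v $ s \<noteq> 0" using v by (auto simp: vec_eq_iff)
  define one_off where "one_off k l = ((\<lambda>_. s)(k := l) :: 'd \<Rightarrow> 'n)" for k l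
  have ysym: "y \<in> symmetric_tensors" using y by (simp add: tangent_space_def)
  have off_s: "one_off k s = (\<lambda>_. s)" for k by (auto simp: one_off_def fun_eq_iff)
  have yat: "y $ one_off k l = y $ one_off k' l" for k k' l
  proof -
    define p where "p m = (if m = k then k' else if m = k' then k else m)" for m
    have "p (p m) = m" for m by (simp add: p_def)
    then have "bij p" by (intro o_bij[of p p]) (auto simp: fun_eq_iff)
    then have "y $ (one_off k l \<circ> p) = y $ one_off k l" using ysym by (auto simp: symmetric_tensors_def)
    moreover have "one_off k l \<circ> p = one_off k' l" by (auto simp: one_off_def p_def fun_eq_iff)
    ultimately show ?thesis by simp
  qed
  let ?k = "undefined :: 'd"
  \<comment> \<open>Solved from the constant index, where all \<open>?d\<close> slots contribute
    equally. At an index with one other entry \<open>l\<close>, one slot contributes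
    \<open>w $ l\<close> and \<open>?d - 1\<close> slots contribute \<open>ws\<close>; for
    \<open>?d = 1\<close> the truncated exponent \<open>?d - 2\<close> comes with the factor
    0.\<close>
  define ws where "ws = y $ (\<lambda>_. s) / (of_nat ?d * v $ s ^ (?d - 1))"
  define w where "w = (\<chi> l. if l = s then ws else
     (y $ one_off ?k l - of_nat (?d - 1) * (ws * v $ l * v $ s ^ (?d - 2))) / v $ s ^ (?d - 1))"
  have pat: "polar v w (one_off k l) = y $ one_off k l" for k l
  proof (cases "l = s")
    case True
    have "polar v w (one_off k l) = (\<Sum>q\<in>(UNIV :: 'd set). ws * (\<Prod>m\<in>-{q}. v $ s))"
      unfolding polar_def using True by (simp add: one_off_def w_def)
    also have "\<dots> = of_nat ?d * (ws * v $ s ^ (?d - 1))" by simp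
    also have "\<dots> = y $ (\<lambda>_. s)" using s by (simp add: ws_def)
    finally show ?thesis using True off_s[of k] by simp
  next
    case False
    have "polar v w (one_off k l) = w $ l * (\<Prod>m\<in>-{k}. v $ one_off k l m) + (\<Sum>q\<in>-{k}. w $ one_off k l q * (\<Prod>m\<in>-{q}. v $ one_off k l m))"
      unfolding polar_def using sum.remove[of UNIV k "\<lambda>q. w $ one_off k l q * (\<Prod>m\<in>-{q}. v $ one_off k l m)"]
      by (simp add: one_off_def Compl_eq_Diff_UNIV)
    also have "(\<Prod>m\<in>-{k}. v $ one_off k l m) = (\<Prod>m\<in>-{k}. v $ s)" by (intro prod.cong) (auto simp: one_off_def)
    also have "\<dots> = v $ s ^ (?d - 1)" by simp
    also have "(\<Sum>q\<in>-{k}. w $ one_off k l q * (\<Prod>m\<in>-{q}. v $ one_off k l m)) = (\<Sum>q\<in>-{k}. ws * (v $ l * v $ s ^ (?d - 2)))"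
    proof (rule sum.cong)
      fix q assume q: "q \<in> - {k}"
      have "(\<Prod>m\<in>-{q}. v $ one_off k l m) = v $ l * (\<Prod>m\<in>-{q} - {k}. v $ one_off k l m)"
        using q prod.remove[of "- {q}" k "\<lambda>m. v $ one_off k l m"] by (simp add: one_off_def)
      also have "(\<Prod>m\<in>-{q} - {k}. v $ one_off k l m) = (\<Prod>m\<in>-{q} - {k}. v $ s)"
        by (intro prod.cong) (auto simp: one_off_def)
      also have "\<dots> = v $ s ^ (?d - 2)" using card_compl2[of k q] q by auto
      finally show "w $ one_off k l q * (\<Prod>m\<in>-{q}. v $ one_off k l m) = ws * (v $ l * v $ s ^ (?d - 2))"
        using q by (simp add: one_off_def w_def)
    qed simp
    also have "\<dots> = of_nat (?d - 1) * (ws * v $ l * v $ s ^ (?d - 2))" by simp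
    also have "w $ l * v $ s ^ (?d - 1) = y $ one_off ?k l - of_nat (?d - 1) * (ws * v $ l * v $ s ^ (?d - 2))"
      using False s by (simp add: w_def)
    finally show ?thesis using yat[of k l ?k] by simp
  qed
  define z where "z = y - (\<chi> j. polar v w j)"
  have zat: "z $ one_off k l = 0" for k l by (simp add: z_def pat)
  have swap: "swap_relation (tensor_power v) z"
    unfolding z_def by (intro swap_relation_diff tangent_swap_relation y polar_swap_relation)
  have "z $ i = 0" for i
  proof (induction "card {k. i k \<noteq> s}" arbitrary: i rule: less_induct)
    case less
    show ?case
    proof (cases "\<exists>k. i k \<noteq> s")
      case False
      then have "i = one_off ?k s" by (auto simp: one_off_def fun_eq_iff)
      then show ?thesis using zat by simp
    next
      case True
      then obtain k where k: "i k \<noteq> s" by blast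
      have "{m. (i(k := s)) m \<noteq> s} \<subset> {m. i m \<noteq> s}" using k by auto
      then have "z $ (i(k := s)) = 0" by (intro less psubset_card_mono) auto
      moreover have "z $ (\<lambda>_. s) = 0" using zat[of k s] off_s[of k] by simp
      moreover have "z $ ((\<lambda>_. s)(k := i k)) = 0" using zat[of k "i k"] by (simp add: one_off_def)
      \<comment> \<open>Exchanging slot \<open>k\<close> with the constant index leaves only this
        term: the three other entries of \<open>z\<close> in the relation are 0.\<close>
      ultimately have "z $ i * (tensor_power v :: complex ^ ('d \<Rightarrow> 'n)) $ (\<lambda>_. s) = 0"
        using swap[unfolded swap_relation_def, rule_format, of i "\<lambda>_. s" k] by simp
      then show ?thesis using s by (simp add: tensor_power_def)
    qed
  qed
  then have "y = (\<chi> j. polar v w j)" by (simp add: z_def vec_eq_iff)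
  then show ?thesis ..
qed

lemma contr_tensor_power:
  fixes v :: "'a::comm_ring_1 ^ 'n::finite"
  shows "contr k (tensor_power v :: 'a ^ ('d::finite \<Rightarrow> 'n)) l v = v $ l * bilinear_form v v ^ (CARD('d) - 1)"
proof -
  \<comment> \<open>The condition \<open>j k = l\<close> moves into the factor of slot
    \<open>k\<close>, so that the sum over indices factors into a product over slots.\<close>
  define h where "h m i = (if m = k then (if i = l then v $ i else 0) else v $ i * v $ i)" for m :: 'd and i
  have "contr k (tensor_power v :: 'a ^ ('d \<Rightarrow> 'n)) l v = (\<Sum>j\<in>UNIV. \<Prod>m\<in>UNIV. h m (j m))"
    unfolding contr_def
  proof (rule sum.cong)
    fix j :: "'d \<Rightarrow> 'n"
    have "(\<Prod>m\<in>UNIV. h m (j m)) = h k (j k) * (\<Prod>m\<in>UNIV - {k}. h m (j m))" by (rule prod.remove) auto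
    also have "(\<Prod>m\<in>UNIV - {k}. h m (j m)) = (\<Prod>m\<in>UNIV - {k}. v $ j m * v $ j m)"
      by (intro prod.cong) (auto simp: h_def)
    moreover have "tensor_power v $ j = v $ j k * (\<Prod>m\<in>UNIV - {k}. v $ j m)"
      unfolding tensor_power_def by (simp add: prod.remove[of UNIV k])
    ultimately show "(if j k = l then tensor_power v $ j * (\<Prod>m\<in>-{k}. v $ j m) else 0) = (\<Prod>m\<in>UNIV. h m (j m))"
      by (simp add: h_def Compl_eq_Diff_UNIV prod.distrib mult.assoc)
  qed simp
  also have "\<dots> = (\<Prod>m\<in>UNIV. \<Sum>i\<in>UNIV. h m i)"
    using prod_sum_PiE[of "UNIV :: 'd set" "\<lambda>_. UNIV" h] by simp
  also have "\<dots> = (\<Sum>i\<in>UNIV. h k i) * (\<Prod>m\<in>UNIV - {k}. \<Sum>i\<in>UNIV. h m i)" by (rule prod.remove) auto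
  also have "(\<Prod>m\<in>UNIV - {k}. \<Sum>i\<in>UNIV. h m i) = (\<Prod>m\<in>UNIV - {k}. bilinear_form v v)"
    by (intro prod.cong) (auto simp: h_def bilinear_form_def)
  also have "(\<Sum>i\<in>UNIV. h k i) = v $ l" by (simp add: h_def)
  finally show ?thesis by (simp add: card_Diff_singleton)
qed

lemma contr_diff: "contr k (s - t) l v = contr k s l v - contr k t l v"
  unfolding contr_def sum_subtractf[symmetric] by (intro sum.cong) (auto simp: left_diff_distrib)

lemma contr_scale: "contr (k::'d::finite) t l (c *s v) = c ^ (CARD('d) - 1) * contr k t l v"
  unfolding contr_def sum_distrib_left
  by (intro sum.cong) (auto simp: prod.distrib mult.left_commute)

lemma tensor_power_scale:
  "tensor_power (c *s v) = c ^ CARD('d) *s (tensor_power v :: 'a::comm_ring_1 ^ ('d::finite \<Rightarrow> 'n::finite))"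
  by (simp add: tensor_power_def vec_eq_iff prod.distrib)

lemma bilinear_form_scale: "bilinear_form (c *s v) (c *s v) = c * c * bilinear_form v (v :: 'a::comm_ring_1 ^ 'n::finite)"
  by (simp add: bilinear_form_def sum_distrib_left mult_ac)

lemma complexify_symmetric: "f \<in> symmetric_tensors \<Longrightarrow> complexify f \<in> symmetric_tensors"
  by (simp add: symmetric_tensors_def complexify_def)

lemma critical_tensor_powerI:
  fixes f :: "real ^ ('d::finite \<Rightarrow> 'n::finite)"
  assumes f: "f \<in> symmetric_tensors" and v: "v \<noteq> 0"
    and eq: "\<And>l. contr k (complexify f) l v = v $ l * bilinear_form v v ^ (CARD('d) - 1)"
  shows "tensor_power v \<in> critical_rank_one_tensors f"
  unfolding critical_rank_one_tensors_def
proof (intro CollectI conjI DiffI ballI)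
  let ?x = "tensor_power v :: complex ^ ('d \<Rightarrow> 'n)"
  show "?x \<in> complex_powers" by (simp add: complex_powers_def)
  obtain s where "v $ s \<noteq> 0" using v by (auto simp: vec_eq_iff)
  then have "?x $ (\<lambda>_. s) \<noteq> 0" by (simp add: tensor_power_def)
  then show "?x \<notin> {0}" by auto
  fix y assume "y \<in> tangent_space complex_powers ?x"
  then obtain w where y: "y = (\<chi> j. polar v w j)" using tangent_polar v by blast
  have "complexify f - ?x \<in> symmetric_tensors"
    by (intro symmetric_tensors_diff complexify_symmetric f tensor_power_symmetric)
  then have "bilinear_form (complexify f - ?x) y
      = of_nat CARD('d) * (\<Sum>l\<in>UNIV. w $ l * contr k (complexify f - ?x) l v)"
    unfolding bilinear_form_def y by (simp only: polar_def vec_lambda_beta sum_contr_all)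
  also have "\<dots> = 0" by (simp add: contr_diff eq contr_tensor_power)
  finally show "bilinear_form (complexify f - ?x) y = 0" .
qed

text \<open>Scaling \<open>v\<close> by \<open>c\<close> multiplies the two sides of the critical
  equation by \<open>c ^ (d - 1)\<close> and \<open>c ^ (2 * d - 1)\<close>, so a complex
  \<open>d\<close>-th root of \<open>\<mu> / q ^ (d - 1)\<close>, with \<open>q\<close> for (v|v),
  makes them agree. The root exists and is nonzero because \<open>\<mu>\<close> and \<open>q\<close>
  are.\<close>

lemma eigenvector_power_in_span:
  fixes f :: "real ^ ('d::finite \<Rightarrow> 'n::finite)"
  assumes f: "f \<in> symmetric_tensors"
    and q: "bilinear_form v v \<noteq> 0" and \<mu>: "\<mu> \<noteq> 0"
    and eq: "\<And>l. contr k (complexify f) l v = \<mu> * v $ l"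
  shows "tensor_power v \<in> vec.span (critical_rank_one_tensors f)"
proof -
  let ?d = "CARD('d)" let ?q = "bilinear_form v v"
  obtain c where c: "c \<noteq> 0" "\<mu> / ?q ^ (?d - 1) = c ^ ?d"
    using exists_complex_root_nonzero[of "\<mu> / ?q ^ (?d - 1)" ?d] q \<mu> by auto
  have v: "v \<noteq> 0" using q by (auto simp: bilinear_form_def)
  have \<mu>c: "\<mu> = c ^ ?d * ?q ^ (?d - 1)" using c(2) q by (simp add: field_simps)
  have "tensor_power (c *s v) \<in> critical_rank_one_tensors f"
  proof (rule critical_tensor_powerI[OF f])
    show "c *s v \<noteq> 0" using c(1) v by simp
    fix l
    have "c ^ ?d = c * c ^ (?d - 1)" using zero_less_card_finite[where 'a = 'd] by (metis Suc_diff_1 power_Suc)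
    then show "contr k (complexify f) l (c *s v) = (c *s v) $ l * bilinear_form (c *s v) (c *s v) ^ (?d - 1)"
      unfolding contr_scale eq bilinear_form_scale \<mu>c by (simp add: power_mult_distrib mult_ac)
  qed
  then have "(1 / c ^ ?d) *s tensor_power (c *s v) \<in> vec.span (critical_rank_one_tensors f)"
    by (intro vec.span_scale vec.span_base)
  then show ?thesis using c(1) by (simp add: tensor_power_scale)
qed

section \<open>The span of the critical tensors\<close>

text \<open>Duality for the bilinear rather than the Hermitian form: a separating functional is
  represented by its values at the unit vectors, without conjugation.\<close>

lemma span_separation:
  fixes g :: "complex ^ 'm::finite"
  assumes "g \<notin> vec.span S"
  shows "\<exists>\<phi>. (\<forall>s\<in>S. bilinear_form \<phi> s = 0) \<and> bilinear_form \<phi> g \<noteq> 0"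
proof -
  interpret lf: vector_space_pair "(*s) :: complex \<Rightarrow> complex ^ 'm \<Rightarrow> _" "(*) :: complex \<Rightarrow> complex \<Rightarrow> complex"
    by unfold_locales (auto simp: algebra_simps)
  obtain B where B: "B \<subseteq> S" "vec.independent B" "S \<subseteq> vec.span B"
    using vec.maximal_independent_subset[of S] by blast
  have gB: "g \<notin> vec.span B" using assms vec.span_mono[OF B(1)] by blast
  then have "vec.independent (insert g B)" using B(2) by (rule vec.independent_insertI)
  then obtain h where h: "Vector_Spaces.linear (*s) (*) h"
    "\<forall>b\<in>insert g B. h b = (if b = g then 1 else 0 :: complex)"
    using lf.linear_independent_extend[of "insert g B" "\<lambda>b. if b = g then 1 else 0"] by blast
  define \<phi> where "\<phi> = (\<chi> j. h (axis j 1))"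
  have h\<phi>: "h x = bilinear_form \<phi> x" for x
  proof -
    have "h x = h (\<Sum>j\<in>UNIV. x $ j *s axis j 1)" by (simp add: basis_expansion)
    also have "\<dots> = (\<Sum>j\<in>UNIV. x $ j * h (axis j 1))"
      by (simp add: lf.linear_sum[OF h(1)] lf.linear_scale[OF h(1)])
    finally show ?thesis by (simp add: bilinear_form_def \<phi>_def mult.commute)
  qed
  have "h s = 0" if "s \<in> vec.span B" for s
    using that
  proof (induction rule: vec.span_induct_alt)
    case base
    show ?case by (rule lf.linear_0[OF h(1)])
  next
    case (step c b y)
    have "b \<noteq> g" using step(1) gB vec.span_base by blast
    then show ?case using step h(2) by (simp add: lf.linear_add[OF h(1)] lf.linear_scale[OF h(1)])
  qed
  then show ?thesis using B(3) h(2) by (intro exI[of _ \<phi>]) (auto simp flip: h\<phi>)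
qed

lemma Idl_1_form:
  fixes F :: "'i::finite \<Rightarrow> complex ^ 'n::finite \<Rightarrow> complex"
  assumes "u \<in> Idl F 1"
  shows "\<exists>b A. \<forall>x. u x = (\<Sum>i\<in>UNIV. (b i + (\<Sum>j\<in>UNIV. A i j * x $ j)) * F i x)"
  using assms unfolding Idl_def
proof (induction rule: fn.span_induct_alt)
  case base
  show ?case by (rule exI[of _ "\<lambda>_. 0"], rule exI[of _ "\<lambda>_ _. 0"]) simp
next
  case (step r s q)
  then obtain b A where q: "\<And>x. q x = (\<Sum>i\<in>UNIV. (b i + (\<Sum>j\<in>UNIV. A i j * x $ j)) * F i x)" by auto
  obtain c k where s: "s = mon c * F k" "deg c \<le> 1" using step(1) by auto
  have upd: "(\<Sum>i\<in>UNIV. (if i = k then a else 0) * F i x) = a * F k x" for a x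
    by (simp add: if_distrib[of "\<lambda>a. a * _"] cong: if_cong)
  show ?case
  proof (cases "c = 0")
    case True
    then have sx: "s x = 1 * F k x" for x using s(1) by (simp only: mon_0 times_fun_apply one_fun_apply)
    have "(fscale r s + q) x = (\<Sum>i\<in>UNIV. ((b i + (if i = k then r else 0)) + (\<Sum>j\<in>UNIV. A i j * x $ j)) * F i x)" for x
      using upd[of r x] by (simp add: q sx algebra_simps sum.distrib)
    then show ?thesis by (intro exI allI)
  next
    case False
    then obtain l where "0 < c l" using exp_nonzero by blast
    then obtain c' where c': "c = unit_exp l + c'" using exp_split[of c l] by blast
    then have "deg c' = 0" using s(2) by (simp only: deg_add deg_unit_exp)
    then have "c = unit_exp l" using c' by (simp only: deg_eq_0_iff add_0_right)
    then have sx: "s x = x $ l * F k x" for x using s(1) by (simp add: mon_unit_exp)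
    have "(fscale r s + q) x = (\<Sum>i\<in>UNIV. (b i + (\<Sum>j\<in>UNIV. (A i j + (if i = k \<and> j = l then r else 0)) * x $ j)) * F i x)" for x
    proof -
      have "(\<Sum>j\<in>UNIV. (A i j + (if i = k \<and> j = l then r else 0)) * x $ j)
          = (\<Sum>j\<in>UNIV. A i j * x $ j) + (if i = k then r * x $ l else 0)" for i
        by (simp add: distrib_right sum.distrib if_distrib[of "\<lambda>a. a * _"] cong: if_cong)
      then show ?thesis using upd[of "r * x $ l" x] by (simp add: q sx algebra_simps sum.distrib)
    qed
    then show ?thesis by (intro exI allI)
  qed
qed

text \<open>Comparing the parts of degree \<open>1\<close>, \<open>2\<close> and \<open>d\<close>.\<close>

lemma homogeneous_skew:
  fixes f :: "real ^ ('d::finite \<Rightarrow> 'n::finite)"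
  assumes d: "3 \<le> CARD('d)" and u: "u \<in> Idl (\<lambda>i. eig k0 i f) 1"
    and hom: "\<And>t x. u (t *s x) = t ^ CARD('d) * u x"
  shows "\<exists>A. (\<forall>i j. A i j = - A j i) \<and>
    (\<forall>x. u x = (\<Sum>i\<in>UNIV. \<Sum>j\<in>UNIV. A i j * (x $ j * contr k0 (complexify f) i x)))"
proof -
  let ?d = "CARD('d)" let ?G = "\<lambda>i x. contr k0 (complexify f) i x"
  obtain b A where bA: "\<And>x. u x = (\<Sum>i\<in>UNIV. (b i + (\<Sum>j\<in>UNIV. A i j * x $ j)) * eig k0 i f x)"
    using Idl_1_form[OF u] by blast
  define a where "a i x = (\<Sum>j\<in>UNIV. A i j * x $ j)" for i and x :: "complex ^ 'n"
  have bA': "u x = (\<Sum>i\<in>UNIV. (b i + a i x) * eig k0 i f x)" for x unfolding a_def by (rule bA)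
  have parts: "(\<Sum>i\<in>UNIV. b i * x $ i) = 0 \<and> u x = (\<Sum>i\<in>UNIV. a i x * ?G i x) \<and>
      (?d = 3 \<longrightarrow> (\<Sum>i\<in>UNIV. b i * ?G i x) = (\<Sum>i\<in>UNIV. a i x * x $ i)) \<and>
      (?d \<noteq> 3 \<longrightarrow> (\<Sum>i\<in>UNIV. a i x * x $ i) = 0)" for x
  proof -
    let ?bx = "\<Sum>i\<in>UNIV. b i * x $ i" let ?aG = "\<Sum>i\<in>UNIV. a i x * ?G i x"
    let ?bG = "\<Sum>i\<in>UNIV. b i * ?G i x" let ?ax = "\<Sum>i\<in>UNIV. a i x * x $ i"
    \<comment> \<open>The relation at \<open>t *s x\<close> as a polynomial in \<open>t\<close>. For
      \<open>d = 3\<close> the exponents \<open>d - 1\<close> and 2 coincide, so their coefficients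
      can only be compared together; \<open>b = 0\<close>, read off in degree 1, separates them
      afterwards.\<close>
    let ?P = "monom (u x - ?aG) ?d - monom ?bG (?d - 1) + monom ?ax 2 + monom ?bx 1"
    have dd: "t ^ ?d = t * t ^ (?d - 1)" for t :: complex using d by (metis One_nat_def Suc_pred power_Suc zero_less_card_finite)
    have "poly ?P t = 0" for t
    proof -
      have at: "a i (t *s x) = t * a i x" for i by (simp add: a_def sum_distrib_left mult.left_commute)
      have "t ^ ?d * u x = (\<Sum>i\<in>UNIV. (b i + t * a i x) * (t ^ (?d - 1) * ?G i x - t * x $ i))"
        using bA'[of "t *s x"] by (simp add: hom contr_scale eig_def at)
      also have "\<dots> = (\<Sum>i\<in>UNIV. t ^ ?d * (a i x * ?G i x) + t ^ (?d - 1) * (b i * ?G i x)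
          - t ^ 2 * (a i x * x $ i) - t * (b i * x $ i))"
        unfolding dd by (intro sum.cong) (auto simp: algebra_simps power2_eq_square)
      also have "\<dots> = t ^ ?d * ?aG + t ^ (?d - 1) * ?bG - t ^ 2 * ?ax - t * ?bx"
        by (simp add: sum.distrib sum_subtractf sum_distrib_left)
      finally show ?thesis by (simp add: poly_monom algebra_simps)
    qed
    then have P0: "?P = 0" using poly_all_0_iff_0 by blast
    have c: "coeff ?P n = 0" for n unfolding P0 by simp
    show ?thesis using c[of ?d] c[of 1] c[of 2] d by (auto simp: numeral_3_eq_3 numeral_2_eq_2 split: if_splits)
  qed
  have b0: "b l = 0" for l
  proof -
    have "(\<Sum>i\<in>UNIV. b i * (axis l 1 :: complex ^ 'n) $ i) = 0" using parts by blast
    then show ?thesis by (simp add: axis_def if_distrib[of "\<lambda>a. _ * a"] cong: if_cong)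
  qed
  have ax: "(\<Sum>i\<in>UNIV. a i x * x $ i) = 0" for x
    using parts[of x] by (cases "?d = 3") (auto simp: b0)
  \<comment> \<open>Polarization of the quadratic identity \<open>ax\<close>; at unit vectors it
    becomes skew-symmetry.\<close>
  have q: "(\<Sum>i\<in>UNIV. a i x * y $ i) + (\<Sum>i\<in>UNIV. a i y * x $ i) = 0" for x y
  proof -
    have "0 = (\<Sum>i\<in>UNIV. a i (x + y) * (x + y) $ i)" by (rule ax[symmetric])
    also have "\<dots> = (\<Sum>i\<in>UNIV. a i x * x $ i + a i x * y $ i + a i y * x $ i + a i y * y $ i)"
      by (intro sum.cong) (auto simp: a_def algebra_simps sum.distrib)
    also have "\<dots> = (\<Sum>i\<in>UNIV. a i x * y $ i) + (\<Sum>i\<in>UNIV. a i y * x $ i)"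
      by (simp add: sum.distrib ax)
    finally show ?thesis by simp
  qed
  have "A i j = - A j i" for i j
  proof -
    have a_axis: "a i (axis j 1) = A i j" for i j
      by (simp add: a_def axis_def if_distrib[of "\<lambda>a. _ * a"] cong: if_cong)
    have "(\<Sum>m\<in>UNIV. a m (axis j 1) * (axis i 1 :: complex ^ 'n) $ m) + (\<Sum>m\<in>UNIV. a m (axis i 1) * (axis j 1 :: complex ^ 'n) $ m) = 0"
      by (rule q)
    then have "A i j + A j i = 0"
      unfolding a_axis by (simp add: axis_def if_distrib[of "\<lambda>a. _ * a"] cong: if_cong)
    then show ?thesis by (simp add: eq_neg_iff_add_eq_0)
  qed
  moreover have "u x = (\<Sum>i\<in>UNIV. \<Sum>j\<in>UNIV. A i j * (x $ j * ?G i x))" for x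
    using parts[of x] by (simp add: a_def sum_distrib_right mult.assoc)
  ultimately show ?thesis by blast
qed

text \<open>The second part says that \<open>g\<close> is orthogonal to all infinitesimal rotations
  of \<open>f\<close>. It is expressed through a decomposition of \<open>g\<close> so that it can be
  paired with a form evaluated at the \<open>v m\<close>.\<close>

definition stationary_rep ::
  "'d::finite \<Rightarrow> real ^ ('d \<Rightarrow> 'n::finite) \<Rightarrow> real ^ ('d \<Rightarrow> 'n) \<Rightarrow> nat \<Rightarrow> (nat \<Rightarrow> real) \<Rightarrow> (nat \<Rightarrow> real ^ 'n) \<Rightarrow> bool"
  where
  "stationary_rep k0 f g K c v \<longleftrightarrow> g = (\<Sum>m<K. c m *\<^sub>R tensor_power (v m)) \<and>
    (\<forall>a b. (\<Sum>m<K. c m * (v m $ a * contr k0 f b (v m))) = (\<Sum>m<K. c m * (v m $ b * contr k0 f a (v m))))"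

definition stationary_in_span :: "'d::finite \<Rightarrow> real ^ ('d \<Rightarrow> 'n::finite) \<Rightarrow> bool" where
  "stationary_in_span k0 f \<longleftrightarrow> (\<forall>g K c v. f \<in> symmetric_tensors \<longrightarrow> stationary_rep k0 f g K c v \<longrightarrow>
     complexify g \<in> vec.span (critical_rank_one_tensors f))"

lemma complexify_sum: "complexify (\<Sum>a\<in>A. s a) = (\<Sum>a\<in>A. complexify (s a))"
  by (simp add: complexify_def vec_eq_iff)

lemma complexify_scaleR: "complexify (c *\<^sub>R s) = of_real c *s complexify s"
  by (simp add: complexify_def vec_eq_iff)

lemma complexify_tensor_power: "complexify (tensor_power v) = tensor_power (complexify v)"
  by (simp add: complexify_def tensor_power_def vec_eq_iff)

lemma contr_complexify: "contr k (complexify f) l (complexify v) = of_real (contr k f l v)"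
  by (simp add: contr_def complexify_def if_distrib[of of_real] cong: if_cong)

lemma bilinear_form_complexify_self: "bilinear_form (complexify v) (complexify v) = 0 \<longleftrightarrow> v = 0"
  by (simp add: bilinear_form_complexify)

lemma bilinear_form_sum_scale:
  fixes c :: "nat \<Rightarrow> 'a::comm_ring_1"
  shows "bilinear_form \<phi> (\<Sum>m<K. c m *s t m) = (\<Sum>m<K. c m * bilinear_form \<phi> (t m))"
proof -
  have "bilinear_form \<phi> (\<Sum>m<K. c m *s t m) = (\<Sum>i\<in>UNIV. \<Sum>m<K. c m * (\<phi> $ i * t m $ i))"
    by (simp add: bilinear_form_def sum_distrib_left mult.left_commute)
  also have "\<dots> = (\<Sum>m<K. c m * bilinear_form \<phi> (t m))"
    by (subst sum.swap) (simp add: bilinear_form_def sum_distrib_left)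
  finally show ?thesis .
qed

lemma generic_stationary_in_span_ge_3:
  assumes d: "3 \<le> CARD('d)"
  shows "generic (diag_form :: real ^ ('d::finite \<Rightarrow> 'n::finite))
    (stationary_in_span k0)"
  using generic_eigenvectors[OF d, of k0]
proof (rule generic_mono, unfold stationary_in_span_def, intro allI impI)
  fix f g :: "real ^ ('d \<Rightarrow> 'n)" and K c v
  assume "(\<forall>v. (\<forall>i. eig k0 i f v = 0) \<longrightarrow> v \<noteq> 0 \<longrightarrow> test k0 f v \<noteq> 0) \<and>
      (\<forall>u\<in>Pol CARD('d). (\<forall>v. (\<forall>i. eig k0 i f v = 0) \<longrightarrow> u v = 0) \<longrightarrow> u \<in> Idl (\<lambda>i. eig k0 i f) 1)"
  then have test: "\<And>v. (\<And>i. eig k0 i f v = 0) \<Longrightarrow> v \<noteq> 0 \<Longrightarrow> test k0 f v \<noteq> 0"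
    and van: "\<And>u. u \<in> Pol CARD('d) \<Longrightarrow> (\<And>v. (\<And>i. eig k0 i f v = 0) \<Longrightarrow> u v = 0) \<Longrightarrow> u \<in> Idl (\<lambda>i. eig k0 i f) 1"
    by blast+
  assume f: "f \<in> symmetric_tensors" and "stationary_rep k0 f g K c v"
  then have g: "g = (\<Sum>m<K. c m *\<^sub>R tensor_power (v m))"
    and st: "\<And>a b. (\<Sum>m<K. c m * (v m $ a * contr k0 f b (v m))) = (\<Sum>m<K. c m * (v m $ b * contr k0 f a (v m)))"
    by (auto simp: stationary_rep_def)
  let ?S = "critical_rank_one_tensors f"
  show "complexify g \<in> vec.span ?S"
  proof (rule ccontr)
    assume "complexify g \<notin> vec.span ?S"
    then obtain \<phi> where \<phi>: "\<forall>s\<in>?S. bilinear_form \<phi> s = 0" "bilinear_form \<phi> (complexify g) \<noteq> 0"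
      using span_separation by blast
    \<comment> \<open>Restricted to powers, the separating functional is a form of degree
      \<open>d\<close>; it vanishes at all eigenvectors because their powers lie in the
      span.\<close>
    define u where "u x = bilinear_form \<phi> (tensor_power x)" for x
    have uS: "bilinear_form \<phi> s = 0" if "s \<in> vec.span ?S" for s
      using that \<phi>(1)
      by (induction rule: vec.span_induct_alt) (auto simp: bilinear_form_def algebra_simps sum.distrib simp flip: sum_distrib_left)
    have "u = (\<lambda>x. \<Sum>j\<in>UNIV. \<phi> $ j * (\<Prod>k\<in>UNIV. x $ j k))"
      by (simp add: fun_eq_iff u_def bilinear_form_def tensor_power_def)
    also have "\<dots> \<in> Pol (0 + CARD('d))"
      by (intro Pol_sum Pol_times Pol_const Pol_prod_coord) auto
    finally have "u \<in> Pol CARD('d)" by simp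
    moreover have "u x = 0" if z: "\<And>i. eig k0 i f x = 0" for x
    proof (cases "x = 0")
      case True
      then show ?thesis using d by (simp add: u_def bilinear_form_def tensor_power_def power_0_left)
    next
      case False
      have "tensor_power x \<in> vec.span ?S"
      proof (rule eigenvector_power_in_span[OF f, of x 1 k0])
        show "bilinear_form x x \<noteq> 0" using test[OF z False] by (auto simp: test_def bilinear_form_def)
        show "contr k0 (complexify f) l x = 1 * x $ l" for l using z[of l] by (simp add: eig_def)
      qed simp
      then show ?thesis unfolding u_def by (rule uS)
    qed
    ultimately have "u \<in> Idl (\<lambda>i. eig k0 i f) 1" by (rule van)
    moreover have "u (t *s x) = t ^ CARD('d) * u x" for t x
      by (simp add: u_def tensor_power_scale bilinear_form_def sum_distrib_left mult.left_commute)
    ultimately obtain A where skew: "\<And>i j. A i j = - A j i"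
      and uA: "\<And>x. u x = (\<Sum>i\<in>UNIV. \<Sum>j\<in>UNIV. A i j * (x $ j * contr k0 (complexify f) i x))"
      using homogeneous_skew[OF d, of u k0 f] by blast
    define X where "X i j = (\<Sum>m<K. c m * (v m $ j * contr k0 f i (v m)))" for i j
    have X: "X i j = X j i" for i j unfolding X_def by (rule st)
    have "complexify g = (\<Sum>m<K. of_real (c m) *s tensor_power (complexify (v m)))"
      by (simp add: g complexify_sum complexify_scaleR complexify_tensor_power)
    then have "bilinear_form \<phi> (complexify g) = (\<Sum>m<K. of_real (c m) * u (complexify (v m)))"
      by (simp add: bilinear_form_sum_scale u_def)
    also have "\<dots> = (\<Sum>m<K. \<Sum>i\<in>UNIV. \<Sum>j\<in>UNIV. A i j * of_real (c m * (v m $ j * contr k0 f i (v m))))"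
      unfolding uA contr_complexify sum_distrib_left
      by (intro sum.cong) (auto simp: complexify_def)
    also have "\<dots> = (\<Sum>i\<in>UNIV. \<Sum>j\<in>UNIV. A i j * of_real (X i j))"
      unfolding X_def of_real_sum sum_distrib_left
      by (subst sum.swap, intro sum.cong refl, rule sum.swap)
    \<comment> \<open>Skew-symmetric \<open>A\<close> against symmetric \<open>X\<close>:
      interchanging the indices turns the sum into its negative.\<close>
    also have "\<dots> = 0"
    proof -
      have "(\<Sum>i\<in>UNIV. \<Sum>j\<in>UNIV. A i j * of_real (X i j)) = (\<Sum>i\<in>UNIV. \<Sum>j\<in>UNIV. A j i * of_real (X j i))"
        by (rule sum.swap)
      also have "\<dots> = (\<Sum>i\<in>UNIV. \<Sum>j\<in>UNIV. - (A i j * of_real (X i j)))"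
      proof (intro sum.cong refl)
        fix i j
        show "A j i * complex_of_real (X j i) = - (A i j * complex_of_real (X i j))"
          using skew[of j i] X[of j i] by simp
      qed
      also have "\<dots> = - (\<Sum>i\<in>UNIV. \<Sum>j\<in>UNIV. A i j * of_real (X i j))" by (simp add: sum_negf)
      finally show ?thesis by simp
    qed
    finally show False using \<phi>(2) by blast
  qed
qed

section \<open>Order two: commuting symmetric matrices\<close>

lemma symmetric_eigenvector:
  fixes A :: "real ^ 'n::finite \<Rightarrow> real ^ 'n"
  assumes lin: "linear A" and sym: "\<And>x y. A x \<bullet> y = x \<bullet> A y"
    and S: "subspace S" "\<And>x. x \<in> S \<Longrightarrow> A x \<in> S" and ne: "S \<noteq> {0}"
  shows "\<exists>v\<in>S. norm v = 1 \<and> (\<exists>r. A v = r *\<^sub>R v)"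
proof -
  let ?U = "S \<inter> sphere 0 1"
  obtain x where x: "x \<in> S" "x \<noteq> 0" using ne subspace_0[OF S(1)] by blast
  have "(1 / norm x) *\<^sub>R x \<in> ?U" using x S(1) by (simp add: subspace_scale)
  then have "?U \<noteq> {}" by blast
  moreover have "compact ?U" using closed_subspace[OF S(1)] by (intro closed_Int_compact) auto
  moreover have "continuous_on ?U (\<lambda>v. v \<bullet> A v)"
    using lin by (intro continuous_on_inner continuous_on_id linear_continuous_on) (simp add: linear_conv_bounded_linear)
  ultimately obtain v where v: "v \<in> ?U" and max: "\<And>w. w \<in> ?U \<Longrightarrow> w \<bullet> A w \<le> v \<bullet> A v"
    using continuous_attains_sup[of ?U "\<lambda>v. v \<bullet> A v"] by blast
  define r where "r = v \<bullet> A v"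
  have vv: "v \<bullet> v = 1" using v by (simp add: dot_square_norm)
  have le: "w \<bullet> A w \<le> r * (w \<bullet> w)" if "w \<in> S" for w
  proof (cases "w = 0")
    case False
    have "(1 / norm w) *\<^sub>R w \<in> ?U" using False that S(1) by (simp add: subspace_scale)
    then have "((1 / norm w) *\<^sub>R w) \<bullet> A ((1 / norm w) *\<^sub>R w) \<le> r" unfolding r_def by (rule max)
    then have "(w \<bullet> A w) / (norm w * norm w) \<le> r" by (simp add: linear_scale[OF lin])
    then show ?thesis using False by (simp add: dot_square_norm power2_eq_square pos_divide_le_eq)
  qed (simp add: linear_0[OF lin])
  \<comment> \<open>\<open>v\<close> maximizes the quadratic form of \<open>A\<close> on the unit
    vectors of \<open>S\<close>, so moving it in an orthogonal direction \<open>w\<close> produces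
    no linear term.\<close>
  have orth: "w \<bullet> A v = 0" if w: "w \<in> S" "w \<bullet> v = 0" for w
  proof -
    let ?b = "w \<bullet> A v" let ?c = "r * (w \<bullet> w) - w \<bullet> A w"
    have q: "2 * t * ?b \<le> t\<^sup>2 * ?c" for t
    proof -
      have "v + t *\<^sub>R w \<in> S" using v w S(1) by (simp add: subspace_add subspace_scale)
      then have "(v + t *\<^sub>R w) \<bullet> A (v + t *\<^sub>R w) \<le> r * ((v + t *\<^sub>R w) \<bullet> (v + t *\<^sub>R w))" by (rule le)
      moreover have "v \<bullet> A w = ?b" using sym[of v w] by (simp add: inner_commute)
      moreover have "v \<bullet> w = 0" using w(2) by (simp add: inner_commute)
      ultimately show ?thesis
        using w(2) vv by (simp add: linear_add[OF lin] linear_scale[OF lin] inner_add_left inner_add_right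
          r_def[symmetric] algebra_simps power2_eq_square)
    qed
    show ?thesis
    proof (rule ccontr)
      assume b: "?b \<noteq> 0"
      define s where "s = \<bar>?c\<bar> + 1"
      have s: "0 < s" "?c < s" by (auto simp: s_def)
      have "2 * (?b / s) * ?b \<le> (?b / s)\<^sup>2 * ?c" by (rule q)
      also have "\<dots> \<le> (?b / s)\<^sup>2 * s" using s by (intro mult_left_mono) auto
      also have "\<dots> = ?b\<^sup>2 / s" using s by (simp add: power2_eq_square)
      finally have "2 * (?b\<^sup>2 / s) \<le> ?b\<^sup>2 / s" by (simp add: power2_eq_square)
      moreover have "0 < ?b\<^sup>2 / s" using b s by simp
      ultimately show False by simp
    qed
  qed
  define z where "z = A v - r *\<^sub>R v"
  have zS: "z \<in> S" unfolding z_def using v S by (simp add: subspace_diff subspace_scale)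
  have zv: "z \<bullet> v = 0" by (simp add: z_def inner_diff_left vv r_def inner_commute[of "A v"])
  have "z \<bullet> z = 0" using orth[OF zS zv] zv by (subst (2) z_def) (simp add: inner_diff_right)
  then have "A v = r *\<^sub>R v" by (simp add: z_def)
  then show ?thesis using v by auto
qed

text \<open>As the maps commute, \<open>B\<close> preserves an eigenspace \<open>V\<close> of
  \<open>A\<close> and has an eigenvector \<open>w\<close> in it. Both maps preserve the orthogonal
  complement of \<open>w\<close> in \<open>S\<close>, where induction on the dimension
  applies.\<close>

lemma joint_orthonormal_eigenbasis:
  fixes A B :: "real ^ 'n::finite \<Rightarrow> real ^ 'n"
  assumes A: "linear A" "\<And>x y. A x \<bullet> y = x \<bullet> A y" and B: "linear B" "\<And>x y. B x \<bullet> y = x \<bullet> B y"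
    and comm: "\<And>x. A (B x) = B (A x)"
    and S: "subspace S" "\<And>x. x \<in> S \<Longrightarrow> A x \<in> S" "\<And>x. x \<in> S \<Longrightarrow> B x \<in> S"
  shows "\<exists>E. finite E \<and> E \<subseteq> S \<and> pairwise orthogonal E \<and> S \<subseteq> span E \<and>
    (\<forall>q\<in>E. norm q = 1 \<and> (\<exists>r. A q = r *\<^sub>R q) \<and> (\<exists>r. B q = r *\<^sub>R q))"
  using S
proof (induction "dim S" arbitrary: S rule: less_induct)
  case less
  show ?case
  proof (cases "S = {0}")
    case True
    then show ?thesis by (intro exI[of _ "{}"]) auto
  next
    case False
    then obtain v r where v: "v \<in> S" "norm v = 1" "A v = r *\<^sub>R v"
      using symmetric_eigenvector[OF A less.prems(1,2)] by blast
    define V where "V = {x \<in> S. A x = r *\<^sub>R x}"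
    have subV: "subspace V"
      unfolding V_def using less.prems(1)
      by (auto simp: subspace_def linear_0[OF A(1)] linear_add[OF A(1)] linear_scale[OF A(1)] algebra_simps)
    have BV: "B x \<in> V" if "x \<in> V" for x
      using that less.prems(3) by (auto simp: V_def comm linear_scale[OF B(1)])
    have "v \<in> V" "v \<noteq> 0" using v by (simp add: V_def, auto)
    then have "V \<noteq> {0}" by blast
    then obtain w where w: "w \<in> V" "norm w = 1" "\<exists>r. B w = r *\<^sub>R w"
      using symmetric_eigenvector[OF B subV BV] by blast
    then obtain s where s: "B w = s *\<^sub>R w" by blast
    have wS: "w \<in> S" and Aw: "A w = r *\<^sub>R w" using w(1) by (auto simp: V_def)
    define S' where "S' = {x \<in> S. w \<bullet> x = 0}"
    have sub: "subspace S'"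
      unfolding S'_def using less.prems(1) by (auto simp: subspace_def inner_add_right)
    have "w \<notin> S'" using w(2) by (auto simp: S'_def)
    moreover have "S' \<subseteq> S" by (auto simp: S'_def)
    ultimately have "S' \<subset> S" using wS by blast
    then have "dim S' < dim S"
      using sub less.prems(1) by (intro dim_psubset) (simp add: span_eq_iff[THEN iffD2])
    moreover have "A x \<in> S'" if "x \<in> S'" for x
      using that less.prems(2) A(2)[of w x] by (simp add: S'_def Aw)
    moreover have "B x \<in> S'" if "x \<in> S'" for x
      using that less.prems(3) B(2)[of w x] by (simp add: S'_def s)
    ultimately obtain E where E: "finite E" "E \<subseteq> S'" "pairwise orthogonal E" "S' \<subseteq> span E"
      "\<forall>q\<in>E. norm q = 1 \<and> (\<exists>r. A q = r *\<^sub>R q) \<and> (\<exists>r. B q = r *\<^sub>R q)"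
      using less.hyps[OF _ sub] by blast
    have "S \<subseteq> span (insert w E)"
    proof
      fix x assume x: "x \<in> S"
      have "w \<bullet> w = 1" using w(2) by (simp add: dot_square_norm)
      then have "x - (w \<bullet> x) *\<^sub>R w \<in> S'"
        using x wS less.prems(1) by (simp add: S'_def subspace_diff subspace_scale inner_diff_right)
      then have "x - (w \<bullet> x) *\<^sub>R w \<in> span (insert w E)" using E(4) span_mono[of E "insert w E"] by blast
      then have "(x - (w \<bullet> x) *\<^sub>R w) + (w \<bullet> x) *\<^sub>R w \<in> span (insert w E)"
        by (rule span_add[OF _ span_scale[OF span_base]]) simp
      then show "x \<in> span (insert w E)" by simp
    qed
    moreover have "pairwise orthogonal (insert w E)"
      using E(2,3) by (auto simp: pairwise_insert orthogonal_def S'_def inner_commute)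
    moreover have "insert w E \<subseteq> S" using E(2) wS by (auto simp: S'_def)
    ultimately show ?thesis using E(1,5) w(2) Aw s by (intro exI[of _ "insert w E"]) auto
  qed
qed

lemma det_polynomial:
  fixes G :: "'f::real_normed_vector \<Rightarrow> real ^ 'n::finite ^ 'n"
  assumes "\<And>i j. real_polynomial_function (\<lambda>f. G f $ i $ j)"
  shows "real_polynomial_function (\<lambda>f. det (G f))"
  unfolding det_def
  by (intro real_polynomial_function_sum real_polynomial_function.intros(4)
      real_polynomial_function_prod real_polynomial_function.intros(2) assms) auto

definition pair_index :: "'d \<Rightarrow> 'n \<Rightarrow> 'n \<Rightarrow> 'd \<Rightarrow> 'n" where
  "pair_index k0 l m = (\<lambda>k. if k = k0 then l else m)"

definition matrix_of :: "'d::finite \<Rightarrow> real ^ ('d \<Rightarrow> 'n::finite) \<Rightarrow> real ^ 'n ^ 'n" where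
  "matrix_of k0 f = (\<chi> l m. f $ pair_index k0 l m)"

text \<open>Stationarity says that the product of the two symmetric matrices is symmetric, that is,
  that they commute. The joint eigenbasis writes \<open>g\<close> through powers of real
  eigenvectors of \<open>f\<close>; these are not isotropic, and an invertible matrix of
  \<open>f\<close> has no eigenvalue 0, so each can be rescaled to a critical power.\<close>

lemma generic_stationary_in_span_2:
  assumes d: "CARD('d) = 2"
  shows "generic (diag_form :: real ^ ('d::finite \<Rightarrow> 'n::finite))
    (stationary_in_span k0)"
proof -
  obtain k1 where k1: "k1 \<noteq> k0" "(UNIV :: 'd set) = {k0, k1}"
  proof -
    obtain a b where "(UNIV :: 'd set) = {a, b}" "a \<noteq> b" using d unfolding card_2_iff by auto
    then show ?thesis using that by (cases "k0 = a") (auto, metis UNIV_I insertE insert_commute singletonD)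
  qed
  have compl: "- {k0} = {k1}" using k1 by auto
  have k0': "k0 \<noteq> k1" using k1(1) by simp
  have idx: "pair_index k0 (j k0) (j k1) = j" for j :: "'d \<Rightarrow> 'n"
  proof
    fix k show "pair_index k0 (j k0) (j k1) k = j k"
      using k1 UNIV_I[of k] unfolding k1(2) by (auto simp: pair_index_def)
  qed
  have prod2: "(\<Prod>k\<in>(UNIV :: 'd set). h k) = h k0 * h k1" for h :: "'d \<Rightarrow> real"
    unfolding k1(2) using k0' by simp
  have contr2: "contr k0 t l v = (matrix_of k0 t *v v) $ l" for t :: "real ^ ('d \<Rightarrow> 'n)" and l v
  proof -
    have "contr k0 t l v = (\<Sum>j\<in>{j. j k0 = l}. t $ j * v $ j k1)"
      by (simp add: contr_def compl sum.If_cases)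
    also have "\<dots> = (\<Sum>m\<in>UNIV. t $ pair_index k0 l m * v $ m)"
    proof (rule sum.reindex_bij_witness[of _ "\<lambda>m. pair_index k0 l m" "\<lambda>j. j k1"])
      show "pair_index k0 l (j k1) = j" if "j \<in> {j. j k0 = l}" for j
        using idx[of j] that by simp
      then show "t $ pair_index k0 l (j k1) * v $ j k1 = t $ j * v $ j k1" if "j \<in> {j. j k0 = l}" for j
        using that by simp
    qed (auto simp: pair_index_def k1(1))
    finally show ?thesis by (simp add: matrix_of_def matrix_vector_mult_def)
  qed
  have sym: "matrix_of k0 t $ l $ m = matrix_of k0 t $ m $ l" if "t \<in> symmetric_tensors"
    for t :: "real ^ ('d \<Rightarrow> 'n)" and l m
  proof -
    define p where "p k = (if k = k0 then k1 else if k = k1 then k0 else k)" for k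
    have "p (p k) = k" for k by (simp add: p_def)
    then have "bij p" by (intro o_bij[of p p]) (auto simp: fun_eq_iff)
    then have "t $ (pair_index k0 l m \<circ> p) = t $ pair_index k0 l m"
      using that by (simp add: symmetric_tensors_def)
    moreover have "pair_index k0 l m \<circ> p = pair_index k0 m l"
    proof
      fix k show "(pair_index k0 l m \<circ> p) k = pair_index k0 m l k"
        using UNIV_I[of k] k0' unfolding k1(2) by (auto simp: pair_index_def p_def)
    qed
    ultimately show ?thesis by (simp add: matrix_of_def)
  qed
  have selfadj: "(matrix_of k0 t *v x) \<bullet> y = x \<bullet> (matrix_of k0 t *v y)" if "t \<in> symmetric_tensors"
    for t :: "real ^ ('d \<Rightarrow> 'n)" and x y
  proof -
    have "transpose (matrix_of k0 t) = matrix_of k0 t"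
      using sym[OF that] by (simp add: transpose_def vec_eq_iff)
    then show ?thesis by (metis dot_lmul_matrix transpose_matrix_vector)
  qed
  have "generic (diag_form :: real ^ ('d \<Rightarrow> 'n)) (\<lambda>f. det (matrix_of k0 f) \<noteq> 0)"
    unfolding generic_def
  proof (intro exI[of _ "\<lambda>f. det (matrix_of k0 f)"] conjI)
    show "real_polynomial_function (\<lambda>f :: real ^ ('d \<Rightarrow> 'n). det (matrix_of k0 f))"
      by (rule det_polynomial) (simp add: matrix_of_def real_polynomial_function_nth)
    \<comment> \<open>For \<open>d = 2\<close> the exponent in \<open>weight\<close> is 0, so all
      weights are 1.\<close>
    have "matrix_of k0 (diag_form :: real ^ ('d \<Rightarrow> 'n)) = mat 1"
    proof -
      have "(\<exists>i. pair_index k0 l m = (\<lambda>_. i)) \<longleftrightarrow> l = m" for l m :: 'n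
        using k1(1) by (auto simp: pair_index_def fun_eq_iff split: if_splits)
      then show ?thesis using d by (simp add: matrix_of_def mat_def vec_eq_iff diag_form_nth weight_def)
    qed
    then show "det (matrix_of k0 (diag_form :: real ^ ('d \<Rightarrow> 'n))) \<noteq> 0" by simp
  qed simp
  then show ?thesis
  proof (rule generic_mono, unfold stationary_in_span_def, intro allI impI)
    fix f g :: "real ^ ('d \<Rightarrow> 'n)" and K c v
    assume det: "det (matrix_of k0 f) \<noteq> 0" and f: "f \<in> symmetric_tensors"
      and rep: "stationary_rep k0 f g K c v"
    let ?F = "matrix_of k0 f" let ?G = "matrix_of k0 g"
    have g: "g = (\<Sum>m<K. c m *\<^sub>R tensor_power (v m))"
      and st: "\<And>a b. (\<Sum>m<K. c m * (v m $ a * contr k0 f b (v m))) = (\<Sum>m<K. c m * (v m $ b * contr k0 f a (v m)))"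
      using rep by (auto simp: stationary_rep_def)
    have gsym: "g \<in> symmetric_tensors"
      unfolding g by (intro symmetric_tensors_sum symmetric_tensors_scaleR tensor_power_symmetric)
    have Gab: "?G $ a $ b = (\<Sum>m<K. c m * (v m $ a * v m $ b))" for a b
      using k1(1) by (simp add: matrix_of_def g tensor_power_def prod2 pair_index_def)
    have FG: "(?F ** ?G) $ b $ a = (\<Sum>m<K. c m * (v m $ a * contr k0 f b (v m)))" for a b
    proof -
      have "(?F ** ?G) $ b $ a = (\<Sum>r\<in>UNIV. \<Sum>m<K. ?F $ b $ r * (c m * (v m $ r * v m $ a)))"
        by (simp add: matrix_matrix_mult_def Gab sum_distrib_left)
      also have "\<dots> = (\<Sum>m<K. \<Sum>r\<in>UNIV. ?F $ b $ r * (c m * (v m $ r * v m $ a)))" by (rule sum.swap)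
      also have "\<dots> = (\<Sum>m<K. c m * (v m $ a * contr k0 f b (v m)))"
        unfolding contr2 by (simp add: matrix_vector_mult_def sum_distrib_left mult_ac)
      finally show ?thesis .
    qed
    have comm: "?F ** ?G = ?G ** ?F"
    proof -
      have "(?F ** ?G) $ a $ b = (?G ** ?F) $ a $ b" for a b
      proof -
        have "(?F ** ?G) $ a $ b = (?F ** ?G) $ b $ a" using st FG by metis
        also have "\<dots> = (?G ** ?F) $ a $ b"
          unfolding matrix_matrix_mult_def
          using sym[OF f] sym[OF gsym] by (simp add: mult.commute)
        finally show ?thesis .
      qed
      then show ?thesis by (simp add: vec_eq_iff)
    qed
    have "\<exists>E. finite E \<and> E \<subseteq> UNIV \<and> pairwise orthogonal E \<and> UNIV \<subseteq> span E \<and>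
      (\<forall>q\<in>E. norm q = 1 \<and> (\<exists>r. ?F *v q = r *\<^sub>R q) \<and> (\<exists>r. ?G *v q = r *\<^sub>R q))"
      by (rule joint_orthonormal_eigenbasis)
        (auto simp: selfadj f gsym matrix_vector_mul_assoc comm)
    then obtain E where E: "finite E" "pairwise orthogonal E" "UNIV \<subseteq> span E"
      "\<And>q. q \<in> E \<Longrightarrow> norm q = 1" "\<And>q. q \<in> E \<Longrightarrow> \<exists>r. ?F *v q = r *\<^sub>R q" "\<And>q. q \<in> E \<Longrightarrow> \<exists>r. ?G *v q = r *\<^sub>R q"
      by blast
    have "\<forall>q. \<exists>r. q \<in> E \<longrightarrow> ?G *v q = r *\<^sub>R q" using E(6) by blast
    from choice[OF this] obtain \<mu> where \<mu>: "\<And>q. q \<in> E \<Longrightarrow> ?G *v q = \<mu> q *\<^sub>R q" by blast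
    have "g = (\<Sum>q\<in>E. \<mu> q *\<^sub>R tensor_power q)"
    proof -
      have "g $ j = (\<Sum>q\<in>E. \<mu> q *\<^sub>R tensor_power q) $ j" for j
      proof -
        have "?G *v axis (j k1) 1 = ?G *v (\<Sum>q\<in>E. (axis (j k1) 1 \<bullet> q) *\<^sub>R q)"
          using E by (subst orthonormal_basis_expand) auto
        also have "\<dots> = (\<Sum>q\<in>E. (axis (j k1) 1 \<bullet> q) *\<^sub>R (\<mu> q *\<^sub>R q))"
          by (simp add: linear_sum[OF matrix_vector_mul_linear] linear_scale[OF matrix_vector_mul_linear] \<mu>)
        finally have "(?G *v axis (j k1) 1) $ j k0 = (\<Sum>q\<in>E. \<mu> q * (q $ j k0 * q $ j k1))"
          by (simp add: inner_axis' mult_ac)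
        moreover have "(?G *v axis (j k1) 1) $ j k0 = g $ j"
          by (simp add: matrix_vector_mul_component inner_axis matrix_of_def idx)
        ultimately show ?thesis by (simp add: tensor_power_def prod2)
      qed
      then show ?thesis by (simp add: vec_eq_iff)
    qed
    then have "complexify g = (\<Sum>q\<in>E. of_real (\<mu> q) *s tensor_power (complexify q))"
      by (simp add: complexify_sum complexify_scaleR complexify_tensor_power)
    also have "\<dots> \<in> vec.span (critical_rank_one_tensors f)"
    proof (intro vec.span_sum vec.span_scale)
      fix q assume q: "q \<in> E"
      obtain r where r: "?F *v q = r *\<^sub>R q" using E(5)[OF q] by blast
      have q0: "q \<noteq> 0" using E(4)[OF q] by auto
      have r0: "r \<noteq> 0"
      proof
        assume "r = 0"
        then have "?F *v q = 0" using r by simp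
        moreover have "invertible ?F" using det by (simp add: invertible_det_nz)
        then obtain F' where "F' ** ?F = mat 1" by (auto simp: invertible_def)
        ultimately have "q = 0" by (metis matrix_vector_mul_assoc matrix_vector_mul_lid matrix_vector_mult_0_right)
        then show False using q0 by simp
      qed
      show "tensor_power (complexify q) \<in> vec.span (critical_rank_one_tensors f)"
      proof (rule eigenvector_power_in_span[OF f, of _ "of_real r" k0])
        show "bilinear_form (complexify q) (complexify q) \<noteq> 0" using q0 by (simp add: bilinear_form_complexify_self)
        show "contr k0 (complexify f) l (complexify q) = of_real r * complexify q $ l" for l
          unfolding contr_complexify contr2 r by (simp add: complexify_def)
      qed (use r0 in simp)
    qed
    finally show "complexify g \<in> vec.span (critical_rank_one_tensors f)" .
  qed
qed

section \<open>Order one: proportional vectors\<close>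

lemma generic_stationary_in_span_1:
  assumes d: "CARD('d) = 1"
  shows "generic (diag_form :: real ^ ('d::finite \<Rightarrow> 'n::finite))
    (stationary_in_span k0)"
proof -
  have U: "(UNIV :: 'd set) = {k0}" using d by (metis UNIV_I card_1_singletonE singletonD)
  then have compl: "- {k0} = {}" by auto
  have const: "(\<lambda>_. j k0) = j" for j :: "'d \<Rightarrow> 'n"
  proof
    fix k show "j k0 = j k" using U UNIV_I[of k] by auto
  qed
  have contr1: "contr k0 t l x = t $ (\<lambda>_. l)" for t :: "'x::comm_ring_1 ^ ('d \<Rightarrow> 'n)" and l x
  proof -
    have "{j :: 'd \<Rightarrow> 'n. j k0 = l} = {\<lambda>_. l}" using const by force
    then show ?thesis by (simp add: contr_def compl sum.If_cases)
  qed
  have "generic (diag_form :: real ^ ('d \<Rightarrow> 'n)) (\<lambda>f. f \<noteq> 0)"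
    unfolding generic_def
  proof (intro exI[of _ "\<lambda>f :: real ^ ('d \<Rightarrow> 'n). f $ (\<lambda>_. undefined)"] conjI)
    show "real_polynomial_function (\<lambda>f :: real ^ ('d \<Rightarrow> 'n). f $ (\<lambda>_. undefined))" by (rule real_polynomial_function_nth)
    show "(diag_form :: real ^ ('d \<Rightarrow> 'n)) $ (\<lambda>_. undefined) \<noteq> 0" by (simp add: diag_form_const weight_def)
  qed auto
  then show ?thesis
  proof (rule generic_mono, unfold stationary_in_span_def, intro allI impI)
    fix f g :: "real ^ ('d \<Rightarrow> 'n)" and K c v
    assume f0: "f \<noteq> 0" and f: "f \<in> symmetric_tensors" and rep: "stationary_rep k0 f g K c v"
    have g: "g = (\<Sum>m<K. c m *\<^sub>R tensor_power (v m))"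
      and st: "\<And>a b. (\<Sum>m<K. c m * (v m $ a * contr k0 f b (v m))) = (\<Sum>m<K. c m * (v m $ b * contr k0 f a (v m)))"
      using rep by (auto simp: stationary_rep_def)
    define w where "w = (\<chi> l. f $ (\<lambda>_. l))"
    have power: "tensor_power x $ j = x $ j k0" for x :: "real ^ 'n" and j :: "'d \<Rightarrow> 'n"
      by (simp add: tensor_power_def U)
    have fw: "f = tensor_power w" by (simp add: vec_eq_iff power w_def const)
    have ga: "g $ (\<lambda>_. a) = (\<Sum>m<K. c m * v m $ a)" for a by (simp add: g power)
    \<comment> \<open>With a single slot, contraction returns the entries of \<open>f\<close>
      whatever the vectors are, so stationarity becomes the vanishing of the two-by-two minors of
      \<open>g\<close> and \<open>f\<close>.\<close>
    have st': "g $ (\<lambda>_. a) * f $ (\<lambda>_. b) = g $ (\<lambda>_. b) * f $ (\<lambda>_. a)" for a b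
      using st[of a b] by (simp add: contr1 ga sum_distrib_right mult.assoc)
    have w0: "w \<noteq> 0"
    proof
      assume "w = 0"
      then have "f = 0" unfolding fw by (simp add: vec_eq_iff power)
      then show False using f0 by simp
    qed
    then obtain b where b: "w $ b \<noteq> 0" by (auto simp: vec_eq_iff)
    define r where "r = g $ (\<lambda>_. b) / w $ b"
    have "g $ j = r * f $ j" for j
      using st'[of "j k0" b] b by (simp add: const w_def r_def field_simps)
    then have "g = r *\<^sub>R f" by (simp add: vec_eq_iff)
    then have "complexify g = of_real r *s tensor_power (complexify w)"
      by (simp only: complexify_scaleR complexify_tensor_power[symmetric] fw[symmetric])
    also have "\<dots> \<in> vec.span (critical_rank_one_tensors f)"
    proof (intro vec.span_scale eigenvector_power_in_span[OF f, of _ 1 k0])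
      show "bilinear_form (complexify w) (complexify w) \<noteq> 0" using w0 by (simp add: bilinear_form_complexify_self)
      show "contr k0 (complexify f) l (complexify w) = 1 * complexify w $ l" for l
        by (simp add: contr1) (simp add: complexify_def w_def)
    qed simp
    finally show "complexify g \<in> vec.span (critical_rank_one_tensors f)" .
  qed
qed

section \<open>The exceptional set and the conclusion\<close>

lemma generic_stationary_in_span:
  "generic (diag_form :: real ^ ('d::finite \<Rightarrow> 'n::finite))
    (stationary_in_span k0)"
proof -
  have "0 < CARD('d)" by simp
  then consider "CARD('d) = 1" | "CARD('d) = 2" | "3 \<le> CARD('d)" by linarith
  then show ?thesis
  proof cases
    case 1
    then show ?thesis by (rule generic_stationary_in_span_1)
  next
    case 2
    then show ?thesis by (rule generic_stationary_in_span_2)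
  next
    case 3
    then show ?thesis by (rule generic_stationary_in_span_ge_3)
  qed
qed

theorem corollary1p3:
  shows "\<exists>Z :: (real ^ ('d::finite \<Rightarrow> 'n::finite)) set.
    real_algebraic_subset_of symmetric_tensors Z \<and> Z \<noteq> symmetric_tensors \<and>
    (\<forall>f \<in> symmetric_tensors - Z.
      (\<forall>k g. is_arg_min (\<lambda>h. norm (f - h))
                (\<lambda>h. h \<in> symmetric_tensors \<and> real_symmetric_rank h \<le> k) g
          \<longrightarrow> complexify g \<in> vec.span (critical_rank_one_tensors f)) \<and>
      complexify f \<in> vec.span (critical_rank_one_tensors f))"
proof -
  \<comment> \<open>Any slot serves, as contractions of a symmetric tensor do not depend on
    it.\<close>
  let ?k0 = "undefined :: 'd"
  have "generic (diag_form :: real ^ ('d \<Rightarrow> 'n)) (stationary_in_span ?k0)"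
    by (rule generic_stationary_in_span)
  then obtain P where P: "real_polynomial_function P" "P (diag_form :: real ^ ('d \<Rightarrow> 'n)) \<noteq> 0"
    and gen: "\<forall>f. P f \<noteq> 0 \<longrightarrow> stationary_in_span ?k0 f"
    unfolding generic_def by (elim exE conjE) (rule that)
  \<comment> \<open>\<open>Z\<close> is proper because the diagonal form is symmetric and
    \<open>P\<close> is nonzero there.\<close>
  define Z where "Z = {t \<in> symmetric_tensors. \<forall>p\<in>{P}. p t = 0}"
  have "real_algebraic_subset_of symmetric_tensors Z"
    unfolding real_algebraic_subset_of_def Z_def using P(1) by (intro exI[of _ "{P}"]) simp
  moreover have "Z \<noteq> symmetric_tensors" using P(2) diag_form_symmetric by (auto simp: Z_def)
  moreover have best: "complexify g \<in> vec.span (critical_rank_one_tensors f)"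
    if f: "f \<in> symmetric_tensors - Z"
      and g: "is_arg_min (\<lambda>h. norm (f - h)) (\<lambda>h. h \<in> symmetric_tensors \<and> real_symmetric_rank h \<le> k) g"
    for f g k
  proof -
    have gs: "g \<in> symmetric_tensors" "real_symmetric_rank g \<le> k"
      and min: "\<And>h. h \<in> symmetric_tensors \<Longrightarrow> real_symmetric_rank h \<le> k \<Longrightarrow> norm (f - g) \<le> norm (f - h)"
      using g by (auto simp: is_arg_min_linorder)
    from rank_rep_rank[OF gs(1)] obtain c v
      where gr: "g = (\<Sum>i<real_symmetric_rank g. c i *\<^sub>R tensor_power (v i))" by (rule rank_repE)
    have "stationary_rep ?k0 f g (real_symmetric_rank g) c v"
      unfolding stationary_rep_def
    proof (intro conjI allI)
      show "g = (\<Sum>i<real_symmetric_rank g. c i *\<^sub>R tensor_power (v i))" by (rule gr)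
    next
      fix a b
      show "(\<Sum>m<real_symmetric_rank g. c m * (v m $ a * contr ?k0 f b (v m))) =
          (\<Sum>m<real_symmetric_rank g. c m * (v m $ b * contr ?k0 f a (v m)))"
        by (rule best_approximation_stationary[OF _ gr gs(2) min]) (use f in auto)
    qed
    moreover have "P f \<noteq> 0" "f \<in> symmetric_tensors" using f by (auto simp: Z_def)
    ultimately show ?thesis by (intro gen[unfolded stationary_in_span_def, rule_format])
  qed
  \<comment> \<open>\<open>f\<close> is its own best approximation when \<open>k\<close> is its
    rank.\<close>
  moreover have "complexify f \<in> vec.span (critical_rank_one_tensors f)"
    if f: "f \<in> symmetric_tensors - Z" for f
    by (rule best[OF f, of "real_symmetric_rank f"]) (use f in \<open>auto simp: is_arg_min_linorder\<close>)
  ultimately show ?thesis by (intro exI[of _ Z]) blast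
qed

end
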